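(* Let $\mathcal L$ be a first-order language, in either classical or continuous logic, which extends the language of groups. Let $\{G_i : i\in I\}$ be a family of $\mathcal L$-structures each of which expands an amenable group, let $\mathcal U$ be a countably incomplete ultrafilter on $I$, and let $G=\prod_{\mathcal U}G_i$. Suppose $\tau\colon G\to K$ is a definable group homomorphism, where $K$ is a compact Lie group. Then there are group homomorphisms $\tau_i\colon G_i\to K$, for $i\in I$, such that $\tau=\lim_{\mathcal U}\tau_i$, i.e. for every $a\in G$ and every representative $(a_i)_{i\in I}$ of $a$, $\tau(a)=\lim_{\mathcal U}\tau_i(a_i)$.
   Context: A (discrete) group is amenable if it admits a left-invariant finitely additive probability measure defined on all of its subsets. An ultrafilter $\mathcal U$ on $I$ is countably incomplete if it contains a countable family of sets whose common intersection is empty. For an $\mathcal L$-structure $M$ and a compact Hausdorff space $C$, a map $f\colon M^x\to C$ is definable if there is a continuous function $f^*\colon S_x(M)\to C$ on the space of complete types over $M$ with $f^*(\operatorname{tp}(a/M))=f(a)$ for all $a\in M^x$ (in classical logic this is equivalent to: for all closed $D\subseteq C$ and open $V\subseteq C$ with $D\subseteq V$, there is a definable set $X$ with $f^{-1}(D)\subseteq X\subseteq f^{-1}(V)$). Here $\tau_i$ are not required to be definable. *)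

theory Defs
  imports "HOL-Analysis.Analysis" "HOL-Algebra.Coset"
begin

section \<open>Amenable groups and ultrafilters\<close>

definition amenable_group :: "('a, 'z) monoid_scheme \<Rightarrow> bool" where
  "amenable_group G \<longleftrightarrow> group G \<and>
     (\<exists>\<mu> :: 'a set \<Rightarrow> real.
        (\<forall>A \<subseteq> carrier G. 0 \<le> \<mu> A) \<and>
        \<mu> (carrier G) = 1 \<and>
        (\<forall>A \<subseteq> carrier G. \<forall>B \<subseteq> carrier G. A \<inter> B = {} \<longrightarrow> \<mu> (A \<union> B) = \<mu> A + \<mu> B) \<and>
        (\<forall>g \<in> carrier G. \<forall>A \<subseteq> carrier G. \<mu> (g <#\<^bsub>G\<^esub> A) = \<mu> A))"

text \<open>An ultrafilter on the (nonempty) index type is a filter in the sense of the library; a set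
  \<open>S\<close> belongs to it iff \<open>\<forall>\<^sub>F i in \<U>. i \<in> S\<close>. Principal ultrafilters are allowed.\<close>

definition ultrafilter :: "'i filter \<Rightarrow> bool" where
  "ultrafilter \<U> \<longleftrightarrow>
     \<U> \<noteq> bot \<and> (\<forall>S. (\<forall>\<^sub>F i in \<U>. i \<in> S) \<or> (\<forall>\<^sub>F i in \<U>. i \<notin> S))"

definition countably_incomplete :: "'i filter \<Rightarrow> bool" where
  "countably_incomplete \<U> \<longleftrightarrow>
     (\<exists>\<F>. countable \<F> \<and> (\<forall>S \<in> \<F>. \<forall>\<^sub>F i in \<U>. i \<in> S) \<and> \<Inter>\<F> = {})"


section \<open>Lie groups\<close>

text \<open>Real \<open>n\<close>-space is the library's \<^const>\<open>Euclidean_space\<close>, whose points are the functions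
  \<open>nat \<Rightarrow> real\<close> vanishing from \<open>n\<close> on. In contrast to the class \<^class>\<open>euclidean_space\<close> this
  includes \<open>n = 0\<close>, which is needed for finite groups to be Lie groups.\<close>

primrec Ck_on :: "nat \<Rightarrow> nat \<Rightarrow> (nat \<Rightarrow> real) set \<Rightarrow> ((nat \<Rightarrow> real) \<Rightarrow> real) \<Rightarrow> bool" where
  "Ck_on 0 n V f \<longleftrightarrow> continuous_map (subtopology (Euclidean_space n) V) euclideanreal f"
| "Ck_on (Suc k) n V f \<longleftrightarrow>
     continuous_map (subtopology (Euclidean_space n) V) euclideanreal f \<and>
     (\<forall>i<n. \<exists>g. (\<forall>x\<in>V. ((\<lambda>t. f (x(i := t))) has_real_derivative g x) (at (x i))) \<and>
                Ck_on k n V g)"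

text \<open>Used only for open subsets \<open>V\<close> of \<open>n\<close>-space.\<close>

definition smooth_on :: "nat \<Rightarrow> (nat \<Rightarrow> real) set \<Rightarrow> ((nat \<Rightarrow> real) \<Rightarrow> nat \<Rightarrow> real) \<Rightarrow> bool" where
  "smooth_on n V f \<longleftrightarrow> (\<forall>k j. Ck_on k n V (\<lambda>x. f x j))"

type_synonym 'k chart = "'k set \<times> ('k \<Rightarrow> nat \<Rightarrow> real)"

definition is_chart :: "nat \<Rightarrow> 'k topology \<Rightarrow> 'k chart \<Rightarrow> bool" where
  "is_chart n T c \<longleftrightarrow> (case c of (V, \<phi>) \<Rightarrow>
     openin T V \<and> openin (Euclidean_space n) (\<phi> ` V) \<and>
     homeomorphic_map (subtopology T V) (subtopology (Euclidean_space n) (\<phi> ` V)) \<phi>)"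

definition smooth_atlas :: "nat \<Rightarrow> 'k topology \<Rightarrow> 'k chart set \<Rightarrow> bool" where
  "smooth_atlas n T \<A> \<longleftrightarrow>
     (\<forall>c \<in> \<A>. is_chart n T c) \<and>
     (\<Union>(V, \<phi>) \<in> \<A>. V) = topspace T \<and>
     (\<forall>(V, \<phi>) \<in> \<A>. \<forall>(W, \<psi>) \<in> \<A>. smooth_on n (\<phi> ` (V \<inter> W)) (\<lambda>x. \<psi> (inv_into V \<phi> x)))"

text \<open>The two halves of a point of \<open>2n\<close>-space, identified with pairs of points of \<open>n\<close>-space.\<close>

definition fst_half :: "nat \<Rightarrow> (nat \<Rightarrow> real) \<Rightarrow> nat \<Rightarrow> real" where
  "fst_half n z = (\<lambda>i. if i < n then z i else 0)"

definition snd_half :: "nat \<Rightarrow> (nat \<Rightarrow> real) \<Rightarrow> nat \<Rightarrow> real" where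
  "snd_half n z = (\<lambda>i. if i < n then z (n + i) else 0)"

definition Lie_group ::
  "nat \<Rightarrow> ('k, 'z) monoid_scheme \<Rightarrow> 'k topology \<Rightarrow> 'k chart set \<Rightarrow> bool" where
  "Lie_group n K T \<A> \<longleftrightarrow>
     group K \<and> topspace T = carrier K \<and> Hausdorff_space T \<and> second_countable T \<and>
     smooth_atlas n T \<A> \<and>
     continuous_map (prod_topology T T) T (\<lambda>(x, y). x \<otimes>\<^bsub>K\<^esub> y) \<and>
     continuous_map T T (\<lambda>x. inv\<^bsub>K\<^esub> x) \<and>
     (\<forall>(V, \<phi>) \<in> \<A>. \<forall>(W, \<psi>) \<in> \<A>. \<forall>(Z, \<theta>) \<in> \<A>.
        smooth_on (2 * n)
          {z \<in> topspace (Euclidean_space (2 * n)).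
             fst_half n z \<in> \<phi> ` V \<and> snd_half n z \<in> \<psi> ` W \<and>
             inv_into V \<phi> (fst_half n z) \<otimes>\<^bsub>K\<^esub> inv_into W \<psi> (snd_half n z) \<in> Z}
          (\<lambda>z. \<theta> (inv_into V \<phi> (fst_half n z) \<otimes>\<^bsub>K\<^esub> inv_into W \<psi> (snd_half n z)))) \<and>
     (\<forall>(V, \<phi>) \<in> \<A>. \<forall>(W, \<psi>) \<in> \<A>.
        smooth_on n
          {x \<in> \<phi> ` V. inv\<^bsub>K\<^esub> (inv_into V \<phi> x) \<in> W}
          (\<lambda>x. \<psi> (inv\<^bsub>K\<^esub> (inv_into V \<phi> x))))"


section \<open>Languages and terms\<close>

text \<open>A one-sorted first-order language with distinguished symbols of the language of groups.
  The symbols are sets rather than whole types, so that there may be no relation symbols.\<close>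

record ('f, 'r) lang =
  fun_syms :: "'f set"
  rel_syms :: "'r set"
  fun_arity :: "'f \<Rightarrow> nat"
  rel_arity :: "'r \<Rightarrow> nat"
  mult_sym :: 'f
  inv_sym :: 'f
  one_sym :: 'f

definition extends_group_language :: "('f, 'r, 'z) lang_scheme \<Rightarrow> bool" where
  "extends_group_language L \<longleftrightarrow>
     {mult_sym L, inv_sym L, one_sym L} \<subseteq> fun_syms L \<and>
     fun_arity L (mult_sym L) = 2 \<and> fun_arity L (inv_sym L) = 1 \<and> fun_arity L (one_sym L) = 0"

text \<open>The part of a structure common to classical and continuous logic.\<close>

record ('a, 'f) fun_structure =
  univ :: "'a set"
  fn :: "'f \<Rightarrow> 'a list \<Rightarrow> 'a"

definition tuples :: "'a set \<Rightarrow> nat \<Rightarrow> 'a list set" where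
  "tuples X n = {xs. set xs \<subseteq> X \<and> length xs = n}"

definition group_reduct ::
  "('f, 'r, 'y) lang_scheme \<Rightarrow> ('a, 'f, 'z) fun_structure_scheme \<Rightarrow> 'a monoid" where
  "group_reduct L M =
     \<lparr>carrier = univ M, mult = (\<lambda>x y. fn M (mult_sym L) [x, y]), one = fn M (one_sym L) []\<rparr>"

definition expands_amenable_group ::
  "('f, 'r, 'y) lang_scheme \<Rightarrow> ('a, 'f, 'z) fun_structure_scheme \<Rightarrow> bool" where
  "expands_amenable_group L M \<longleftrightarrow>
     amenable_group (group_reduct L M) \<and>
     (\<forall>x \<in> univ M. fn M (inv_sym L) [x] = inv\<^bsub>group_reduct L M\<^esub> x)"

text \<open>Terms and formulas may contain elements of a structure as parameters, so that
  \<open>L(M)\<close>-formulas need no separate language.\<close>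

datatype ('a, 'f) trm = Var nat | Param 'a | App 'f "('a, 'f) trm list"

fun trm_vars :: "('a, 'f) trm \<Rightarrow> nat set" where
  "trm_vars (Var x) = {x}"
| "trm_vars (Param a) = {}"
| "trm_vars (App f ts) = (\<Union>t \<in> set ts. trm_vars t)"

fun wf_trm :: "('f, 'r, 'z) lang_scheme \<Rightarrow> 'a set \<Rightarrow> ('a, 'f) trm \<Rightarrow> bool" where
  "wf_trm L X (Var x) \<longleftrightarrow> True"
| "wf_trm L X (Param a) \<longleftrightarrow> a \<in> X"
| "wf_trm L X (App f ts) \<longleftrightarrow>
     f \<in> fun_syms L \<and> length ts = fun_arity L f \<and> (\<forall>t \<in> set ts. wf_trm L X t)"

fun trm_val :: "('a, 'f, 'z) fun_structure_scheme \<Rightarrow> (nat \<Rightarrow> 'a) \<Rightarrow> ('a, 'f) trm \<Rightarrow> 'a" where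
  "trm_val M v (Var x) = v x"
| "trm_val M v (Param a) = a"
| "trm_val M v (App f ts) = fn M f (map (trm_val M v) ts)"


section \<open>Classical logic\<close>

record ('a, 'f, 'r) fo_structure = "('a, 'f) fun_structure" +
  rel :: "'r \<Rightarrow> 'a list \<Rightarrow> bool"

definition is_fo_structure :: "('f, 'r) lang \<Rightarrow> ('a, 'f, 'r) fo_structure \<Rightarrow> bool" where
  "is_fo_structure L M \<longleftrightarrow>
     univ M \<noteq> {} \<and> (\<forall>f \<in> fun_syms L. \<forall>xs \<in> tuples (univ M) (fun_arity L f). fn M f xs \<in> univ M)"

datatype ('a, 'f, 'r) fo_fm =
    Equal "('a, 'f) trm" "('a, 'f) trm"
  | Rel 'r "('a, 'f) trm list"
  | Neg "('a, 'f, 'r) fo_fm"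
  | Conj "('a, 'f, 'r) fo_fm" "('a, 'f, 'r) fo_fm"
  | Exists nat "('a, 'f, 'r) fo_fm"

fun fo_free :: "('a, 'f, 'r) fo_fm \<Rightarrow> nat set" where
  "fo_free (Equal s t) = trm_vars s \<union> trm_vars t"
| "fo_free (Rel r ts) = (\<Union>t \<in> set ts. trm_vars t)"
| "fo_free (Neg \<phi>) = fo_free \<phi>"
| "fo_free (Conj \<phi> \<psi>) = fo_free \<phi> \<union> fo_free \<psi>"
| "fo_free (Exists x \<phi>) = fo_free \<phi> - {x}"

fun wf_fo :: "('f, 'r) lang \<Rightarrow> 'a set \<Rightarrow> ('a, 'f, 'r) fo_fm \<Rightarrow> bool" where
  "wf_fo L X (Equal s t) \<longleftrightarrow> wf_trm L X s \<and> wf_trm L X t"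
| "wf_fo L X (Rel r ts) \<longleftrightarrow>
     r \<in> rel_syms L \<and> length ts = rel_arity L r \<and> (\<forall>t \<in> set ts. wf_trm L X t)"
| "wf_fo L X (Neg \<phi>) \<longleftrightarrow> wf_fo L X \<phi>"
| "wf_fo L X (Conj \<phi> \<psi>) \<longleftrightarrow> wf_fo L X \<phi> \<and> wf_fo L X \<psi>"
| "wf_fo L X (Exists x \<phi>) \<longleftrightarrow> wf_fo L X \<phi>"

fun fo_sat :: "('a, 'f, 'r) fo_structure \<Rightarrow> (nat \<Rightarrow> 'a) \<Rightarrow> ('a, 'f, 'r) fo_fm \<Rightarrow> bool" where
  "fo_sat M v (Equal s t) \<longleftrightarrow> trm_val M v s = trm_val M v t"
| "fo_sat M v (Rel r ts) \<longleftrightarrow> rel M r (map (trm_val M v) ts)"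
| "fo_sat M v (Neg \<phi>) \<longleftrightarrow> \<not> fo_sat M v \<phi>"
| "fo_sat M v (Conj \<phi> \<psi>) \<longleftrightarrow> fo_sat M v \<phi> \<and> fo_sat M v \<psi>"
| "fo_sat M v (Exists x \<phi>) \<longleftrightarrow> (\<exists>a \<in> univ M. fo_sat M (v(x := a)) \<phi>)"

text \<open>\<open>L(M)\<close>-formulas in the single free variable \<open>0\<close>; such a formula is evaluated at \<open>a\<close> under
  the constant assignment with value \<open>a\<close>.\<close>

definition fo_fms :: "('f, 'r) lang \<Rightarrow> ('a, 'f, 'r) fo_structure \<Rightarrow> ('a, 'f, 'r) fo_fm set" where
  "fo_fms L M = {\<phi>. wf_fo L (univ M) \<phi> \<and> fo_free \<phi> \<subseteq> {0}}"

definition fo_tp ::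
  "('f, 'r) lang \<Rightarrow> ('a, 'f, 'r) fo_structure \<Rightarrow> 'a \<Rightarrow> ('a, 'f, 'r) fo_fm set" where
  "fo_tp L M a = {\<phi> \<in> fo_fms L M. fo_sat M (\<lambda>_. a) \<phi>}"

text \<open>Complete types over \<open>M\<close>. By compactness, a set of \<open>L(M)\<close>-formulas is consistent with the
  elementary diagram of \<open>M\<close> iff it is finitely satisfiable in \<open>M\<close>; the latter avoids quantifying
  over elementary extensions, which live in arbitrary types.\<close>

definition fo_types ::
  "('f, 'r) lang \<Rightarrow> ('a, 'f, 'r) fo_structure \<Rightarrow> ('a, 'f, 'r) fo_fm set set" where
  "fo_types L M = {p. p \<subseteq> fo_fms L M \<and>
     (\<forall>\<Phi>. finite \<Phi> \<and> \<Phi> \<subseteq> p \<longrightarrow> (\<exists>a \<in> univ M. \<forall>\<phi> \<in> \<Phi>. fo_sat M (\<lambda>_. a) \<phi>)) \<and>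
     (\<forall>\<phi> \<in> fo_fms L M. \<phi> \<in> p \<or> Neg \<phi> \<in> p)}"

definition fo_type_space ::
  "('f, 'r) lang \<Rightarrow> ('a, 'f, 'r) fo_structure \<Rightarrow> ('a, 'f, 'r) fo_fm set topology" where
  "fo_type_space L M =
     topology_generated_by {{p \<in> fo_types L M. \<phi> \<in> p} | \<phi>. \<phi> \<in> fo_fms L M}"

definition fo_definable_map ::
  "('f, 'r) lang \<Rightarrow> ('a, 'f, 'r) fo_structure \<Rightarrow> 'c topology \<Rightarrow> ('a \<Rightarrow> 'c) \<Rightarrow> bool" where
  "fo_definable_map L M C f \<longleftrightarrow>
     (\<exists>g. continuous_map (fo_type_space L M) C g \<and> (\<forall>a \<in> univ M. g (fo_tp L M a) = f a))"

definition fo_class ::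
  "'i filter \<Rightarrow> ('i \<Rightarrow> ('a, 'f, 'r) fo_structure) \<Rightarrow> ('i \<Rightarrow> 'a) \<Rightarrow> ('i \<Rightarrow> 'a) set" where
  "fo_class \<U> M a = {b. (\<forall>i. b i \<in> univ (M i)) \<and> (\<forall>\<^sub>F i in \<U>. a i = b i)}"

text \<open>Elements are equivalence classes; symbols are interpreted on chosen representatives.\<close>

definition fo_ultraproduct ::
  "'i filter \<Rightarrow> ('i \<Rightarrow> ('a, 'f, 'r) fo_structure) \<Rightarrow> (('i \<Rightarrow> 'a) set, 'f, 'r) fo_structure" where
  "fo_ultraproduct \<U> M =
     \<lparr>univ = fo_class \<U> M ` {a. \<forall>i. a i \<in> univ (M i)},
      fn = (\<lambda>f As. fo_class \<U> M (\<lambda>i. fn (M i) f (map (\<lambda>A. (SOME a. a \<in> A) i) As))),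
      rel = (\<lambda>r As. \<forall>\<^sub>F i in \<U>. rel (M i) r (map (\<lambda>A. (SOME a. a \<in> A) i) As))\<rparr>"


section \<open>Continuous logic\<close>

text \<open>Bounded metric structures in the sense of Ben Yaacov, Berenstein, Henson and Usvyatsov: the
  language specifies a bound on the diameter, a closed bounded interval of values for each
  predicate symbol, and moduli of uniform continuity.\<close>

record ('f, 'r) metric_lang = "('f, 'r) lang" +
  diam_bound :: real
  pred_lo :: "'r \<Rightarrow> real"
  pred_hi :: "'r \<Rightarrow> real"
  fun_modulus :: "'f \<Rightarrow> real \<Rightarrow> real"
  pred_modulus :: "'r \<Rightarrow> real \<Rightarrow> real"

definition is_metric_lang :: "('f, 'r) metric_lang \<Rightarrow> bool" where
  "is_metric_lang L \<longleftrightarrow>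
     (\<forall>r \<in> rel_syms L. pred_lo L r \<le> pred_hi L r) \<and>
     (\<forall>f \<in> fun_syms L. \<forall>\<epsilon>>0. fun_modulus L f \<epsilon> > 0) \<and>
     (\<forall>r \<in> rel_syms L. \<forall>\<epsilon>>0. pred_modulus L r \<epsilon> > 0)"

record ('a, 'f, 'r) metric_structure = "('a, 'f) fun_structure" +
  metr :: "'a \<Rightarrow> 'a \<Rightarrow> real"
  pred :: "'r \<Rightarrow> 'a list \<Rightarrow> real"

definition is_metric_structure ::
  "('f, 'r) metric_lang \<Rightarrow> ('a, 'f, 'r) metric_structure \<Rightarrow> bool" where
  "is_metric_structure L M \<longleftrightarrow>
     univ M \<noteq> {} \<and>
     Metric_space (univ M) (metr M) \<and> Metric_space.mcomplete (univ M) (metr M) \<and>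
     (\<forall>x \<in> univ M. \<forall>y \<in> univ M. metr M x y \<le> diam_bound L) \<and>
     (\<forall>f \<in> fun_syms L. \<forall>xs \<in> tuples (univ M) (fun_arity L f). fn M f xs \<in> univ M) \<and>
     (\<forall>r \<in> rel_syms L. \<forall>xs \<in> tuples (univ M) (rel_arity L r).
        pred M r xs \<in> {pred_lo L r .. pred_hi L r}) \<and>
     (\<forall>f \<in> fun_syms L. \<forall>\<epsilon>>0.
        \<forall>xs \<in> tuples (univ M) (fun_arity L f). \<forall>ys \<in> tuples (univ M) (fun_arity L f).
          (\<forall>k < fun_arity L f. metr M (xs ! k) (ys ! k) < fun_modulus L f \<epsilon>) \<longrightarrow>
          metr M (fn M f xs) (fn M f ys) \<le> \<epsilon>) \<and>
     (\<forall>r \<in> rel_syms L. \<forall>\<epsilon>>0.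
        \<forall>xs \<in> tuples (univ M) (rel_arity L r). \<forall>ys \<in> tuples (univ M) (rel_arity L r).
          (\<forall>k < rel_arity L r. metr M (xs ! k) (ys ! k) < pred_modulus L r \<epsilon>) \<longrightarrow>
          \<bar>pred M r xs - pred M r ys\<bar> \<le> \<epsilon>)"

text \<open>The connective in \<open>Conn u \<phi>s\<close> is a continuous real function \<open>u\<close> on \<open>n\<close>-space,
  where \<open>n\<close> is the length of \<open>\<phi>s\<close>.\<close>

datatype ('a, 'f, 'r) metric_fm =
    Dist "('a, 'f) trm" "('a, 'f) trm"
  | Pred 'r "('a, 'f) trm list"
  | Conn "(nat \<Rightarrow> real) \<Rightarrow> real" "('a, 'f, 'r) metric_fm list"
  | SupQ nat "('a, 'f, 'r) metric_fm"
  | InfQ nat "('a, 'f, 'r) metric_fm"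

fun metric_free :: "('a, 'f, 'r) metric_fm \<Rightarrow> nat set" where
  "metric_free (Dist s t) = trm_vars s \<union> trm_vars t"
| "metric_free (Pred r ts) = (\<Union>t \<in> set ts. trm_vars t)"
| "metric_free (Conn u \<phi>s) = (\<Union>\<phi> \<in> set \<phi>s. metric_free \<phi>)"
| "metric_free (SupQ x \<phi>) = metric_free \<phi> - {x}"
| "metric_free (InfQ x \<phi>) = metric_free \<phi> - {x}"

fun wf_metric :: "('f, 'r) metric_lang \<Rightarrow> 'a set \<Rightarrow> ('a, 'f, 'r) metric_fm \<Rightarrow> bool" where
  "wf_metric L X (Dist s t) \<longleftrightarrow> wf_trm L X s \<and> wf_trm L X t"
| "wf_metric L X (Pred r ts) \<longleftrightarrow>
     r \<in> rel_syms L \<and> length ts = rel_arity L r \<and> (\<forall>t \<in> set ts. wf_trm L X t)"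
| "wf_metric L X (Conn u \<phi>s) \<longleftrightarrow>
     continuous_map (Euclidean_space (length \<phi>s)) euclideanreal u \<and>
     (\<forall>\<phi> \<in> set \<phi>s. wf_metric L X \<phi>)"
| "wf_metric L X (SupQ x \<phi>) \<longleftrightarrow> wf_metric L X \<phi>"
| "wf_metric L X (InfQ x \<phi>) \<longleftrightarrow> wf_metric L X \<phi>"

fun metric_val ::
  "('a, 'f, 'r) metric_structure \<Rightarrow> (nat \<Rightarrow> 'a) \<Rightarrow> ('a, 'f, 'r) metric_fm \<Rightarrow> real" where
  "metric_val M v (Dist s t) = metr M (trm_val M v s) (trm_val M v t)"
| "metric_val M v (Pred r ts) = pred M r (map (trm_val M v) ts)"
| "metric_val M v (Conn u \<phi>s) =
     u (\<lambda>i. if i < length \<phi>s then map (metric_val M v) \<phi>s ! i else 0)"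
| "metric_val M v (SupQ x \<phi>) = (SUP a \<in> univ M. metric_val M (v(x := a)) \<phi>)"
| "metric_val M v (InfQ x \<phi>) = (INF a \<in> univ M. metric_val M (v(x := a)) \<phi>)"

definition metric_fms ::
  "('f, 'r) metric_lang \<Rightarrow> ('a, 'f, 'r) metric_structure \<Rightarrow> ('a, 'f, 'r) metric_fm set" where
  "metric_fms L M = {\<phi>. wf_metric L (univ M) \<phi> \<and> metric_free \<phi> \<subseteq> {0}}"

definition metric_tp ::
  "('f, 'r) metric_lang \<Rightarrow> ('a, 'f, 'r) metric_structure \<Rightarrow> 'a \<Rightarrow> ('a, 'f, 'r) metric_fm \<Rightarrow> real"
  where
  "metric_tp L M a = (\<lambda>\<phi> \<in> metric_fms L M. metric_val M (\<lambda>_. a) \<phi>)"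

text \<open>A complete type over \<open>M\<close> is given by the values it assigns to the \<open>L(M)\<close>-formulas, i.e.
  \<open>p \<phi> = t\<close> stands for the condition \<open>\<bar>\<phi>(x) - t\<bar> = 0\<close>. By compactness, these conditions are
  consistent with the elementary diagram of \<open>M\<close> iff they are finitely approximately satisfiable
  in \<open>M\<close>. The logic topology is the coarsest one making all evaluations \<open>p \<mapsto> p \<phi>\<close> continuous.\<close>

definition metric_types ::
  "('f, 'r) metric_lang \<Rightarrow> ('a, 'f, 'r) metric_structure \<Rightarrow> (('a, 'f, 'r) metric_fm \<Rightarrow> real) set"
  where
  "metric_types L M = {p \<in> extensional (metric_fms L M).
     \<forall>\<Phi> \<epsilon>. finite \<Phi> \<and> \<Phi> \<subseteq> metric_fms L M \<and> \<epsilon> > 0 \<longrightarrow>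
       (\<exists>a \<in> univ M. \<forall>\<phi> \<in> \<Phi>. \<bar>metric_val M (\<lambda>_. a) \<phi> - p \<phi>\<bar> < \<epsilon>)}"

definition metric_type_space ::
  "('f, 'r) metric_lang \<Rightarrow> ('a, 'f, 'r) metric_structure \<Rightarrow>
   (('a, 'f, 'r) metric_fm \<Rightarrow> real) topology" where
  "metric_type_space L M =
     subtopology (product_topology (\<lambda>_. euclideanreal) (metric_fms L M)) (metric_types L M)"

definition metric_definable_map ::
  "('f, 'r) metric_lang \<Rightarrow> ('a, 'f, 'r) metric_structure \<Rightarrow> 'c topology \<Rightarrow> ('a \<Rightarrow> 'c) \<Rightarrow> bool"
  where
  "metric_definable_map L M C f \<longleftrightarrow>
     (\<exists>g. continuous_map (metric_type_space L M) C g \<and>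
          (\<forall>a \<in> univ M. g (metric_tp L M a) = f a))"

definition metric_class ::
  "'i filter \<Rightarrow> ('i \<Rightarrow> ('a, 'f, 'r) metric_structure) \<Rightarrow> ('i \<Rightarrow> 'a) \<Rightarrow> ('i \<Rightarrow> 'a) set" where
  "metric_class \<U> M a =
     {b. (\<forall>i. b i \<in> univ (M i)) \<and> ((\<lambda>i. metr (M i) (a i) (b i)) \<longlongrightarrow> 0) \<U>}"

definition metric_ultraproduct ::
  "'i filter \<Rightarrow> ('i \<Rightarrow> ('a, 'f, 'r) metric_structure) \<Rightarrow>
   (('i \<Rightarrow> 'a) set, 'f, 'r) metric_structure" where
  "metric_ultraproduct \<U> M =
     \<lparr>univ = metric_class \<U> M ` {a. \<forall>i. a i \<in> univ (M i)},
      fn = (\<lambda>f As. metric_class \<U> M (\<lambda>i. fn (M i) f (map (\<lambda>A. (SOME a. a \<in> A) i) As))),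
      metr = (\<lambda>A B. Lim \<U> (\<lambda>i. metr (M i) ((SOME a. a \<in> A) i) ((SOME b. b \<in> B) i))),
      pred = (\<lambda>r As. Lim \<U> (\<lambda>i. pred (M i) r (map (\<lambda>A. (SOME a. a \<in> A) i) As)))\<rparr>"

end

theory Submission
  imports Defs
begin

text \<open>
  By definability and compactness of the type space, the preimages under \<open>\<tau>\<close> of a closed set and of
  an open neighbourhood of it are separated by an internal subset of the ultraproduct. Covering \<open>K\<close>
  by finitely many small sets, one obtains maps \<open>f\<^sub>i : G\<^sub>i \<rightarrow> K\<close> whose ultralimit is \<open>\<tau>\<close> up to a
  prescribed error; since \<open>\<tau>\<close> is multiplicative, \<open>f\<^sub>i\<close> is uniformly almost multiplicative for
  \<open>\<U>\<close>-most \<open>i\<close>. By Ulam stability \<open>f\<^sub>i\<close> is close to a homomorphism, and countable incompleteness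
  allows the error to tend to \<open>0\<close> along \<open>\<U>\<close>.

  Ulam stability is Kazhdan's averaging argument. The only consequence of smoothness that it needs
  is a chart \<open>l\<close> at the identity with \<open>\<bar>l (xy) - l x - l y\<bar> \<le> C \<bar>l x\<bar> \<bar>l y\<bar>\<close>: then powers grow linearly
  in \<open>l\<close>, so conjugations are uniformly Lipschitz in \<open>l\<close>, and being almost additive they are linear
  up to a quadratic error. Hence replacing \<open>f x\<close> by the product of \<open>f x\<close> with the mean over \<open>y\<close> of
  \<open>f(x)\<inverse> f(xy) f(y)\<inverse>\<close>, taken in the chart, turns a defect \<open>\<delta>\<close> into \<open>O(\<delta>\<^sup>2)\<close>, and iterating this
  converges to a homomorphism.
\<close>

text \<open>Two uniformities shape the argument. The radius in \<open>Ulam_stability\<close> is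
  fixed before \<open>H\<close> and \<open>f\<close>, because it is applied to all factors at once;
  and the constants for conjugation must not depend on the conjugating element, which is where
  compactness of \<open>K\<close> enters. The chart is only known to be almost additive: no
  exponential map or invariant norm is used, so the linear part of a conjugation is recovered by
  rescaling. The mean is finitely additive and left invariant, which dictates the order of the
  factors in the correcting cocycle. The averaged functions are rounded to finitely many values, so
  that their mean is a finite sum; the rounding error is of the order of the square of the defect
  and does not spoil the improvement. Finally, homomorphisms of a fixed accuracy approximate \<tau>
  along a section only on a large set that depends on the section. Different accuracies are
  therefore compared with each other, uniformly over each factor, before they are merged.\<close>

section \<open>Finitely additive means\<close>

text \<open>The integral of a finite-valued vector function against a finitely additive measure. It
  is meaningful only when \<open>v\<close> takes finitely many values on \<open>H\<close>, hence the
  finiteness hypotheses below.\<close>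

definition simple_mean :: "('a set \<Rightarrow> real) \<Rightarrow> 'a set \<Rightarrow> ('a \<Rightarrow> 'v::real_vector) \<Rightarrow> 'v" where
  "simple_mean \<mu> H v = (\<Sum>w\<in>v ` H. \<mu> {y\<in>H. v y = w} *\<^sub>R w)"

text \<open>Relative to a subspace, since chart coordinates fill only a finite-dimensional part of
  the ambient Banach space and the limit maps constructed below are controlled only there.\<close>

definition linear_on_subspace :: "'v::real_vector set \<Rightarrow> ('v \<Rightarrow> 'w::real_vector) \<Rightarrow> bool" where
  "linear_on_subspace W A \<longleftrightarrow>
     (\<forall>u\<in>W. \<forall>v\<in>W. A (u + v) = A u + A v) \<and> (\<forall>u\<in>W. \<forall>c. A (c *\<^sub>R u) = c *\<^sub>R A u)"

lemma linear_on_subspace_sum: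
  assumes "subspace W" "linear_on_subspace W A" "finite I" "\<And>i. i \<in> I \<Longrightarrow> x i \<in> W"
  shows "A (\<Sum>i\<in>I. c i *\<^sub>R x i) = (\<Sum>i\<in>I. c i *\<^sub>R A (x i))"
  using assms(3,4)
proof (induction I rule: finite_induct)
  case empty
  have "A (0 *\<^sub>R 0) = 0 *\<^sub>R A 0"
    using assms(1,2) subspace_0 unfolding linear_on_subspace_def by blast
  then show ?case by simp
next
  case (insert i I)
  have "c i *\<^sub>R x i \<in> W" "(\<Sum>i\<in>I. c i *\<^sub>R x i) \<in> W"
    using insert.prems assms(1) by (auto intro!: subspace_sum subspace_mul)
  then show ?case
    using insert assms(2) unfolding linear_on_subspace_def by simp
qed

locale finitely_additive_probability =
  fixes \<mu> :: "'a set \<Rightarrow> real" and H :: "'a set"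
  assumes nonneg: "A \<subseteq> H \<Longrightarrow> 0 \<le> \<mu> A"
    and total: "\<mu> H = 1"
    and additive: "A \<subseteq> H \<Longrightarrow> B \<subseteq> H \<Longrightarrow> A \<inter> B = {} \<Longrightarrow> \<mu> (A \<union> B) = \<mu> A + \<mu> B"
begin

lemma measure_fibres:
  assumes "finite C" "A \<subseteq> H"
  shows "\<mu> {y\<in>A. q y \<in> C} = (\<Sum>c\<in>C. \<mu> {y\<in>A. q y = c})"
  using assms(1)
proof (induction C rule: finite_induct)
  case empty
  have "\<mu> ({} \<union> {}) = \<mu> {} + \<mu> {}" by (rule additive) auto
  then show ?case by simp
next
  case (insert c C)
  have "{y\<in>A. q y \<in> insert c C} = {y\<in>A. q y = c} \<union> {y\<in>A. q y \<in> C}" by auto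
  also have "\<mu> \<dots> = \<mu> {y\<in>A. q y = c} + \<mu> {y\<in>A. q y \<in> C}"
    using insert.hyps assms(2) by (intro additive) auto
  finally show ?case using insert by simp
qed

text \<open>The mean may be computed along any finer finite partition, given by the fibres of
  \<open>q\<close>. This makes two functions comparable: take for \<open>q\<close> the pair of them,
  as in \<open>simple_mean_add\<close>.\<close>

lemma simple_mean_fibres:
  assumes fin: "finite (q ` H)" and v: "\<And>y. y \<in> H \<Longrightarrow> v y = h (q y)"
  shows "simple_mean \<mu> H v = (\<Sum>c\<in>q ` H. \<mu> {y\<in>H. q y = c} *\<^sub>R h c)"
proof -
  have im: "v ` H = h ` (q ` H)" using v by (auto simp: image_iff)
  have fib: "\<mu> {y\<in>H. v y = w} *\<^sub>R w = (\<Sum>c\<in>{c\<in>q ` H. h c = w}. \<mu> {y\<in>H. q y = c} *\<^sub>R h c)" for w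
  proof -
    have "{y\<in>H. v y = w} = {y\<in>H. q y \<in> {c\<in>q ` H. h c = w}}" using v by auto
    then have "\<mu> {y\<in>H. v y = w} = (\<Sum>c\<in>{c\<in>q ` H. h c = w}. \<mu> {y\<in>H. q y = c})"
      using measure_fibres[of "{c\<in>q ` H. h c = w}" H q] fin by simp
    then show ?thesis by (simp add: scaleR_sum_left)
  qed
  show ?thesis
    unfolding simple_mean_def im fib by (rule sum.image_gen[OF fin, symmetric])
qed

lemma simple_mean_add:
  assumes "finite (v ` H)" "finite (w ` H)"
  shows "simple_mean \<mu> H (\<lambda>y. v y + w y) = simple_mean \<mu> H v + simple_mean \<mu> H w"
proof -
  let ?q = "\<lambda>y. (v y, w y)"
  have fin: "finite (?q ` H)"
    by (rule finite_subset[of _ "v ` H \<times> w ` H"]) (use assms in auto)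
  show ?thesis
    using simple_mean_fibres[of ?q "\<lambda>y. v y + w y" "\<lambda>(a, b). a + b", OF fin]
      simple_mean_fibres[of ?q v fst, OF fin] simple_mean_fibres[of ?q w snd, OF fin]
    by (simp add: sum.distrib[symmetric] scaleR_add_right[symmetric] case_prod_beta)
qed

lemma simple_mean_linear:
  assumes "finite (v ` H)" "v ` H \<subseteq> W" "subspace W" "linear_on_subspace W A"
  shows "simple_mean \<mu> H (\<lambda>y. A (v y)) = A (simple_mean \<mu> H v)"
proof -
  have "simple_mean \<mu> H (\<lambda>y. A (v y)) = (\<Sum>c\<in>v ` H. \<mu> {y\<in>H. v y = c} *\<^sub>R A c)"
    by (rule simple_mean_fibres) (use assms in auto)
  also have "\<dots> = A (\<Sum>c\<in>v ` H. \<mu> {y\<in>H. v y = c} *\<^sub>R c)"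
    by (rule linear_on_subspace_sum[OF assms(3,4,1), symmetric]) (use assms(2) in auto)
  finally show ?thesis unfolding simple_mean_def .
qed

lemma simple_mean_const: "simple_mean \<mu> H (\<lambda>y. c) = c"
proof -
  have "\<mu> {} + \<mu> {} = \<mu> ({} \<union> {})" by (subst additive) auto
  then have "H \<noteq> {}" using total by auto
  then show ?thesis unfolding simple_mean_def by (simp add: image_constant_conv total)
qed

lemma simple_mean_in_subspace:
  assumes "v ` H \<subseteq> W" "subspace W"
  shows "simple_mean \<mu> H v \<in> W"
  unfolding simple_mean_def using assms by (auto intro!: subspace_sum subspace_mul)

lemma norm_simple_mean_le:
  fixes v :: "'a \<Rightarrow> 'v::real_normed_vector"
  assumes "finite (v ` H)" "\<And>y. y \<in> H \<Longrightarrow> norm (v y) \<le> b"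
  shows "norm (simple_mean \<mu> H v) \<le> b"
proof -
  have "norm (simple_mean \<mu> H v) \<le> (\<Sum>w\<in>v ` H. \<mu> {y\<in>H. v y = w} * b)"
    unfolding simple_mean_def
    by (rule sum_norm_le) (auto intro!: mult_left_mono assms(2) nonneg simp: abs_of_nonneg nonneg)
  also have "\<dots> = \<mu> {y\<in>H. v y \<in> v ` H} * b"
    using measure_fibres[OF assms(1), of H v] by (simp add: sum_distrib_right)
  also have "{y\<in>H. v y \<in> v ` H} = H" by auto
  finally show ?thesis using total by simp
qed

lemma norm_simple_mean_diff_le:
  fixes v w :: "'a \<Rightarrow> 'v::real_normed_vector"
  assumes fin: "finite (v ` H)" "finite (w ` H)" and b: "\<And>y. y \<in> H \<Longrightarrow> norm (v y - w y) \<le> b"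
  shows "norm (simple_mean \<mu> H v - simple_mean \<mu> H w) \<le> b"
proof -
  have fin': "finite ((\<lambda>y. v y - w y) ` H)"
    by (rule finite_subset[of _ "(\<lambda>(a, b). a - b) ` (v ` H \<times> w ` H)"]) (use fin in auto)
  have "simple_mean \<mu> H v = simple_mean \<mu> H (\<lambda>y. (v y - w y) + w y)" by simp
  also have "\<dots> = simple_mean \<mu> H (\<lambda>y. v y - w y) + simple_mean \<mu> H w"
    by (rule simple_mean_add[OF fin' fin(2)])
  finally show ?thesis using norm_simple_mean_le[OF fin' b] by simp
qed

text \<open>Left translation by \<open>z\<close> carries the fibre of the translated function over
  \<open>w\<close> onto the fibre of \<open>v\<close> over \<open>w\<close>.\<close>

lemma simple_mean_translate:
  assumes G: "group G" "carrier G = H" and z: "z \<in> H"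
    and inv: "\<And>g A. g \<in> H \<Longrightarrow> A \<subseteq> H \<Longrightarrow> \<mu> (g <#\<^bsub>G\<^esub> A) = \<mu> A"
  shows "simple_mean \<mu> H (\<lambda>y. v (z \<otimes>\<^bsub>G\<^esub> y)) = simple_mean \<mu> H v"
proof -
  interpret group G by fact
  have bij: "(\<lambda>y. z \<otimes>\<^bsub>G\<^esub> y) ` H = H"
    using z G(2) surj_const_mult by auto
  have im: "(\<lambda>y. v (z \<otimes>\<^bsub>G\<^esub> y)) ` H = v ` H"
    using bij by (metis image_image)
  have "\<mu> {y\<in>H. v (z \<otimes>\<^bsub>G\<^esub> y) = w} = \<mu> {y\<in>H. v y = w}" for w
  proof -
    have "z <#\<^bsub>G\<^esub> {y\<in>H. v (z \<otimes>\<^bsub>G\<^esub> y) = w} = {y\<in>H. v y = w}"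
    proof
      show "{y\<in>H. v y = w} \<subseteq> z <#\<^bsub>G\<^esub> {y\<in>H. v (z \<otimes>\<^bsub>G\<^esub> y) = w}"
      proof
        fix y assume y: "y \<in> {y\<in>H. v y = w}"
        then obtain y' where "y' \<in> H" "y = z \<otimes>\<^bsub>G\<^esub> y'" using bij by blast
        with y show "y \<in> z <#\<^bsub>G\<^esub> {y\<in>H. v (z \<otimes>\<^bsub>G\<^esub> y) = w}"
          unfolding l_coset_def by auto
      qed
    qed (use z G(2) in \<open>auto simp: l_coset_def\<close>)
    then show ?thesis using inv[OF z, of "{y\<in>H. v (z \<otimes>\<^bsub>G\<^esub> y) = w}"] by auto
  qed
  then show ?thesis unfolding simple_mean_def im by simp
qed

end

text \<open>Hyers' construction: \<open>A u\<close> is the limit of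
  \<open>2 ^ m \<psi>(u / 2 ^ m)\<close>. Because the additivity defect is bounded by a bilinear
  expression, shrinking the arguments makes the rescaled defect decay like \<open>2 ^ (-m)\<close>.
  Hence the limit exists, is exactly additive, and differs from \<psi> by a quadratic term. The
  linear bound on \<psi> passes to the limit and upgrades additivity to homogeneity.\<close>

lemma almost_additive_near_linear:
  fixes \<psi> :: "'v::real_normed_vector \<Rightarrow> 'w::banach"
  assumes W: "subspace W" and s: "s > 0" and C: "C \<ge> 0"
    and add: "\<And>u v. u \<in> W \<Longrightarrow> v \<in> W \<Longrightarrow> norm u < s \<Longrightarrow> norm v < s \<Longrightarrow> norm (u + v) < s
        \<Longrightarrow> norm (\<psi> (u + v) - \<psi> u - \<psi> v) \<le> C * norm u * norm v"
    and bound: "\<And>u. u \<in> W \<Longrightarrow> norm u < s \<Longrightarrow> norm (\<psi> u) \<le> B * norm u"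
  obtains A where "linear_on_subspace W A" "\<And>u. u \<in> W \<Longrightarrow> norm (A u) \<le> B * norm u"
    "\<And>u. u \<in> W \<Longrightarrow> norm u < s \<Longrightarrow> norm (\<psi> u - A u) \<le> C * (norm u)\<^sup>2"
proof -
  define a where "a u m = 2 ^ m *\<^sub>R \<psi> ((1 / 2 ^ m) *\<^sub>R u)" for u m
  define A where "A u = lim (a u)" for u
  have small: "\<forall>\<^sub>F m in sequentially. norm ((1 / 2 ^ m) *\<^sub>R u) < s" for u :: 'v
  proof -
    have "(\<lambda>m. (1 / 2) ^ m * norm u) \<longlonglongrightarrow> 0 * norm u"
      by (intro tendsto_intros LIMSEQ_power_zero) auto
    then have "\<forall>\<^sub>F m in sequentially. (1 / 2) ^ m * norm u < s"
      using s by (intro order_tendstoD(2)[of _ 0]) auto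
    then show ?thesis by (simp add: power_one_over)
  qed
  \<comment> \<open>Splitting the argument into two equal halves costs
    \<open>C |u|^2 / 4 ^ (m + 1)\<close>, which is then multiplied by \<open>2 ^ m\<close>.\<close>
  have step: "norm (a u (Suc m) - a u m) \<le> (C * (norm u)\<^sup>2 / 4) * (1 / 2) ^ m"
    if u: "u \<in> W" and m: "norm ((1 / 2 ^ m) *\<^sub>R u) < s" for u m
  proof -
    let ?h = "(1 / 2 ^ Suc m) *\<^sub>R u"
    have hW: "?h \<in> W" using W u by (rule subspace_mul)
    have hh: "?h + ?h = (1 / 2 ^ m) *\<^sub>R u"
      by (simp add: scaleR_add_left[symmetric] field_simps)
    have "norm ?h \<le> norm ((1 / 2 ^ m) *\<^sub>R u)" by (simp add: field_simps)
    then have "norm (\<psi> (?h + ?h) - \<psi> ?h - \<psi> ?h) \<le> C * norm ?h * norm ?h"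
      using m hh by (intro add hW) auto
    then have *: "norm (\<psi> ?h + \<psi> ?h - \<psi> ((1 / 2 ^ m) *\<^sub>R u)) \<le> C * norm ?h * norm ?h"
      unfolding hh by (metis diff_diff_eq norm_minus_commute)
    have "a u (Suc m) - a u m = 2 ^ m *\<^sub>R (\<psi> ?h + \<psi> ?h - \<psi> ((1 / 2 ^ m) *\<^sub>R u))"
      unfolding a_def by (simp add: algebra_simps scaleR_2[symmetric])
    then have "norm (a u (Suc m) - a u m) = 2 ^ m * norm (\<psi> ?h + \<psi> ?h - \<psi> ((1 / 2 ^ m) *\<^sub>R u))"
      by (simp only: norm_scaleR power_abs abs_numeral)
    also have "\<dots> \<le> 2 ^ m * (C * norm ?h * norm ?h)"
      by (intro mult_left_mono *) simp
    also have "\<dots> = (C * (norm u)\<^sup>2 / 4) * (1 / 2) ^ m"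
      by (simp add: field_simps power2_eq_square power_one_over)
    finally show ?thesis .
  qed
  have lim: "a u \<longlonglongrightarrow> A u" if u: "u \<in> W" for u
  proof -
    have "\<forall>\<^sub>F m in sequentially. norm (a u (Suc m) - a u m) \<le> (C * (norm u)\<^sup>2 / 4) * (1 / 2) ^ m"
      using small[of u] by eventually_elim (rule step[OF u])
    moreover have "summable (\<lambda>m. (C * (norm u)\<^sup>2 / 4) * (1 / 2) ^ m :: real)"
      by (intro summable_mult summable_geometric) auto
    ultimately have "summable (\<lambda>m. a u (Suc m) - a u m)"
      by (rule summable_comparison_test_ev)
    then have "convergent (\<lambda>n. \<Sum>m<n. a u (Suc m) - a u m)"
      by (simp add: summable_iff_convergent)
    then have "convergent (\<lambda>n. a u n - a u 0)" by (simp add: sum_lessThan_telescope)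
    then have "convergent (\<lambda>n. (a u n - a u 0) + a u 0)"
      by (intro convergent_add convergent_const)
    then show ?thesis by (simp add: A_def convergent_LIMSEQ_iff)
  qed
  have bdd: "norm (A u) \<le> B * norm u" if u: "u \<in> W" for u
  proof (rule tendsto_upperbound[OF tendsto_norm[OF lim[OF u]]])
    show "\<forall>\<^sub>F m in sequentially. norm (a u m) \<le> B * norm u"
      using small[of u]
    proof eventually_elim
      case (elim m)
      have "norm (a u m) \<le> 2 ^ m * (B * norm ((1 / 2 ^ m) *\<^sub>R u))"
        unfolding a_def using bound[OF subspace_mul[OF W u] elim] by (simp add: field_simps)
      then show ?case by simp
    qed
  qed simp
  have Aadd: "A (u + v) = A u + A v" if u: "u \<in> W" and v: "v \<in> W" for u v
  proof -
    have uv: "u + v \<in> W" using W u v by (rule subspace_add)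
    have "(\<lambda>m. norm (a (u + v) m - a u m - a v m)) \<longlonglongrightarrow> norm (A (u + v) - A u - A v)"
      by (intro tendsto_intros lim u v uv)
    moreover have "(\<lambda>m. norm (a (u + v) m - a u m - a v m)) \<longlonglongrightarrow> 0"
    proof (rule tendsto_sandwich[OF _ _ tendsto_const])
      show "\<forall>\<^sub>F m in sequentially. norm (a (u + v) m - a u m - a v m)
          \<le> (C * norm u * norm v) * (1 / 2) ^ m"
        using small[of u] small[of v] small[of "u + v"]
      proof eventually_elim
        case (elim m)
        let ?c = "1 / 2 ^ m :: real"
        have "norm (\<psi> (?c *\<^sub>R u + ?c *\<^sub>R v) - \<psi> (?c *\<^sub>R u) - \<psi> (?c *\<^sub>R v))
            \<le> C * norm (?c *\<^sub>R u) * norm (?c *\<^sub>R v)"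
          using elim by (intro add subspace_mul[OF W] u v) (auto simp: scaleR_add_right)
        moreover have "a (u + v) m - a u m - a v m
            = 2 ^ m *\<^sub>R (\<psi> (?c *\<^sub>R u + ?c *\<^sub>R v) - \<psi> (?c *\<^sub>R u) - \<psi> (?c *\<^sub>R v))"
          unfolding a_def by (simp add: scaleR_add_right scaleR_diff_right)
        ultimately have "norm (a (u + v) m - a u m - a v m)
            \<le> 2 ^ m * (C * norm (?c *\<^sub>R u) * norm (?c *\<^sub>R v))"
          by (simp only: norm_scaleR power_abs abs_numeral) (intro mult_left_mono, auto)
        also have "\<dots> = (C * norm u * norm v) * (1 / 2) ^ m"
          by (simp add: field_simps power_one_over)
        finally show ?case .
      qed
      have "(\<lambda>m. (C * norm u * norm v) * (1 / 2) ^ m) \<longlonglongrightarrow> (C * norm u * norm v) * 0"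
        by (intro tendsto_intros LIMSEQ_power_zero) auto
      then show "(\<lambda>m. (C * norm u * norm v) * (1 / 2) ^ m) \<longlonglongrightarrow> 0" by simp
    qed auto
    ultimately have "norm (A (u + v) - A u - A v) = 0" by (rule LIMSEQ_unique)
    then show ?thesis by (simp add: algebra_simps)
  qed
  have Anat: "A (real n *\<^sub>R u) = real n *\<^sub>R A u" if u: "u \<in> W" for n u
  proof (induction n)
    case 0
    have "A (0 + 0) = A 0 + A 0" using Aadd W subspace_0 by blast
    then show ?case by simp
  next
    case (Suc n)
    have "A (u + real n *\<^sub>R u) = A u + A (real n *\<^sub>R u)"
      by (intro Aadd u subspace_mul[OF W])
    then show ?case using Suc by (simp add: algebra_simps)
  qed
  have Aneg: "A (- u) = - A u" if u: "u \<in> W" for u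
    using Aadd[OF u subspace_neg[OF W u]] Anat[OF u, of 0] by (simp add: eq_neg_iff_add_eq_0 add.commute)
  have Aint: "A (of_int k *\<^sub>R u) = of_int k *\<^sub>R A u" if u: "u \<in> W" for k u
  proof (cases k rule: int_cases2)
    case (nonneg n) then show ?thesis using Anat[OF u] by simp
  next
    case (nonpos n)
    then show ?thesis using Anat[OF u, of n] Aneg[OF subspace_mul[OF W u]] by simp
  qed
  have Ascale: "A (c *\<^sub>R u) = c *\<^sub>R A u" if u: "u \<in> W" for c u
  proof -
    \<comment> \<open>Boundedness upgrades homogeneity over the integers to homogeneity over the reals, by
      comparing \<open>n c\<close> with its integer part.\<close>
    have key: "norm (A (c *\<^sub>R u) - c *\<^sub>R A u) \<le> (2 * (B * norm u)) / real (Suc n)" for n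
    proof -
      let ?N = "real (Suc n)"
      define k where "k = \<lfloor>?N * c\<rfloor>"
      define f where "f = ?N * c - of_int k"
      have f: "0 \<le> f" "f \<le> 1" unfolding f_def k_def by linarith+
      have fu: "f *\<^sub>R u \<in> W" "of_int k *\<^sub>R u \<in> W" by (intro subspace_mul[OF W u])+
      have "?N *\<^sub>R A (c *\<^sub>R u) = A (?N *\<^sub>R c *\<^sub>R u)"
        by (rule Anat[symmetric]) (rule subspace_mul[OF W u])
      also have "?N *\<^sub>R c *\<^sub>R u = of_int k *\<^sub>R u + f *\<^sub>R u"
        unfolding f_def by (simp add: algebra_simps)
      also have "A \<dots> = of_int k *\<^sub>R A u + A (f *\<^sub>R u)"
        using Aadd[OF fu(2,1)] Aint[OF u] by simp
      finally have "?N *\<^sub>R (A (c *\<^sub>R u) - c *\<^sub>R A u) = A (f *\<^sub>R u) - f *\<^sub>R A u"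
        unfolding f_def by (simp add: algebra_simps)
      then have "?N * norm (A (c *\<^sub>R u) - c *\<^sub>R A u) = norm (A (f *\<^sub>R u) - f *\<^sub>R A u)"
        by (metis abs_of_nat norm_scaleR)
      also have "\<dots> \<le> norm (A (f *\<^sub>R u)) + norm (f *\<^sub>R A u)" by (rule norm_triangle_ineq4)
      also have "\<dots> \<le> B * norm (f *\<^sub>R u) + f * (B * norm u)"
        using bdd[OF fu(1)] mult_left_mono[OF bdd[OF u] f(1)] f(1) by (intro add_mono) simp_all
      also have "\<dots> = f * (2 * (B * norm u))" using f by simp
      also have "\<dots> \<le> 2 * (B * norm u)"
        using f bdd[OF u] norm_ge_zero[of "A u"] by (intro mult_left_le_one_le) linarith+
      finally show ?thesis by (simp add: field_simps)
    qed
    have "(\<lambda>n. (2 * (B * norm u)) / real (Suc n)) \<longlonglongrightarrow> 0"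
      by (rule LIMSEQ_Suc[OF lim_const_over_n])
    then have "norm (A (c *\<^sub>R u) - c *\<^sub>R A u) \<le> 0"
      by (rule tendsto_lowerbound) (use key in auto)
    then show ?thesis by simp
  qed
  have near: "norm (\<psi> u - A u) \<le> C * (norm u)\<^sup>2" if u: "u \<in> W" and us: "norm u < s" for u
  proof -
    have small': "norm ((1 / 2 ^ m) *\<^sub>R u) < s" for m
    proof -
      have "norm u / 2 ^ m \<le> norm u / 1" by (intro divide_left_mono) auto
      then have "norm ((1 / 2 ^ m) *\<^sub>R u) \<le> norm u" by simp
      then show ?thesis using us by simp
    qed
    \<comment> \<open>The partial sum of the geometric series from \<open>step\<close>, in closed
      form; the resulting constant \<open>C / 2\<close> is weakened to \<open>C\<close>
      below.\<close>
    have part: "norm (a u m - a u 0) \<le> (C * (norm u)\<^sup>2 / 2) * (1 - (1 / 2) ^ m)" for m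
    proof (induction m)
      case (Suc m)
      have "norm (a u (Suc m) - a u 0) \<le> norm (a u (Suc m) - a u m) + norm (a u m - a u 0)"
        using norm_triangle_ineq[of "a u (Suc m) - a u m" "a u m - a u 0"] by simp
      also have "\<dots> \<le> (C * (norm u)\<^sup>2 / 4) * (1 / 2) ^ m + (C * (norm u)\<^sup>2 / 2) * (1 - (1 / 2) ^ m)"
        using step[OF u small'] Suc by (intro add_mono)
      also have "\<dots> = (C * (norm u)\<^sup>2 / 2) * (1 - (1 / 2) ^ Suc m)" by (simp add: field_simps)
      finally show ?case .
    qed auto
    have "norm (a u m - a u 0) \<le> C * (norm u)\<^sup>2" for m
    proof -
      have "(C * (norm u)\<^sup>2 / 2) * (1 - (1 / 2) ^ m) \<le> (C * (norm u)\<^sup>2 / 2) * 1"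
        using C by (intro mult_left_mono) auto
      also have "\<dots> \<le> C * (norm u)\<^sup>2" using C by simp
      finally show ?thesis using part[of m] by linarith
    qed
    moreover have "(\<lambda>m. norm (a u m - a u 0)) \<longlonglongrightarrow> norm (A u - a u 0)"
      by (intro tendsto_intros lim u)
    ultimately have "norm (A u - a u 0) \<le> C * (norm u)\<^sup>2"
      by (intro tendsto_upperbound[where F = sequentially and f = "\<lambda>m. norm (a u m - a u 0)"]) auto
    then show ?thesis by (simp add: a_def norm_minus_commute)
  qed
  show ?thesis
    by (rule that[of A]) (use Aadd Ascale bdd near in \<open>auto simp: linear_on_subspace_def\<close>)
qed

section \<open>Ultrafilters and compact groups\<close>

text \<open>Ultrafilters are the minimal proper filters, found by Zorn's lemma in the reversed
  order. A chain of proper filters has a proper infimum, since whatever holds eventually in the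
  infimum already holds eventually in a member.\<close>

lemma ultrafilter_below:
  assumes "F \<noteq> bot"
  obtains U where "U \<le> F" "ultrafilter U"
proof -
  let ?A = "{G. G \<le> F \<and> G \<noteq> bot}"
  have "\<exists>m\<in>?A. \<forall>a\<in>?A. m \<ge> a \<longrightarrow> a = m"
  proof (rule predicate_Zorn)
    show "partial_order_on ?A (relation_of (\<ge>) ?A)"
      by (rule partial_order_on_relation_ofI) auto
    fix C assume C: "C \<in> Chains (relation_of (\<ge>) ?A)"
    show "\<exists>u\<in>?A. \<forall>a\<in>C. a \<ge> u"
    proof (cases "C = {}")
      case True
      then show ?thesis using assms by auto
    next
      case False
      have sub: "C \<subseteq> ?A" and chain: "\<And>G H. G \<in> C \<Longrightarrow> H \<in> C \<Longrightarrow> G \<le> H \<or> H \<le> G"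
        using C unfolding Chains_def relation_of_def by auto
      have "\<not> eventually (\<lambda>_. False) (Inf C)"
      proof (subst eventually_Inf_base[OF False])
        show "\<exists>x\<in>C. x \<le> inf G H" if "G \<in> C" "H \<in> C" for G H
          using chain[OF that] that by (auto intro!: bexI[of _ "inf G H"] simp: inf_absorb1 inf_absorb2)
        show "\<not> (\<exists>b\<in>C. eventually (\<lambda>_. False) b)"
          using sub by (auto simp: trivial_limit_def[symmetric])
      qed
      then have "Inf C \<noteq> bot" by (simp add: trivial_limit_def)
      moreover obtain G where "G \<in> C" using False by blast
      then have "Inf C \<le> F" using sub by (auto intro: Inf_lower2)
      ultimately show ?thesis by (intro bexI[of _ "Inf C"]) (auto intro: Inf_lower)
    qed
  qed
  then obtain U where U: "U \<le> F" "U \<noteq> bot" and max: "\<And>G. G \<le> U \<Longrightarrow> G \<noteq> bot \<Longrightarrow> G = U"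
    by (auto intro: order_trans)
  have "(\<forall>\<^sub>F i in U. i \<in> S) \<or> (\<forall>\<^sub>F i in U. i \<notin> S)" for S
  \<comment> \<open>Intersecting with \<open>S\<close> either destroys properness, so that the
    complement of \<open>S\<close> is large, or by minimality changes nothing.\<close>
  proof (cases "inf U (principal S) = bot")
    case True
    then have "eventually (\<lambda>_. False) (inf U (principal S))" by simp
    then show ?thesis by (simp add: eventually_inf_principal)
  next
    case False
    then have "inf U (principal S) = U" by (intro max) auto
    moreover have "\<forall>\<^sub>F i in inf U (principal S). i \<in> S" by (simp add: eventually_inf_principal)
    ultimately show ?thesis by simp
  qed
  then show ?thesis using U that unfolding ultrafilter_def by blast
qed

lemma ultrafilter_not_eventually:
  assumes "ultrafilter U"
  shows "\<not> eventually P U \<longleftrightarrow> (\<forall>\<^sub>F i in U. \<not> P i)"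
proof
  assume "\<not> eventually P U"
  then show "\<forall>\<^sub>F i in U. \<not> P i"
    using assms[unfolded ultrafilter_def, THEN conjunct2, rule_format, of "{i. P i}"] by auto
next
  assume *: "\<forall>\<^sub>F i in U. \<not> P i"
  show "\<not> eventually P U"
  proof
    assume "eventually P U"
    with * have "eventually (\<lambda>_. False) U" by eventually_elim simp
    then show False using assms by (simp add: ultrafilter_def trivial_limit_def)
  qed
qed

text \<open>Pigeonhole: a choice among finitely many alternatives is constant on a large
  set.\<close>

lemma ultrafilter_eventually_bex_finite:
  assumes "ultrafilter U" "finite A" "\<forall>\<^sub>F i in U. \<exists>p\<in>A. Q p i"
  shows "\<exists>p\<in>A. \<forall>\<^sub>F i in U. Q p i"
proof (rule ccontr)
  assume "\<not> ?thesis"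
  then have "\<forall>p\<in>A. \<forall>\<^sub>F i in U. \<not> Q p i" by (simp add: ultrafilter_not_eventually[OF assms(1)])
  then have "\<forall>\<^sub>F i in U. \<forall>p\<in>A. \<not> Q p i" by (rule eventually_ball_finite[OF assms(2)])
  then have "\<not> (\<forall>\<^sub>F i in U. \<exists>p\<in>A. Q p i)"
    by (subst ultrafilter_not_eventually[OF assms(1)]) simp
  then show False using assms(3) by simp
qed

text \<open>If no point were a limit, each point would have a neighbourhood that \<open>f\<close>
  eventually avoids; a finite subcover would then be avoided entirely.\<close>

lemma compact_space_ultrafilter_limit:
  assumes U: "ultrafilter U" and T: "compact_space T" and f: "\<forall>\<^sub>F i in U. f i \<in> topspace T"
  obtains l where "limitin T f l U"
proof -
  have "\<exists>l. limitin T f l U"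
  proof (rule ccontr)
    assume no: "\<nexists>l. limitin T f l U"
    have "\<exists>V. openin T V \<and> l \<in> V \<and> (\<forall>\<^sub>F i in U. f i \<notin> V)" if "l \<in> topspace T" for l
    proof -
      have "\<exists>V. openin T V \<and> l \<in> V \<and> \<not> (\<forall>\<^sub>F i in U. f i \<in> V)"
        using no that unfolding limitin_def by blast
      then show ?thesis by (simp add: ultrafilter_not_eventually[OF U])
    qed
    then obtain V where V: "\<And>l. l \<in> topspace T \<Longrightarrow> openin T (V l) \<and> l \<in> V l \<and> (\<forall>\<^sub>F i in U. f i \<notin> V l)"
      by metis
    have "\<exists>\<F>. finite \<F> \<and> \<F> \<subseteq> V ` topspace T \<and> topspace T \<subseteq> \<Union>\<F>"
      by (rule T[unfolded compact_space_alt, rule_format]) (use V in auto)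
    then obtain F where F: "finite F" "F \<subseteq> V ` topspace T" "topspace T \<subseteq> \<Union>F" by blast
    have "\<forall>\<^sub>F i in U. \<forall>X\<in>F. f i \<notin> X"
      using F V by (intro eventually_ball_finite) auto
    with f have "eventually (\<lambda>_. False) U" by eventually_elim (use F in auto)
    then show False using U by (simp add: ultrafilter_def trivial_limit_def)
  qed
  then show ?thesis using that by blast
qed

locale compact_topological_group = group K for K (structure) +
  fixes T
  assumes topspace_eq: "topspace T = carrier K"
    and compact: "compact_space T" and Hausdorff: "Hausdorff_space T"
    and continuous_mult: "continuous_map (prod_topology T T) T (\<lambda>(x, y). x \<otimes> y)"
    and continuous_inv: "continuous_map T T (\<lambda>x. inv x)"
begin

lemma inv_mult_cancel [simp]:
  "x \<in> carrier K \<Longrightarrow> y \<in> carrier K \<Longrightarrow> inv x \<otimes> (x \<otimes> y) = y"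
  "x \<in> carrier K \<Longrightarrow> y \<in> carrier K \<Longrightarrow> x \<otimes> (inv x \<otimes> y) = y"
  by (simp_all add: m_assoc[symmetric])

lemma continuous_map_group_mult:
  "continuous_map X T f \<Longrightarrow> continuous_map X T g \<Longrightarrow> continuous_map X T (\<lambda>x. f x \<otimes> g x)"
  using continuous_map_compose[OF _ continuous_mult, of X "\<lambda>x. (f x, g x)"]
  by (simp add: continuous_map_pairedI o_def)

lemma continuous_map_group_inv:
  "continuous_map X T f \<Longrightarrow> continuous_map X T (\<lambda>x. inv (f x))"
  using continuous_map_compose[OF _ continuous_inv, of X f] by (simp add: o_def)

lemma limitin_group_mult:
  assumes "limitin T f a F" "limitin T g b F"
  shows "limitin T (\<lambda>i. f i \<otimes> g i) (a \<otimes> b) F"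
proof -
  have "limitin (prod_topology T T) (\<lambda>i. (f i, g i)) (a, b) F"
    using assms by (simp add: limitin_pairwise o_def)
  from continuous_map_limit[OF continuous_mult this] show ?thesis by (simp add: o_def)
qed

lemma limitin_group_inv:
  "limitin T f a F \<Longrightarrow> limitin T (\<lambda>i. inv (f i)) (inv a) F"
  using continuous_map_limit[OF continuous_inv, of f a F] by (simp add: o_def)

lemma quotient_neighbourhood:
  assumes "openin T N" "\<one> \<in> N"
  obtains N' where "openin T N'" "\<one> \<in> N'" "\<And>p q. p \<in> N' \<Longrightarrow> q \<in> N' \<Longrightarrow> inv q \<otimes> p \<in> N"
proof -
  have "continuous_map (prod_topology T T) T (\<lambda>z. inv (fst z) \<otimes> snd z)"
    by (intro continuous_map_group_mult continuous_map_group_inv continuous_map_fst continuous_map_snd)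
  then have "openin (prod_topology T T) {z \<in> topspace (prod_topology T T). inv (fst z) \<otimes> snd z \<in> N}"
    using assms(1) by (rule openin_continuous_map_preimage)
  moreover have "(\<one>, \<one>) \<in> {z \<in> topspace (prod_topology T T). inv (fst z) \<otimes> snd z \<in> N}"
    using assms(2) by (simp add: topspace_eq)
  ultimately have "\<exists>A B. openin T A \<and> openin T B \<and> \<one> \<in> A \<and> \<one> \<in> B \<and>
      A \<times> B \<subseteq> {z \<in> topspace (prod_topology T T). inv (fst z) \<otimes> snd z \<in> N}"
    unfolding openin_prod_topology_alt by blast
  then obtain A B where AB: "openin T A" "openin T B" "\<one> \<in> A" "\<one> \<in> B"
    "A \<times> B \<subseteq> {z \<in> topspace (prod_topology T T). inv (fst z) \<otimes> snd z \<in> N}"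
    by blast
  show ?thesis
  proof (rule that[of "A \<inter> B"])
    show "inv q \<otimes> p \<in> N" if "p \<in> A \<inter> B" "q \<in> A \<inter> B" for p q
      using AB(5) that by auto
  qed (use AB in auto)
qed

text \<open>Compactness makes \<open>N'\<close> independent of \<open>k\<close>: the set of pairs
  \<open>(k, x)\<close> with \<open>k x k^-1\<close> in \<open>N\<close> is open and contains all
  pairs \<open>(k, \<one>)\<close>, so the tube lemma applies.\<close>

lemma conjugation_equicontinuous:
  assumes "openin T N" "\<one> \<in> N"
  obtains N' where "openin T N'" "\<one> \<in> N'"
    "\<And>k x. k \<in> carrier K \<Longrightarrow> x \<in> N' \<Longrightarrow> k \<otimes> x \<otimes> inv k \<in> N"
proof -
  let ?W = "{z \<in> topspace (prod_topology T T). fst z \<otimes> snd z \<otimes> inv (fst z) \<in> N}"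
  have "continuous_map (prod_topology T T) T (\<lambda>z. fst z \<otimes> snd z \<otimes> inv (fst z))"
    by (intro continuous_map_group_mult continuous_map_group_inv continuous_map_fst continuous_map_snd)
  then have "openin (prod_topology T T) ?W"
    using assms(1) by (rule openin_continuous_map_preimage)
  moreover have "compactin T (carrier K)" using compact by (simp add: compact_space_def topspace_eq)
  moreover have "carrier K \<times> {\<one>} \<subseteq> ?W" using assms(2) by (auto simp: topspace_eq)
  ultimately obtain A B where "openin T B" "\<one> \<in> B" "carrier K \<subseteq> A" "A \<times> B \<subseteq> ?W"
    using tube_lemma_left[of T T ?W "carrier K" \<one>] by (auto simp: topspace_eq)
  then show ?thesis using that[of B] by fastforce
qed

lemma closed_neighbourhood:
  assumes "openin T N" "x \<in> N"
  obtains A D where "openin T A" "closedin T D" "x \<in> A" "A \<subseteq> D" "D \<subseteq> N"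
proof -
  have "regular_space T"
    using compact Hausdorff by (simp add: compact_Hausdorff_imp_regular_space)
  then have "neighbourhood_base_of (closedin T) T" by (simp add: neighbourhood_base_of_closedin)
  then show ?thesis
    using assms that unfolding neighbourhood_base_of by blast
qed

lemma conj_nat_pow:
  assumes "k \<in> carrier K" "x \<in> carrier K"
  shows "(k \<otimes> x \<otimes> inv k) [^] (n::nat) = k \<otimes> x [^] n \<otimes> inv k"
  using assms by (induction n) (simp_all add: m_assoc)

end

section \<open>Ulam stability\<close>

text \<open>An abstract Lie chart at the identity. The model space \<open>W\<close> is a subspace of
  a Banach type, so the dimension does not enter the types. The inequality in \<open>mult\<close> is
  the second-order estimate for the product in coordinates. The assumption \<open>rounding\<close>
  expresses total boundedness of balls in \<open>W\<close>, in the form in which it is applied: a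
  finite-valued map that stays in the same ball.\<close>

locale almost_additive_chart = compact_topological_group K T for K (structure) and T +
  fixes W :: "'v::banach set" and V :: "'a set" and l :: "'a \<Rightarrow> 'v" and R C :: real
  assumes W: "subspace W" and R: "0 < R" and C: "0 \<le> C"
    and V: "V \<subseteq> carrier K" and one_V: "\<one> \<in> V" and l_one: "l \<one> = 0"
    and l_W: "x \<in> V \<Longrightarrow> l x \<in> W" and inj: "inj_on l V"
    and surj: "u \<in> W \<Longrightarrow> norm u < R \<Longrightarrow> \<exists>x\<in>V. l x = u"
    and open_ball: "0 < s \<Longrightarrow> s \<le> R \<Longrightarrow> openin T {x\<in>V. norm (l x) < s}"
    and ball_base: "openin T N \<Longrightarrow> \<one> \<in> N \<Longrightarrow> \<exists>s>0. {x\<in>V. norm (l x) < s} \<subseteq> N"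
    and mult: "x \<in> V \<Longrightarrow> y \<in> V \<Longrightarrow> norm (l x) < R \<Longrightarrow> norm (l y) < R \<Longrightarrow>
        x \<otimes> y \<in> V \<and> norm (l (x \<otimes> y) - l x - l y) \<le> C * norm (l x) * norm (l y)"
    and rounding: "0 < \<eta> \<Longrightarrow> 0 < d \<Longrightarrow> \<exists>\<rho>. finite (\<rho> ` {u\<in>W. norm u \<le> d}) \<and>
        (\<forall>u\<in>W. norm u \<le> d \<longrightarrow> \<rho> u \<in> W \<and> norm (\<rho> u) \<le> d \<and> norm (\<rho> u - u) \<le> \<eta>)"
begin

section \<open>Metric estimates in the chart\<close>

definition ballV :: "real \<Rightarrow> 'a set" where "ballV s = {x\<in>V. norm (l x) < s}"

lemma ballV_carrier: "x \<in> ballV s \<Longrightarrow> x \<in> carrier K"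
  using V by (auto simp: ballV_def)

lemma ballV_mono: "s \<le> t \<Longrightarrow> ballV s \<subseteq> ballV t"
  by (auto simp: ballV_def)

lemma one_ballV: "0 < s \<Longrightarrow> \<one> \<in> ballV s"
  by (simp add: ballV_def one_V l_one)

lemma ballV_base:
  assumes "openin T N" "\<one> \<in> N" "0 < t"
  obtains s where "0 < s" "s \<le> t" "ballV s \<subseteq> N"
proof -
  obtain s where "s > 0" "{x\<in>V. norm (l x) < s} \<subseteq> N" using ball_base assms by blast
  then show ?thesis using that[of "min s t"] assms(3) by (auto simp: ballV_def)
qed

lemma mult_bound:
  assumes "x \<in> V" "y \<in> V" "norm (l x) \<le> a" "norm (l y) \<le> b" "a < R" "b < R"
  shows "x \<otimes> y \<in> V" "norm (l (x \<otimes> y) - l x - l y) \<le> C * a * b"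
    "norm (l (x \<otimes> y)) \<le> a + b + C * a * b"
proof -
  have *: "x \<otimes> y \<in> V" "norm (l (x \<otimes> y) - l x - l y) \<le> C * norm (l x) * norm (l y)"
    using mult assms by auto
  show "x \<otimes> y \<in> V" by fact
  have "C * norm (l x) * norm (l y) \<le> C * a * b"
    using assms(3,4) C order_trans[OF norm_ge_zero assms(3)] by (intro mult_mono) auto
  with * show 1: "norm (l (x \<otimes> y) - l x - l y) \<le> C * a * b" by linarith
  have "norm (l (x \<otimes> y)) \<le> norm (l (x \<otimes> y) - l x - l y) + norm (l x) + norm (l y)"
    using norm_triangle_ineq[of "l (x \<otimes> y) - l x - l y" "l x + l y"] norm_triangle_ineq[of "l x" "l y"]
    by simp
  with 1 assms show "norm (l (x \<otimes> y)) \<le> a + b + C * a * b" by linarith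
qed

text \<open>The estimate for two factors, applied twice. With \<open>C t \<le> 1\<close> the first
  product has size at most \<open>3 t\<close>, so the errors add up to
  \<open>C t t + C (3 t) t\<close>, and the total size is at most
  \<open>3 t + t + 3 t\<close>.\<close>

lemma mult3_bound:
  assumes "x \<in> V" "y \<in> V" "z \<in> V" "norm (l x) \<le> t" "norm (l y) \<le> t" "norm (l z) \<le> t"
    and t: "3 * t < R" "C * t \<le> 1" "0 \<le> t"
  shows "x \<otimes> y \<otimes> z \<in> V" "norm (l (x \<otimes> y \<otimes> z) - l x - l y - l z) \<le> 4 * C * t\<^sup>2"
    "norm (l (x \<otimes> y \<otimes> z)) \<le> 7 * t"
proof -
  have tR: "t < R" using t by linarith
  note xy = mult_bound[OF assms(1,2,4,5) tR tR]
  have Ct: "C * t * t \<le> t" using mult_right_mono[OF t(2,3)] by simp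
  then have xy3: "norm (l (x \<otimes> y)) \<le> 3 * t" using xy by linarith
  note xyz = mult_bound[OF xy(1) assms(3) xy3 assms(6) t(1) tR]
  show "x \<otimes> y \<otimes> z \<in> V" by fact
  have "norm (l (x \<otimes> y \<otimes> z) - l x - l y - l z)
      \<le> norm (l (x \<otimes> y \<otimes> z) - l (x \<otimes> y) - l z) + norm (l (x \<otimes> y) - l x - l y)"
    using norm_triangle_ineq[of "l (x \<otimes> y \<otimes> z) - l (x \<otimes> y) - l z" "l (x \<otimes> y) - l x - l y"]
    by (simp add: algebra_simps)
  also have "\<dots> \<le> C * (3 * t) * t + C * t * t" using xyz xy by linarith
  finally show "norm (l (x \<otimes> y \<otimes> z) - l x - l y - l z) \<le> 4 * C * t\<^sup>2"
    by (simp add: power2_eq_square algebra_simps)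
  show "norm (l (x \<otimes> y \<otimes> z)) \<le> 7 * t" using xyz Ct by (simp add: algebra_simps)
qed

text \<open>Coordinate differences control group quotients. For \<open>w = q^-1 p\<close>, so that
  \<open>p = q w\<close>, the chart gives \<open>|l p - l q - l w| \<le> C |l q| |l w|\<close>. Once
  \<open>C |l q| \<le> 1/4\<close> this error is absorbed into \<open>|l w|\<close>, which is then
  at most \<open>4/3 |l p - l q|\<close>, rounded up to the factor 2. Continuity of the quotient
  first puts \<open>w\<close> in the domain of the estimate.\<close>

lemma quotient_bound:
  obtains r where "0 < r" "r \<le> R"
    "\<And>p q. p \<in> ballV r \<Longrightarrow> q \<in> ballV r \<Longrightarrow>
       inv q \<otimes> p \<in> V \<and> norm (l (inv q \<otimes> p)) \<le> 2 * norm (l p - l q)"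
proof -
  define r0 where "r0 = min R (1 / (4 * (C + 1)))"
  have r0: "0 < r0" "r0 \<le> R" using R C by (auto simp: r0_def)
  have "C * r0 \<le> C * (1 / (4 * (C + 1)))" using C by (intro mult_left_mono) (auto simp: r0_def)
  also have "\<dots> \<le> 1 / 4" using C by (simp add: field_simps)
  finally have Cr0: "C * r0 \<le> 1 / 4" .
  have "openin T (ballV r0)" unfolding ballV_def using r0 by (rule open_ball)
  from quotient_neighbourhood[OF this one_ballV[OF r0(1)]] obtain N where
    N: "openin T N" "\<one> \<in> N" "\<And>p q. p \<in> N \<Longrightarrow> q \<in> N \<Longrightarrow> inv q \<otimes> p \<in> ballV r0" by blast
  obtain r where r: "0 < r" "r \<le> r0" "ballV r \<subseteq> N" using ballV_base[OF N(1,2) r0(1)] by blast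
  show ?thesis
  proof (rule that[OF r(1)])
    show "r \<le> R" using r r0 by linarith
    fix p q assume pq: "p \<in> ballV r" "q \<in> ballV r"
    let ?w = "inv q \<otimes> p"
    have w: "?w \<in> V" "norm (l ?w) < r0" using N(3) pq r(3) by (auto simp: ballV_def)
    have q: "q \<in> V" "norm (l q) < r0" using pq r by (auto simp: ballV_def)
    have "q \<otimes> ?w = p" using pq by (simp add: ballV_carrier)
    then have "norm (l p - l q - l ?w) \<le> C * norm (l q) * norm (l ?w)"
      using mult[OF q(1) w(1)] q(2) w(2) r0 by simp
    also have "\<dots> \<le> (1 / 4) * norm (l ?w)"
    proof (rule mult_right_mono)
      have "C * norm (l q) \<le> C * r0" using q C by (intro mult_left_mono) auto
      then show "C * norm (l q) \<le> 1 / 4" using Cr0 by linarith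
    qed simp
    finally have "norm (l p - l q - l ?w) \<le> (1 / 4) * norm (l ?w)" .
    moreover have "norm (l ?w) \<le> norm (l p - l q) + norm (l p - l q - l ?w)"
      using norm_triangle_ineq4[of "l p - l q" "l p - l q - l ?w"] by simp
    ultimately have "norm (l ?w) \<le> 2 * norm (l p - l q)" using norm_ge_zero[of "l ?w"] by linarith
    with w show "?w \<in> V \<and> norm (l ?w) \<le> 2 * norm (l p - l q)" by simp
  qed
qed

text \<open>Every further factor adds at most \<open>(1 + 1/4) |l x|\<close>, crudely
  \<open>2 |l x|\<close>, and the smallness of \<open>2 m |l x|\<close> keeps all powers up to
  \<open>m\<close> inside the range of the product estimate.\<close>

lemma nat_pow_upper:
  assumes x: "x \<in> V" and s: "s \<le> R" "C * s \<le> 1 / 4" and m: "2 * real m * norm (l x) < s" "0 < m"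
    and j: "j \<le> m"
  shows "x [^] j \<in> V \<and> norm (l (x [^] j)) \<le> 2 * real j * norm (l x)"
  using j
proof (induction j)
  case 0
  then show ?case by (simp add: one_V l_one)
next
  case (Suc j)
  have IH: "x [^] j \<in> V" "norm (l (x [^] j)) \<le> 2 * real j * norm (l x)" using Suc by auto
  have mono: "2 * real j * norm (l x) \<le> 2 * real m * norm (l x)"
    "1 * norm (l x) \<le> 2 * real m * norm (l x)"
    using Suc.prems m(2) by (intro mult_right_mono; simp)+
  have bd: "norm (l (x [^] j)) < s" "norm (l x) < s" using IH mono m(1) by linarith+
  have *: "x [^] j \<otimes> x \<in> V"
    "norm (l (x [^] j \<otimes> x)) \<le> norm (l (x [^] j)) + norm (l x) + C * norm (l (x [^] j)) * norm (l x)"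
    using mult_bound[OF IH(1) x order_refl order_refl] bd s by auto
  have "C * norm (l (x [^] j)) * norm (l x) \<le> (C * s) * norm (l x)"
    using bd C by (intro mult_right_mono mult_left_mono) auto
  also have "\<dots> \<le> (1 / 4) * norm (l x)" using s by (intro mult_right_mono) auto
  finally have "norm (l (x [^] j \<otimes> x)) \<le> 2 * real j * norm (l x) + 2 * norm (l x)"
    using * IH norm_ge_zero[of "l x"] by linarith
  then show ?case using * by (simp add: algebra_simps)
qed

text \<open>As long as the powers remain in the ball, each step contributes \<open>l x\<close> up to
  a quarter of its size. Hence three quarters of \<open>m |l x|\<close> is at most
  \<open>|l (x ^ m)|\<close>.\<close>

lemma nat_pow_lower:
  assumes s: "s \<le> R" "C * s \<le> 1 / 4" and pow: "\<And>j. j \<le> m \<Longrightarrow> x [^] j \<in> ballV s"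
    and m: "0 < m" and x: "x \<in> carrier K"
  shows "real m * norm (l x) \<le> 4 / 3 * s"
proof -
  have x1: "x \<in> V" "norm (l x) < s" using pow[of 1] m x by (auto simp: ballV_def)
  have "norm (l (x [^] j) - real j *\<^sub>R l x) \<le> real j * norm (l x) / 4" if "j \<le> m" for j
    using that
  proof (induction j)
    case 0
    then show ?case by (simp add: l_one)
  next
    case (Suc j)
    have j: "x [^] j \<in> V" "norm (l (x [^] j)) < s" using pow[of j] Suc.prems by (auto simp: ballV_def)
    have "norm (l (x [^] j \<otimes> x) - l (x [^] j) - l x) \<le> C * norm (l (x [^] j)) * norm (l x)"
      using mult j x1 s by auto
    also have "\<dots> \<le> (C * s) * norm (l x)"
      using j C by (intro mult_right_mono mult_left_mono) auto
    also have "\<dots> \<le> (1 / 4) * norm (l x)" using s by (intro mult_right_mono) auto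
    finally have "norm (l (x [^] j \<otimes> x) - l (x [^] j) - l x) \<le> (1 / 4) * norm (l x)" .
    moreover have "norm (l (x [^] j \<otimes> x) - real (Suc j) *\<^sub>R l x)
        \<le> norm (l (x [^] j \<otimes> x) - l (x [^] j) - l x) + norm (l (x [^] j) - real j *\<^sub>R l x)"
      using norm_triangle_ineq[of "l (x [^] j \<otimes> x) - l (x [^] j) - l x" "l (x [^] j) - real j *\<^sub>R l x"]
      by (simp add: algebra_simps)
    ultimately show ?case using Suc by (simp add: algebra_simps)
  qed
  from this[of m] have "norm (l (x [^] m) - real m *\<^sub>R l x) \<le> real m * norm (l x) / 4" by simp
  moreover have "norm (real m *\<^sub>R l x) \<le> norm (l (x [^] m)) + norm (l (x [^] m) - real m *\<^sub>R l x)"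
    using norm_triangle_ineq4[of "l (x [^] m)" "l (x [^] m) - real m *\<^sub>R l x"] by simp
  moreover have "norm (l (x [^] m)) < s" using pow[of m] by (auto simp: ballV_def)
  ultimately show ?thesis by simp
qed

text \<open>Since \<open>\<bar>l (x ^ m)\<bar>\<close> is comparable to \<open>m \<bar>l x\<bar>\<close>, the size of \<open>l x\<close> is determined by how long
  the powers of \<open>x\<close> stay in a fixed neighbourhood, which equicontinuity of conjugation controls.\<close>

lemma conjugation_bound:
  obtains s B where "0 < s" "1 \<le> B"
    "\<And>k x. k \<in> carrier K \<Longrightarrow> x \<in> ballV s \<Longrightarrow>
       k \<otimes> x \<otimes> inv k \<in> V \<and> norm (l (k \<otimes> x \<otimes> inv k)) \<le> B * norm (l x)"
proof -
  define r where "r = min R (1 / (4 * (C + 1)))"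
  have r: "0 < r" "r \<le> R" using R C by (auto simp: r_def)
  have "C * r \<le> C * (1 / (4 * (C + 1)))" using C by (intro mult_left_mono) (auto simp: r_def)
  also have "\<dots> \<le> 1 / 4" using C by (simp add: field_simps)
  finally have Cr: "C * r \<le> 1 / 4" .
  have "openin T (ballV r)" unfolding ballV_def using r by (rule open_ball)
  from conjugation_equicontinuous[OF this one_ballV[OF r(1)]] obtain N where
    N: "openin T N" "\<one> \<in> N"
    "\<And>k x. k \<in> carrier K \<Longrightarrow> x \<in> N \<Longrightarrow> k \<otimes> x \<otimes> inv k \<in> ballV r" by blast
  obtain s where s: "0 < s" "s \<le> r" "ballV s \<subseteq> N" using ballV_base[OF N(1,2) r(1)] by blast
  have Cs: "C * s \<le> 1 / 4" using mult_left_mono[OF s(2) C] Cr by linarith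
  show ?thesis
  \<comment> \<open>The radius \<open>s / 4\<close> makes the number \<open>m\<close> below
    positive, and \<open>6 r / s\<close> rounds up the factor \<open>(16/3) r / s\<close> that the
    comparison of powers yields.\<close>
  proof (rule that[of "s / 4" "6 * r / s"])
    show "0 < s / 4" "1 \<le> 6 * r / s" using s by (auto simp: field_simps)
    fix k x assume k: "k \<in> carrier K" and x: "x \<in> ballV (s / 4)"
    let ?y = "k \<otimes> x \<otimes> inv k"
    have xV: "x \<in> V" "norm (l x) < s / 4" "x \<in> carrier K"
      using x by (auto simp: ballV_def ballV_carrier intro: ballV_carrier[OF x])
    have yV: "?y \<in> V" using N(3)[OF k] x ballV_mono[of "s / 4" s] s by (auto simp: ballV_def)
    have "norm (l ?y) \<le> 6 * r / s * norm (l x)"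
    proof (cases "l x = 0")
      case True
      then have "x = \<one>" using inj_onD[OF inj _ xV(1) one_V] l_one by simp
      then show ?thesis using k by (simp add: l_one)
    next
      case False
      then have lx: "norm (l x) > 0" by simp
      \<comment> \<open>The largest integer with \<open>2 m |l x| < s\<close>: the first
        \<open>m\<close> powers of \<open>x\<close> stay in \<open>ballV s\<close>, while
        \<open>m + 1 \<le> 2 m\<close> turns maximality into
        \<open>s \<le> 4 m |l x|\<close>.\<close>
      define m where "m = nat (\<lceil>s / (2 * norm (l x))\<rceil> - 1)"
      have "s / (2 * norm (l x)) > 2" using lx xV(2) by (simp add: field_simps)
      then have m1: "0 < m" "real m < s / (2 * norm (l x))" "s / (2 * norm (l x)) \<le> real m + 1"
        unfolding m_def by linarith+
      have m2: "2 * real m * norm (l x) < s" using m1(2) lx by (simp add: field_simps)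
      have "s \<le> 2 * (real m + 1) * norm (l x)" using m1(3) lx by (simp add: field_simps)
      also have "\<dots> \<le> 4 * real m * norm (l x)" using m1(1) by (intro mult_right_mono) auto
      finally have m3: "s \<le> 4 * real m * norm (l x)" .
      have "?y [^] j \<in> ballV r" if j: "j \<le> m" for j
      proof -
        have sR: "s \<le> R" using s r by linarith
        have "x [^] j \<in> V \<and> norm (l (x [^] j)) \<le> 2 * real j * norm (l x)"
          using nat_pow_upper[OF xV(1) sR Cs m2 m1(1) j] .
        moreover have "2 * real j * norm (l x) \<le> 2 * real m * norm (l x)"
          using j by (intro mult_right_mono) auto
        ultimately have "x [^] j \<in> ballV s" using m2 by (auto simp: ballV_def)
        then show ?thesis using N(3)[OF k] s(3) conj_nat_pow[OF k xV(3)] by auto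
      qed
      from nat_pow_lower[OF r(2) Cr this m1(1)] have "real m * norm (l ?y) \<le> 4 / 3 * r"
        using k xV by auto
      then have "(4 * norm (l x)) * (real m * norm (l ?y)) \<le> (4 * norm (l x)) * (4 / 3 * r)"
        using lx by (intro mult_left_mono) auto
      moreover have "s * norm (l ?y) \<le> 4 * real m * norm (l x) * norm (l ?y)"
        using m3 by (intro mult_right_mono) auto
      ultimately have "s * norm (l ?y) \<le> 16 / 3 * (r * norm (l x))" by (simp add: algebra_simps)
      also have "\<dots> \<le> 6 * (r * norm (l x))" using r lx by (intro mult_right_mono) auto
      finally show ?thesis using s(1) by (simp add: field_simps)
    qed
    with yV show "?y \<in> V \<and> norm (l ?y) \<le> 6 * r / s * norm (l x)" by simp
  qed
qed

end

section \<open>Linearised conjugation, the Newton step and stability\<close>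

lemma amenable_groupE:
  assumes "amenable_group H"
  obtains \<mu> where "finitely_additive_probability \<mu> (carrier H)"
    "\<And>g A. g \<in> carrier H \<Longrightarrow> A \<subseteq> carrier H \<Longrightarrow> \<mu> (g <#\<^bsub>H\<^esub> A) = \<mu> A"
proof -
  from assms obtain \<mu> where "(\<forall>A \<subseteq> carrier H. 0 \<le> \<mu> A) \<and> \<mu> (carrier H) = (1::real) \<and>
      (\<forall>A \<subseteq> carrier H. \<forall>B \<subseteq> carrier H. A \<inter> B = {} \<longrightarrow> \<mu> (A \<union> B) = \<mu> A + \<mu> B) \<and>
      (\<forall>g \<in> carrier H. \<forall>A \<subseteq> carrier H. \<mu> (g <#\<^bsub>H\<^esub> A) = \<mu> A)"
    unfolding amenable_group_def by (elim conjE exE) (rule that, intro conjI)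
  then show ?thesis
    by (intro that[of \<mu>]) (auto simp: finitely_additive_probability_def)
qed

context almost_additive_chart begin

text \<open>In coordinates a conjugation is \<open>\<psi> u = l (k (E u) k^-1)\<close>, with
  \<open>E\<close> the inverse chart. It is almost additive because conjugation is multiplicative
  and \<open>l\<close> is almost additive both before and after it; then
  \<open>almost_additive_near_linear\<close> applies. The constants do not depend on
  \<open>k\<close> since those of \<open>conjugation_bound\<close> do not.\<close>

lemma conjugation_near_linear:
  obtains s B D where "0 < s" "1 \<le> B" "0 \<le> D"
    "\<And>k x. k \<in> carrier K \<Longrightarrow> x \<in> ballV s \<Longrightarrow>
       k \<otimes> x \<otimes> inv k \<in> V \<and> norm (l (k \<otimes> x \<otimes> inv k)) \<le> B * norm (l x)"
    "\<And>k. k \<in> carrier K \<Longrightarrow> \<exists>A. linear_on_subspace W A \<and> (\<forall>u\<in>W. norm (A u) \<le> B * norm u) \<and>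
       (\<forall>x\<in>ballV s. norm (l (k \<otimes> x \<otimes> inv k) - A (l x)) \<le> D * (norm (l x))\<^sup>2)"
proof -
  obtain s B where s: "0 < s" and B: "1 \<le> B"
    and conj: "\<And>k x. k \<in> carrier K \<Longrightarrow> x \<in> ballV s \<Longrightarrow>
       k \<otimes> x \<otimes> inv k \<in> V \<and> norm (l (k \<otimes> x \<otimes> inv k)) \<le> B * norm (l x)"
    using conjugation_bound by blast
  obtain r where r: "0 < r" "r \<le> R"
    and quot: "\<And>p q. p \<in> ballV r \<Longrightarrow> q \<in> ballV r \<Longrightarrow>
       inv q \<otimes> p \<in> V \<and> norm (l (inv q \<otimes> p)) \<le> 2 * norm (l p - l q)"
    using quotient_bound by blast
  \<comment> \<open>The four bounds keep, in this order, arguments in the domain of conjugation,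
    products of two arguments in the range of \<open>quot\<close>, conjugates within radius
    \<open>R\<close>, and the relative error of a product of conjugates at most 1.\<close>
  define \<sigma> where "\<sigma> = min (min (s / 4) (r / 4)) (min (R / (4 * B)) (1 / (4 * B * C + 1)))"
  have BC: "0 \<le> B * C" using B C by simp
  have "0 < R / (4 * B)" "0 < 1 / (4 * B * C + 1)" using R B BC by auto
  then have \<sigma>0: "0 < \<sigma>" "\<sigma> \<le> s / 4" "\<sigma> \<le> r / 4" "\<sigma> \<le> R / (4 * B)"
    using s r by (simp_all add: \<sigma>_def)
  then have \<sigma>: "0 < \<sigma>" "4 * \<sigma> \<le> s" "4 * \<sigma> \<le> r" "4 * B * \<sigma> \<le> R"
    using B by (simp_all add: field_simps)
  have "\<sigma> \<le> 1 / (4 * B * C + 1)" by (simp add: \<sigma>_def)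
  then have "\<sigma> * (4 * B * C + 1) \<le> 1" using BC by (simp add: field_simps)
  then have \<sigma>': "4 * B * C * \<sigma> \<le> 1" using \<sigma>(1) by (simp add: algebra_simps)
  have "C \<le> B * C" using mult_right_mono[OF B C] by simp
  then have "C * \<sigma> \<le> (B * C) * \<sigma>" using \<sigma>(1) by (intro mult_right_mono) auto
  moreover have "0 \<le> (B * C) * \<sigma>" using BC \<sigma>(1) by simp
  ultimately have C\<sigma>: "C * \<sigma> \<le> 1 / 4" "0 \<le> C * \<sigma>" using \<sigma>' C \<sigma>(1) by (simp_all add: algebra_simps)
  \<comment> \<open>The term with \<open>B\<close> squared is the product error for the conjugates
    of \<open>x\<close> and \<open>y\<close>; the term \<open>4 * B * C\<close> pays for replacing
    \<open>E u \<otimes> E v\<close> by \<open>E (u + v)\<close>.\<close>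
  define D where "D = 4 * B * C + C * B\<^sup>2"
  have D: "0 \<le> D" using BC C by (simp add: D_def)
  have "\<exists>A. linear_on_subspace W A \<and> (\<forall>u\<in>W. norm (A u) \<le> B * norm u) \<and>
       (\<forall>x\<in>ballV \<sigma>. norm (l (k \<otimes> x \<otimes> inv k) - A (l x)) \<le> D * (norm (l x))\<^sup>2)"
    if k: "k \<in> carrier K" for k
  proof -
    define E where "E = inv_into V l"
    define c where "c x = k \<otimes> x \<otimes> inv k" for x
    define \<psi> where "\<psi> u = l (c (E u))" for u
    have E: "E u \<in> V" "l (E u) = u" if "u \<in> W" "norm u < R" for u
    proof -
      have "u \<in> l ` V" using surj[OF that] by auto
      then show "E u \<in> V" "l (E u) = u" unfolding E_def by (rule inv_into_into, rule f_inv_into_f)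
    qed
    have cV: "c x \<in> V" "norm (l (c x)) \<le> B * norm (l x)" if "x \<in> V" "norm (l x) < s" for x
      using conj[OF k, of x] that by (auto simp: c_def ballV_def)
    have cm: "c (x \<otimes> y) = c x \<otimes> c y" if "x \<in> V" "y \<in> V" for x y
      using that V k unfolding c_def by (simp add: m_assoc subset_iff)
    have \<sigma>R: "4 * \<sigma> \<le> R" using \<sigma>(3) r by linarith
    have bound: "norm (\<psi> u) \<le> B * norm u" if "u \<in> W" "norm u < \<sigma>" for u
      using cV(2)[of "E u"] E[of u] that \<sigma>(1,2) \<sigma>R by (simp add: \<psi>_def)
    have add: "norm (\<psi> (u + v) - \<psi> u - \<psi> v) \<le> D * norm u * norm v"
      if u: "u \<in> W" and v: "v \<in> W" and us: "norm u < \<sigma>" and vs: "norm v < \<sigma>"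
        and uvs: "norm (u + v) < \<sigma>" for u v
    proof -
      let ?n = "norm u * norm v"
      have uvW: "u + v \<in> W" using W u v by (rule subspace_add)
      define x y z where "x = E u" and "y = E v" and "z = E (u + v)"
      have xyz: "x \<in> V" "l x = u" "y \<in> V" "l y = v" "z \<in> V" "l z = u + v"
        using E u v uvW us vs uvs \<sigma>R \<sigma>(1) by (auto simp: x_def y_def z_def)
      have xy: "x \<otimes> y \<in> V" "norm (l (x \<otimes> y) - u - v) \<le> C * ?n"
        using mult[OF xyz(1,3)] xyz us vs \<sigma>R \<sigma>(1) by (auto simp: algebra_simps)
      have "C * ?n \<le> C * (\<sigma> * \<sigma>)"
        using us vs C \<sigma>(1) by (intro mult_left_mono mult_mono) auto
      also have "\<dots> \<le> \<sigma> / 4" using mult_right_mono[OF C\<sigma>(1), of \<sigma>] \<sigma>(1) by (simp add: algebra_simps)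
      finally have n\<sigma>: "C * ?n \<le> \<sigma> / 4" .
      have "norm (l (x \<otimes> y)) \<le> norm (l (x \<otimes> y) - u - v) + norm (u + v)"
        using norm_triangle_ineq[of "l (x \<otimes> y) - u - v" "u + v"] by simp
      then have xys: "norm (l (x \<otimes> y)) < 3 * \<sigma>" using xy n\<sigma> uvs \<sigma>(1) by linarith
      \<comment> \<open>The coordinates of \<open>z\<close> and \<open>x \<otimes> y\<close> differ
        by at most \<open>C |u| |v|\<close>, so by \<open>quot\<close> the correcting factor
        \<open>w\<close> has second-order size, and conjugation enlarges it at most by
        \<open>B\<close>.\<close>
      define w where "w = inv (x \<otimes> y) \<otimes> z"
      have "z \<in> ballV r" "x \<otimes> y \<in> ballV r" using xyz uvs xy xys \<sigma> by (auto simp: ballV_def)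
      from quot[OF this] have w: "w \<in> V" "norm (l w) \<le> 2 * (C * ?n)"
        using xy(2) xyz(6) norm_minus_commute[of "l (x \<otimes> y)" "u + v"] by (auto simp: w_def diff_diff_eq)
      have ws: "norm (l w) < \<sigma>" using w n\<sigma> \<sigma>(1) by linarith
      have zxyw: "z = (x \<otimes> y) \<otimes> w"
        using xyz xy V by (auto simp: w_def subset_iff)
      have c1: "c x \<in> V" "norm (l (c x)) \<le> B * norm u" "c y \<in> V" "norm (l (c y)) \<le> B * norm v"
        using cV[of x] cV[of y] xyz us vs \<sigma>(1,2) by auto
      have c2: "c (x \<otimes> y) \<in> V" "norm (l (c (x \<otimes> y))) \<le> B * norm (l (x \<otimes> y))"
        "c w \<in> V" "norm (l (c w)) \<le> B * norm (l w)"
        using cV[of "x \<otimes> y"] cV[of w] xy xys w ws \<sigma>(1,2) by auto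
      have BR: "B * t < R" if "t < 3 * \<sigma>" for t
      proof -
        have "B * t < B * (3 * \<sigma>)" using that B by (intro mult_strict_left_mono) auto
        also have "\<dots> \<le> 4 * B * \<sigma>" using B \<sigma>(1) by simp
        finally show ?thesis using \<sigma>(4) by linarith
      qed
      have "norm (l (c x \<otimes> c y) - l (c x) - l (c y)) \<le> C * (B * norm u) * (B * norm v)"
        by (rule mult_bound(2)[OF c1(1,3,2,4)]) (use BR us vs \<sigma>(1) in auto)
      then have e1: "norm (l (c (x \<otimes> y)) - l (c x) - l (c y)) \<le> C * B\<^sup>2 * ?n"
        using cm[OF xyz(1,3)] by (simp add: power2_eq_square algebra_simps)
      have cxy3: "norm (l (c (x \<otimes> y))) \<le> B * (3 * \<sigma>)"
        using c2(2) mult_left_mono[of "norm (l (x \<otimes> y))" "3 * \<sigma>" B] xys B by linarith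
      have "norm (l (c (x \<otimes> y) \<otimes> c w) - l (c (x \<otimes> y)) - l (c w))
          \<le> C * norm (l (c (x \<otimes> y))) * norm (l (c w))"
        using mult[OF c2(1,3)] c2 BR[OF xys] BR[of "norm (l w)"] ws \<sigma>(1) by auto
      also have "\<dots> \<le> 1 * norm (l (c w))"
      proof (rule mult_right_mono)
        have "C * norm (l (c (x \<otimes> y))) \<le> C * (B * (3 * \<sigma>))" using cxy3 C by (rule mult_left_mono)
        also have "\<dots> \<le> 4 * B * C * \<sigma>"
          using mult_nonneg_nonneg[OF BC less_imp_le[OF \<sigma>(1)]] by (simp add: algebra_simps)
        finally show "C * norm (l (c (x \<otimes> y))) \<le> 1" using \<sigma>' by linarith
      qed simp
      finally have "norm (l (c z) - l (c (x \<otimes> y)) - l (c w)) \<le> norm (l (c w))"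
        using cm[OF xy(1) w(1)] zxyw by simp
      moreover have "norm (l (c z) - l (c (x \<otimes> y)))
          \<le> norm (l (c z) - l (c (x \<otimes> y)) - l (c w)) + norm (l (c w))"
        using norm_triangle_ineq[of "l (c z) - l (c (x \<otimes> y)) - l (c w)" "l (c w)"] by simp
      moreover have "norm (l (c w)) \<le> 2 * B * C * ?n"
      proof -
        have "B * norm (l w) \<le> B * (2 * (C * ?n))" using w(2) B by (intro mult_left_mono) auto
        also have "\<dots> = 2 * B * C * ?n" by simp
        finally show ?thesis using c2(4) by linarith
      qed
      ultimately have e2: "norm (l (c z) - l (c (x \<otimes> y))) \<le> 4 * B * C * ?n" by linarith
      have "norm (l (c z) - l (c x) - l (c y))
          \<le> norm (l (c z) - l (c (x \<otimes> y))) + norm (l (c (x \<otimes> y)) - l (c x) - l (c y))"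
        using norm_triangle_ineq[of "l (c z) - l (c (x \<otimes> y))" "l (c (x \<otimes> y)) - l (c x) - l (c y)"]
        by (simp add: algebra_simps)
      also have "\<dots> \<le> D * ?n" using e1 e2 by (simp add: D_def algebra_simps)
      finally show ?thesis by (simp add: \<psi>_def x_def y_def z_def algebra_simps)
    qed
    from almost_additive_near_linear[OF W \<sigma>(1) D add bound] obtain A where
      A: "linear_on_subspace W A" "\<And>u. u \<in> W \<Longrightarrow> norm (A u) \<le> B * norm u"
        "\<And>u. u \<in> W \<Longrightarrow> norm u < \<sigma> \<Longrightarrow> norm (\<psi> u - A u) \<le> D * (norm u)\<^sup>2" by blast
    have "norm (l (k \<otimes> x \<otimes> inv k) - A (l x)) \<le> D * (norm (l x))\<^sup>2" if "x \<in> ballV \<sigma>" for x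
    proof -
      have x: "x \<in> V" "norm (l x) < \<sigma>" using that by (auto simp: ballV_def)
      then have "E (l x) = x" unfolding E_def by (simp add: inv_into_f_f[OF inj])
      then show ?thesis using A(3)[OF l_W x(2)] x by (simp add: \<psi>_def c_def)
    qed
    with A show ?thesis by blast
  qed
  moreover have "k \<otimes> x \<otimes> inv k \<in> V \<and> norm (l (k \<otimes> x \<otimes> inv k)) \<le> B * norm (l x)"
    if "k \<in> carrier K" "x \<in> ballV \<sigma>" for k x
    using conj that ballV_mono[of \<sigma> s] \<sigma> by auto
  ultimately show ?thesis using that[of \<sigma> B D] \<sigma>(1) B D by blast
qed

text \<open>Membership in \<open>V\<close> is part of the bound, since \<open>l\<close> carries
  information only on \<open>V\<close>.\<close>

definition defect_le :: "('h, 'm) monoid_scheme \<Rightarrow> ('h \<Rightarrow> 'a) \<Rightarrow> real \<Rightarrow> bool" where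
  "defect_le H f \<delta> \<longleftrightarrow> (\<forall>x\<in>carrier H. \<forall>z\<in>carrier H.
     inv (f (x \<otimes>\<^bsub>H\<^esub> z)) \<otimes> f x \<otimes> f z \<in> V \<and> norm (l (inv (f (x \<otimes>\<^bsub>H\<^esub> z)) \<otimes> f x \<otimes> f z)) \<le> \<delta>)"

text \<open>One Newton step: correct \<open>f x\<close> by the mean over \<open>y\<close> of \<open>f(x)\<inverse> f(xy) f(y)\<inverse>\<close>. By the
  cocycle identity for these elements and left invariance of the mean, the first order part of
  the new defect vanishes. Rounding makes the averaged functions finite-valued.\<close>

lemma defect_improvement:
  obtains d M where "0 < d" "1 \<le> M"
    "\<And>(H :: ('h, 'm) monoid_scheme) f \<delta>. amenable_group H \<Longrightarrow> f \<in> carrier H \<rightarrow> carrier K \<Longrightarrow>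
       0 < \<delta> \<Longrightarrow> \<delta> \<le> d \<Longrightarrow> defect_le H f \<delta> \<Longrightarrow>
       \<exists>e. e \<in> carrier H \<rightarrow> V \<and> (\<forall>x\<in>carrier H. norm (l (e x)) \<le> M * \<delta>) \<and>
         defect_le H (\<lambda>x. f x \<otimes> e x) (M * \<delta>\<^sup>2)"
proof -
  obtain s B D where s: "0 < s" and B: "1 \<le> B" and D: "0 \<le> D"
    and conj: "\<And>k x. k \<in> carrier K \<Longrightarrow> x \<in> ballV s \<Longrightarrow>
       k \<otimes> x \<otimes> inv k \<in> V \<and> norm (l (k \<otimes> x \<otimes> inv k)) \<le> B * norm (l x)"
    and lin: "\<And>k. k \<in> carrier K \<Longrightarrow> \<exists>A. linear_on_subspace W A \<and> (\<forall>u\<in>W. norm (A u) \<le> B * norm u) \<and>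
       (\<forall>x\<in>ballV s. norm (l (k \<otimes> x \<otimes> inv k) - A (l x)) \<le> D * (norm (l x))\<^sup>2)"
    using conjugation_near_linear by blast
  obtain r where r: "0 < r" "r \<le> R"
    and quot: "\<And>p q. p \<in> ballV r \<Longrightarrow> q \<in> ballV r \<Longrightarrow>
       inv q \<otimes> p \<in> V \<and> norm (l (inv q \<otimes> p)) \<le> 2 * norm (l p - l q)"
    using quotient_bound by blast
  define t0 where "t0 = min (min (r / 8) (s / 8)) (1 / (C + 1))"
  have t0: "0 < t0" "8 * t0 \<le> r" "8 * t0 \<le> s" using r s C by (auto simp: t0_def)
  have "t0 \<le> 1 / (C + 1)" by (simp add: t0_def)
  then have "t0 * (C + 1) \<le> 1" using C by (simp add: field_simps)
  then have t0': "C * t0 \<le> 1" using t0 by (simp add: algebra_simps)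
  have B2: "1 \<le> B\<^sup>2" "B \<le> B\<^sup>2" 
    using B mult_mono[OF B B] mult_left_mono[OF B, of B] by (simp_all add: power2_eq_square)
  have B2pos: "0 < B\<^sup>2" using B by simp
  \<comment> \<open>The constant of the quadratic error in the linearised cocycle identity: the
    first term comes from multiplying three factors, the second from replacing conjugation by a
    linear map, and \<open>B + 2\<close> from three roundings. In \<open>M\<close>, the term
    \<open>2 * B\<close> bounds the size of the correction and \<open>4 * Q\<close> the new
    defect.\<close>
  define Q where "Q = 36 * C * B ^ 4 + 4 * D * B\<^sup>2 + B + 2"
  define M where "M = 2 * B + 4 * Q"
  define d where "d = t0 / (3 * B\<^sup>2)"
  have Q: "0 \<le> Q" "36 * C * B ^ 4 + 4 * D * B\<^sup>2 \<le> Q" using C B D by (auto simp: Q_def)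
  show ?thesis
  proof (rule that[of d M])
    show "0 < d" using t0 B2pos by (simp add: d_def)
    show "1 \<le> M" using B Q by (simp add: M_def)
    fix H :: "('h, 'm) monoid_scheme" and f \<delta>
    assume H: "amenable_group H" and f: "f \<in> carrier H \<rightarrow> carrier K"
      and \<delta>: "0 < \<delta>" "\<delta> \<le> d" and def: "defect_le H f \<delta>"
    interpret H: group H using H by (simp add: amenable_group_def)
    obtain \<mu> where \<mu>: "finitely_additive_probability \<mu> (carrier H)"
      and \<mu>_inv: "\<And>g A. g \<in> carrier H \<Longrightarrow> A \<subseteq> carrier H \<Longrightarrow> \<mu> (g <#\<^bsub>H\<^esub> A) = \<mu> A"
      by (rule amenable_groupE[OF H]) blast
    interpret \<mu>: finitely_additive_probability \<mu> "carrier H" by (rule \<mu>)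
    \<comment> \<open>A common bound for all factors to be multiplied: the defect, the corrections
      of size \<open>2 B \<delta>\<close>, and their conjugates of size
      \<open>2 B^2 \<delta>\<close>.\<close>
    define t where "t = 3 * B\<^sup>2 * \<delta>"
    have "\<delta> \<le> t0 / (3 * B\<^sup>2)" using \<delta>(2) by (simp add: d_def)
    then have "t \<le> t0" using B2pos by (simp add: t_def field_simps)
    moreover have tpos: "0 < t" using \<delta> B2pos by (simp add: t_def)
    ultimately have t: "0 \<le> t" "8 * t \<le> r" "8 * t \<le> s" "C * t \<le> 1" "3 * t < R"
      using t0 t0' r C mult_left_mono[of t t0 C] by auto
    have \<delta>t: "\<delta> < t" "2 * \<delta> < t" "2 * B * \<delta> < t" "2 * B\<^sup>2 * \<delta> < t"
    proof -
      have "1 * \<delta> \<le> B\<^sup>2 * \<delta>" "B * \<delta> \<le> B\<^sup>2 * \<delta>" using B2 \<delta> by (auto intro!: mult_right_mono)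
      then show "\<delta> < t" "2 * \<delta> < t" "2 * B * \<delta> < t" "2 * B\<^sup>2 * \<delta> < t"
        using \<delta>(1) unfolding t_def by linarith+
    qed
    have t2: "t\<^sup>2 = 9 * B ^ 4 * \<delta>\<^sup>2" by (simp add: t_def power_mult_distrib flip: power_mult)
    have fK [simp]: "f x \<in> carrier K" if "x \<in> carrier H" for x using f that by auto
    define S where "S x z = inv (f (x \<otimes>\<^bsub>H\<^esub> z)) \<otimes> f x \<otimes> f z" for x z
    \<comment> \<open>This is the inverse of \<open>S x y\<close> conjugated by \<open>f y\<close>.
      Inversion costs a factor 2, through \<open>quot\<close> with \<open>p\<close> the identity,
      and conjugation a factor \<open>B\<close>.\<close>
    define \<alpha> where "\<alpha> x y = inv (f x) \<otimes> f (x \<otimes>\<^bsub>H\<^esub> y) \<otimes> inv (f y)" for x y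
    have S: "S x z \<in> V" "norm (l (S x z)) \<le> \<delta>" "S x z \<in> carrier K"
      if "x \<in> carrier H" "z \<in> carrier H" for x z
      using def that V by (auto simp: defect_le_def S_def)
    have \<alpha>: "\<alpha> x y \<in> V" "norm (l (\<alpha> x y)) \<le> 2 * B * \<delta>" "\<alpha> x y \<in> carrier K"
      if "x \<in> carrier H" "y \<in> carrier H" for x y
    proof -
      have Sb: "S x y \<in> ballV r" using S[OF that] \<delta>t t by (auto simp: ballV_def)
      have iS: "inv (S x y) \<in> V" "norm (l (inv (S x y))) \<le> 2 * \<delta>"
        using quot[OF one_ballV[OF r(1)] Sb] S[OF that] by (auto simp: l_one)
      have "inv (S x y) \<in> ballV s" using iS \<delta>t t by (auto simp: ballV_def)
      from conj[OF fK[OF that(2)] this]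
      have *: "f y \<otimes> inv (S x y) \<otimes> inv (f y) \<in> V"
        "norm (l (f y \<otimes> inv (S x y) \<otimes> inv (f y))) \<le> B * norm (l (inv (S x y)))" by auto
      have eq: "f y \<otimes> inv (S x y) \<otimes> inv (f y) = \<alpha> x y"
        using that by (simp add: S_def \<alpha>_def inv_mult_group m_assoc)
      show "\<alpha> x y \<in> V" using * eq by simp
      then show "\<alpha> x y \<in> carrier K" using V by auto
      show "norm (l (\<alpha> x y)) \<le> 2 * B * \<delta>"
      proof -
        have "B * norm (l (inv (S x y))) \<le> B * (2 * \<delta>)" using iS(2) B by (intro mult_left_mono) auto
        then show ?thesis using *(2) unfolding eq by linarith
      qed
    qed
    define \<delta>1 where "\<delta>1 = 2 * B * \<delta>"
    have \<delta>1: "0 < \<delta>1" "\<delta>1 < t" using \<delta> B \<delta>t by (auto simp: \<delta>1_def)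
    \<comment> \<open>Rounding with error \<open>\<delta>^2\<close> leaves finitely many values and
      disturbs the averaged identity only at second order.\<close>
    obtain \<rho> where fin: "finite (\<rho> ` {u\<in>W. norm u \<le> \<delta>1})"
      and \<rho>: "\<And>u. u \<in> W \<Longrightarrow> norm u \<le> \<delta>1 \<Longrightarrow>
        \<rho> u \<in> W \<and> norm (\<rho> u) \<le> \<delta>1 \<and> norm (\<rho> u - u) \<le> \<delta>\<^sup>2"
      using rounding[of "\<delta>\<^sup>2" \<delta>1] \<delta> \<delta>1 by auto
    define v where "v x y = \<rho> (l (\<alpha> x y))" for x y
    have v: "v x y \<in> W" "norm (v x y) \<le> \<delta>1" "norm (v x y - l (\<alpha> x y)) \<le> \<delta>\<^sup>2"
      if "x \<in> carrier H" "y \<in> carrier H" for x y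
      using \<rho>[of "l (\<alpha> x y)"] \<alpha>[OF that] l_W by (auto simp: v_def \<delta>1_def)
    have vfin: "finite (v x ` carrier H)" if "x \<in> carrier H" for x
      by (rule finite_subset[OF _ fin]) (use that \<alpha> l_W in \<open>auto simp: v_def \<delta>1_def\<close>)
    define a where "a x = simple_mean \<mu> (carrier H) (v x)" for x
    have a: "a x \<in> W" "norm (a x) \<le> \<delta>1" if "x \<in> carrier H" for x
      unfolding a_def using that v W vfin
      by (auto intro!: \<mu>.simple_mean_in_subspace \<mu>.norm_simple_mean_le)
    define e where "e x = inv_into V l (a x)" for x
    have e: "e x \<in> V" "l (e x) = a x" "e x \<in> carrier K" if "x \<in> carrier H" for x
    proof -
      have "norm (a x) < R" using a(2)[OF that] \<delta>1 t by linarith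
      from surj[OF a(1)[OF that] this] have "a x \<in> l ` V" by (metis imageI)
      then show "e x \<in> V" "l (e x) = a x" unfolding e_def by (rule inv_into_into, rule f_inv_into_f)
      then show "e x \<in> carrier K" using V by auto
    qed
    show "\<exists>e. e \<in> carrier H \<rightarrow> V \<and> (\<forall>x\<in>carrier H. norm (l (e x)) \<le> M * \<delta>) \<and>
         defect_le H (\<lambda>x. f x \<otimes> e x) (M * \<delta>\<^sup>2)"
    proof (intro exI conjI ballI)
      show "e \<in> carrier H \<rightarrow> V" using e by auto
      show "norm (l (e x)) \<le> M * \<delta>" if "x \<in> carrier H" for x
      proof -
        have "2 * B * \<delta> \<le> M * \<delta>" using Q \<delta> by (intro mult_right_mono) (auto simp: M_def)
        then show ?thesis using e[OF that] a[OF that] by (simp add: \<delta>1_def)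
      qed
      show "defect_le H (\<lambda>x. f x \<otimes> e x) (M * \<delta>\<^sup>2)"
        unfolding defect_le_def
      proof (intro ballI)
        fix x z assume x: "x \<in> carrier H" and z: "z \<in> carrier H"
        have xz: "x \<otimes>\<^bsub>H\<^esub> z \<in> carrier H" using x z by simp
        \<comment> \<open>In the new defect, moving \<open>f z\<close> to the left past
          \<open>e x\<close> conjugates \<open>e x\<close> by the inverse of
          \<open>f z\<close>.\<close>
        define c where "c w = inv (f z) \<otimes> w \<otimes> f z" for w
        have "inv (f z) \<in> carrier K" using z by simp
        from lin[OF this] conj[OF this] obtain A where A: "linear_on_subspace W A"
            "\<And>u. u \<in> W \<Longrightarrow> norm (A u) \<le> B * norm u"
          and cA: "\<And>w. w \<in> ballV s \<Longrightarrow> norm (l (c w) - A (l w)) \<le> D * (norm (l w))\<^sup>2"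
          and cV: "\<And>w. w \<in> ballV s \<Longrightarrow> c w \<in> V \<and> norm (l (c w)) \<le> B * norm (l w)"
          using z by (auto simp: c_def)
        have cw: "c w \<in> V" "norm (l (c w)) \<le> t" "norm (l (c w) - A (l w)) \<le> 4 * D * B\<^sup>2 * \<delta>\<^sup>2"
          if w: "w \<in> V" "norm (l w) \<le> \<delta>1" for w
        proof -
          have ws: "w \<in> ballV s" using w \<delta>1 t by (auto simp: ballV_def)
          show "c w \<in> V" using cV[OF ws] by simp
          have "B * norm (l w) \<le> B * \<delta>1" using w B by (intro mult_left_mono) auto
          also have "\<dots> \<le> t" using \<delta>t by (simp add: \<delta>1_def power2_eq_square algebra_simps)
          finally show "norm (l (c w)) \<le> t" using cV[OF ws] by linarith
          have "D * (norm (l w))\<^sup>2 \<le> D * \<delta>1\<^sup>2" using w D by (intro mult_left_mono power_mono) auto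
          also have "\<dots> = 4 * D * B\<^sup>2 * \<delta>\<^sup>2" by (simp add: \<delta>1_def power_mult_distrib)
          finally show "norm (l (c w) - A (l w)) \<le> 4 * D * B\<^sup>2 * \<delta>\<^sup>2" using cA[OF ws] by linarith
        qed
        have prod: "S x z \<otimes> c w \<otimes> w' \<in> V" "norm (l (S x z \<otimes> c w \<otimes> w')) \<le> 7 * t"
          "norm (l (S x z \<otimes> c w \<otimes> w') - l (S x z) - A (l w) - l w') \<le> (Q - B - 2) * \<delta>\<^sup>2"
          if w: "w \<in> V" "norm (l w) \<le> \<delta>1" and w': "w' \<in> V" "norm (l w') \<le> \<delta>1" for w w'
        proof -
          have "norm (l (S x z)) \<le> t" using S[OF x z] \<delta>t by linarith
          moreover have "norm (l w') \<le> t" using w' \<delta>1 by linarith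
          ultimately have m: "S x z \<otimes> c w \<otimes> w' \<in> V" "norm (l (S x z \<otimes> c w \<otimes> w')) \<le> 7 * t"
            "norm (l (S x z \<otimes> c w \<otimes> w') - l (S x z) - l (c w) - l w') \<le> 4 * C * t\<^sup>2"
            using mult3_bound[OF S(1)[OF x z] cw(1)[OF w] w'(1) _ cw(2)[OF w] _ t(5,4,1)] by auto
          show "S x z \<otimes> c w \<otimes> w' \<in> V" "norm (l (S x z \<otimes> c w \<otimes> w')) \<le> 7 * t" by fact+
          have "norm (l (S x z \<otimes> c w \<otimes> w') - l (S x z) - A (l w) - l w')
              \<le> norm (l (S x z \<otimes> c w \<otimes> w') - l (S x z) - l (c w) - l w') + norm (l (c w) - A (l w))"
            using norm_triangle_ineq[of "l (S x z \<otimes> c w \<otimes> w') - l (S x z) - l (c w) - l w'"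
                "l (c w) - A (l w)"] by (simp add: algebra_simps)
          also have "\<dots> \<le> 4 * C * t\<^sup>2 + 4 * D * B\<^sup>2 * \<delta>\<^sup>2" using m(3) cw(3)[OF w] by linarith
          also have "\<dots> = (Q - B - 2) * \<delta>\<^sup>2" by (simp add: t2 Q_def algebra_simps)
          finally show "norm (l (S x z \<otimes> c w \<otimes> w') - l (S x z) - A (l w) - l w') \<le> (Q - B - 2) * \<delta>\<^sup>2" .
        qed
        have Adiff: "A (u - w) = A u - A w" if "u \<in> W" "w \<in> W" for u w
        proof -
          have "A (u - w + w) = A (u - w) + A w"
            using A(1) that subspace_diff[OF W that] unfolding linear_on_subspace_def by blast
          then show ?thesis by simp
        qed
        \<comment> \<open>A telescoping product. To first order it reads \<open>l (\<alpha> (xz) y)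
          = l (S x z) + A (l (\<alpha> x (zy))) + l (\<alpha> z y)\<close>. Averaging over
          \<open>y\<close>, with left invariance in the middle term, gives
          \<open>a (xz) = l (S x z) + A (a x) + a z\<close> up to
          \<open>Q \<delta>^2\<close>.\<close>
        have cocycle: "S x z \<otimes> c (\<alpha> x (z \<otimes>\<^bsub>H\<^esub> y)) \<otimes> \<alpha> z y = \<alpha> (x \<otimes>\<^bsub>H\<^esub> z) y"
          if "y \<in> carrier H" for y
          using x z that by (simp add: S_def c_def \<alpha>_def m_assoc H.m_assoc)
        have pt: "norm (v (x \<otimes>\<^bsub>H\<^esub> z) y - ((l (S x z) + A (v x (z \<otimes>\<^bsub>H\<^esub> y))) + v z y)) \<le> Q * \<delta>\<^sup>2"
          if y: "y \<in> carrier H" for y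
        proof -
          have zy: "z \<otimes>\<^bsub>H\<^esub> y \<in> carrier H" using z y by simp
          have main: "norm (l (\<alpha> (x \<otimes>\<^bsub>H\<^esub> z) y) - l (S x z) - A (l (\<alpha> x (z \<otimes>\<^bsub>H\<^esub> y))) - l (\<alpha> z y))
              \<le> (Q - B - 2) * \<delta>\<^sup>2"
            using prod(3)[OF \<alpha>(1)[OF x zy] _ \<alpha>(1)[OF z y]] \<alpha>(2)[OF x zy] \<alpha>(2)[OF z y] cocycle[OF y]
            by (simp add: \<delta>1_def)
          have "norm (A (v x (z \<otimes>\<^bsub>H\<^esub> y) - l (\<alpha> x (z \<otimes>\<^bsub>H\<^esub> y)))) \<le> B * \<delta>\<^sup>2"
            using A(2)[OF subspace_diff[OF W v(1)[OF x zy] l_W[OF \<alpha>(1)[OF x zy]]]]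
              mult_left_mono[OF v(3)[OF x zy], of B] B by linarith
          then have r1: "norm (A (v x (z \<otimes>\<^bsub>H\<^esub> y)) - A (l (\<alpha> x (z \<otimes>\<^bsub>H\<^esub> y)))) \<le> B * \<delta>\<^sup>2"
            using Adiff[OF v(1)[OF x zy] l_W[OF \<alpha>(1)[OF x zy]]] by simp
          \<comment> \<open>Trades three rounded vectors for their unrounded versions; the rounding
            error under \<open>A\<close> is magnified by \<open>B\<close>.\<close>
          have tri: "norm (p1 - ((q + p2) + p3)) \<le> norm (p1' - q - p2' - p3')
              + norm (p1 - p1') + norm (p2 - p2') + norm (p3 - p3')" for p1 p2 p3 p1' p2' p3' q :: 'v
          proof -
            have "p1 - ((q + p2) + p3) = (p1' - q - p2' - p3') + (p1 - p1') - (p2 - p2') - (p3 - p3')"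
              by simp
            moreover have "norm (a + b - c - d) \<le> norm a + norm b + norm c + norm d" for a b c d :: 'v
              using norm_triangle_ineq4[of "a + b - c" d] norm_triangle_ineq4[of "a + b" c]
                norm_triangle_ineq[of a b] by linarith
            ultimately show ?thesis by (simp only:)
          qed
          have "norm (v (x \<otimes>\<^bsub>H\<^esub> z) y - ((l (S x z) + A (v x (z \<otimes>\<^bsub>H\<^esub> y))) + v z y))
              \<le> (Q - B - 2) * \<delta>\<^sup>2 + \<delta>\<^sup>2 + B * \<delta>\<^sup>2 + \<delta>\<^sup>2"
            using tri[of "v (x \<otimes>\<^bsub>H\<^esub> z) y" "l (S x z)" "A (v x (z \<otimes>\<^bsub>H\<^esub> y))" "v z y"
                "l (\<alpha> (x \<otimes>\<^bsub>H\<^esub> z) y)" "A (l (\<alpha> x (z \<otimes>\<^bsub>H\<^esub> y)))" "l (\<alpha> z y)"]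
              main r1 v(3)[OF xz y] v(3)[OF z y] by linarith
          then show ?thesis by (simp add: algebra_simps)
        qed
        have trans: "simple_mean \<mu> (carrier H) (\<lambda>y. v x (z \<otimes>\<^bsub>H\<^esub> y)) = a x"
          unfolding a_def by (rule \<mu>.simple_mean_translate[OF H.is_group refl z \<mu>_inv])
        have fin1: "finite ((\<lambda>y. v x (z \<otimes>\<^bsub>H\<^esub> y)) ` carrier H)"
          by (rule finite_subset[OF _ vfin[OF x]]) (use z in auto)
        have fin2: "finite ((\<lambda>y. A (v x (z \<otimes>\<^bsub>H\<^esub> y))) ` carrier H)"
          using finite_imageI[OF fin1, of A] by (simp add: image_image)
        have fin3: "finite ((\<lambda>y. l (S x z) + A (v x (z \<otimes>\<^bsub>H\<^esub> y))) ` carrier H)"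
          using finite_imageI[OF fin2, of "\<lambda>w. l (S x z) + w"] by (simp add: image_image)
        have fin4: "finite ((\<lambda>y. (l (S x z) + A (v x (z \<otimes>\<^bsub>H\<^esub> y))) + v z y) ` carrier H)"
          by (rule finite_subset[OF _ finite_imageI[OF finite_cartesian_product[OF fin3 vfin[OF z]],
                of "\<lambda>(p, q). p + q"]]) auto
        have "simple_mean \<mu> (carrier H) (\<lambda>y. (l (S x z) + A (v x (z \<otimes>\<^bsub>H\<^esub> y))) + v z y)
            = simple_mean \<mu> (carrier H) (\<lambda>y. l (S x z) + A (v x (z \<otimes>\<^bsub>H\<^esub> y))) + a z"
          unfolding a_def by (rule \<mu>.simple_mean_add[OF fin3 vfin[OF z]])
        also have "simple_mean \<mu> (carrier H) (\<lambda>y. l (S x z) + A (v x (z \<otimes>\<^bsub>H\<^esub> y)))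
            = l (S x z) + simple_mean \<mu> (carrier H) (\<lambda>y. A (v x (z \<otimes>\<^bsub>H\<^esub> y)))"
          using \<mu>.simple_mean_add[OF _ fin2, of "\<lambda>_. l (S x z)"]
          by (simp add: \<mu>.simple_mean_const image_constant_conv)
        also have "simple_mean \<mu> (carrier H) (\<lambda>y. A (v x (z \<otimes>\<^bsub>H\<^esub> y))) = A (a x)"
          unfolding trans[symmetric]
          by (rule \<mu>.simple_mean_linear[OF fin1 _ W A(1)]) (use v x z in auto)
        finally have mean: "simple_mean \<mu> (carrier H) (\<lambda>y. (l (S x z) + A (v x (z \<otimes>\<^bsub>H\<^esub> y))) + v z y)
            = l (S x z) + A (a x) + a z" .
        have axz: "norm (a (x \<otimes>\<^bsub>H\<^esub> z) - (l (S x z) + A (a x) + a z)) \<le> Q * \<delta>\<^sup>2"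
          unfolding mean[symmetric] a_def[of "x \<otimes>\<^bsub>H\<^esub> z"]
          by (rule \<mu>.norm_simple_mean_diff_le[OF vfin[OF xz] fin4 pt])
        \<comment> \<open>The product from \<open>cocycle\<close> with the mean corrections in place
          of \<alpha>. The new defect is the inverse of \<open>e (xz)\<close> times
          \<open>p\<close>. By the averaged identity \<open>p\<close> and \<open>e (xz)\<close> have
          equal coordinates up to \<open>2 Q \<delta>^2\<close>, and \<open>quot\<close> doubles
          this.\<close>
        define p where "p = S x z \<otimes> c (e x) \<otimes> e z"
        have p: "p \<in> V" "norm (l p) \<le> 7 * t"
          "norm (l p - l (S x z) - A (a x) - a z) \<le> (Q - B - 2) * \<delta>\<^sup>2"
          using prod[of "e x" "e z"] e x z a by (auto simp: p_def)
        have "norm (l p - a (x \<otimes>\<^bsub>H\<^esub> z)) \<le> norm (l p - l (S x z) - A (a x) - a z)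
            + norm (a (x \<otimes>\<^bsub>H\<^esub> z) - (l (S x z) + A (a x) + a z))"
          using norm_triangle_ineq4[of "l p - l (S x z) - A (a x) - a z"
              "a (x \<otimes>\<^bsub>H\<^esub> z) - (l (S x z) + A (a x) + a z)"] by (simp add: algebra_simps)
        also have "\<dots> \<le> (Q - B - 2) * \<delta>\<^sup>2 + Q * \<delta>\<^sup>2" using p(3) axz by linarith
        also have "\<dots> \<le> Q * \<delta>\<^sup>2 + Q * \<delta>\<^sup>2" using B by (intro add_mono mult_right_mono) auto
        finally have pq: "norm (l p - l (e (x \<otimes>\<^bsub>H\<^esub> z))) \<le> 2 * Q * \<delta>\<^sup>2" using e[OF xz] by simp
        have "p \<in> ballV r" "e (x \<otimes>\<^bsub>H\<^esub> z) \<in> ballV r"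
          using p e[OF xz] a[OF xz] \<delta>1 t tpos by (auto simp: ballV_def)
        from quot[OF this] have "inv (e (x \<otimes>\<^bsub>H\<^esub> z)) \<otimes> p \<in> V"
          "norm (l (inv (e (x \<otimes>\<^bsub>H\<^esub> z)) \<otimes> p)) \<le> 4 * Q * \<delta>\<^sup>2" using pq by auto
        moreover have "4 * Q * \<delta>\<^sup>2 \<le> M * \<delta>\<^sup>2" using B by (intro mult_right_mono) (auto simp: M_def)
        moreover have "inv (e (x \<otimes>\<^bsub>H\<^esub> z)) \<otimes> p
            = inv (f (x \<otimes>\<^bsub>H\<^esub> z) \<otimes> e (x \<otimes>\<^bsub>H\<^esub> z)) \<otimes> (f x \<otimes> e x) \<otimes> (f z \<otimes> e z)"
          using x z xz e by (simp add: p_def S_def c_def inv_mult_group m_assoc)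
        ultimately show "inv (f (x \<otimes>\<^bsub>H\<^esub> z) \<otimes> e (x \<otimes>\<^bsub>H\<^esub> z)) \<otimes> (f x \<otimes> e x) \<otimes> (f z \<otimes> e z) \<in> V \<and>
            norm (l (inv (f (x \<otimes>\<^bsub>H\<^esub> z) \<otimes> e (x \<otimes>\<^bsub>H\<^esub> z)) \<otimes> (f x \<otimes> e x) \<otimes> (f z \<otimes> e z))) \<le> M * \<delta>\<^sup>2"
          by auto
      qed
    qed
  qed
qed

text \<open>Iterates the Newton step. Of the quadratic improvement only a halving of the defect per
  step is kept. The corrections are then dominated by a geometric series, which keeps every iterate
  near \<open>f\<close>, and compactness provides a limit map whose defect is trivial.\<close>

lemma Ulam_stability:
  assumes N: "openin T N" "\<one> \<in> N"
  obtains N' where "openin T N'" "\<one> \<in> N'"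
    "\<And>(H :: ('h, 'm) monoid_scheme) f. amenable_group H \<Longrightarrow> f \<in> carrier H \<rightarrow> carrier K \<Longrightarrow>
       (\<And>x z. x \<in> carrier H \<Longrightarrow> z \<in> carrier H \<Longrightarrow> inv (f (x \<otimes>\<^bsub>H\<^esub> z)) \<otimes> f x \<otimes> f z \<in> N') \<Longrightarrow>
       \<exists>h\<in>hom H K. \<forall>x\<in>carrier H. inv (f x) \<otimes> h x \<in> N"
proof -
  obtain d M where d: "0 < d" and M: "1 \<le> M" and improve:
    "\<And>(H :: ('h, 'm) monoid_scheme) f \<delta>. amenable_group H \<Longrightarrow> f \<in> carrier H \<rightarrow> carrier K \<Longrightarrow>
       0 < \<delta> \<Longrightarrow> \<delta> \<le> d \<Longrightarrow> defect_le H f \<delta> \<Longrightarrow>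
       \<exists>e. e \<in> carrier H \<rightarrow> V \<and> (\<forall>x\<in>carrier H. norm (l (e x)) \<le> M * \<delta>) \<and>
         defect_le H (\<lambda>x. f x \<otimes> e x) (M * \<delta>\<^sup>2)"
    using defect_improvement by blast
  obtain A Cl where Cl: "openin T A" "closedin T Cl" "\<one> \<in> A" "A \<subseteq> Cl" "Cl \<subseteq> N"
    using closed_neighbourhood[OF N] by blast
  obtain \<tau> where \<tau>: "0 < \<tau>" "\<tau> \<le> R" "ballV \<tau> \<subseteq> A" using ballV_base[OF Cl(1,3) R] by blast
  \<comment> \<open>The bounds make the Newton step applicable, keep the total drift
    \<open>4 M \<delta>\<close> inside the ball of radius \<tau>, and ensure
    \<open>M \<delta> \<le> 1/2\<close> and \<open>4 C M \<delta> \<le> 1\<close>.\<close>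
  define \<delta> where "\<delta> = min d (min (\<tau> / (8 * M)) (1 / (4 * M * (C + 1))))"
  have \<delta>: "0 < \<delta>" "\<delta> \<le> d" using d M \<tau> C by (auto simp: \<delta>_def)
  have "\<delta> \<le> \<tau> / (8 * M)" by (simp add: \<delta>_def)
  then have \<delta>\<tau>: "8 * M * \<delta> \<le> \<tau>" using M by (simp add: field_simps)
  have "\<delta> \<le> 1 / (4 * M * (C + 1))" by (simp add: \<delta>_def)
  moreover have "0 < 4 * M * (C + 1)" using M C by simp
  ultimately have "\<delta> * (4 * M * (C + 1)) \<le> 1" by (simp only: pos_le_divide_eq)
  then have "4 * (C * (M * \<delta>)) + 4 * (M * \<delta>) \<le> 1" by (simp add: algebra_simps)
  moreover have M\<delta>: "0 < M * \<delta>" "\<delta> \<le> M * \<delta>" using M \<delta> by auto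
  moreover have "0 \<le> C * (M * \<delta>)" using C M\<delta> by simp
  ultimately have \<delta>M: "4 * (C * (M * \<delta>)) \<le> 1" "M * \<delta> \<le> 1 / 2" by linarith+
  show ?thesis
  proof (rule that[of "ballV \<delta>"])
    have "\<delta> \<le> R" using \<delta>\<tau> \<tau> M\<delta> by linarith
    then show "openin T (ballV \<delta>)" unfolding ballV_def by (intro open_ball \<delta>)
    show "\<one> \<in> ballV \<delta>" by (rule one_ballV[OF \<delta>(1)])
    fix H :: "('h, 'm) monoid_scheme" and f
    assume H: "amenable_group H" and f: "f \<in> carrier H \<rightarrow> carrier K"
      and def: "\<And>x z. x \<in> carrier H \<Longrightarrow> z \<in> carrier H \<Longrightarrow> inv (f (x \<otimes>\<^bsub>H\<^esub> z)) \<otimes> f x \<otimes> f z \<in> ballV \<delta>"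
    interpret H: group H using H by (simp add: amenable_group_def)
    \<comment> \<open>The invariant: the bound on the defect has halved \<open>n\<close> times, and
      the drift from \<open>f\<close> is bounded by the sum of \<open>2 M \<delta> / 2 ^ j\<close>
      over \<open>j < n\<close>, in closed form.\<close>
    define P where "P n g \<longleftrightarrow> g \<in> carrier H \<rightarrow> carrier K \<and> defect_le H g (\<delta> / 2 ^ n) \<and>
      (\<forall>x\<in>carrier H. inv (f x) \<otimes> g x \<in> V \<and>
         norm (l (inv (f x) \<otimes> g x)) \<le> 4 * (M * \<delta>) * (1 - 1 / 2 ^ n))" for n g
    have "\<exists>F. \<forall>n. P n (F n) \<and> True"
    proof (rule dependent_nat_choice)
      have "inv (f x) \<otimes> f x = \<one>" if "x \<in> carrier H" for x
        using f that by (intro l_inv) auto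
      then have "P 0 f"
        using f def by (auto simp: P_def defect_le_def ballV_def one_V l_one intro: less_imp_le)
      then show "\<exists>g. P 0 g" by blast
      fix g n assume g: "P n g"
      let ?\<delta> = "\<delta> / 2 ^ n"
      have \<delta>n: "0 < ?\<delta>" "?\<delta> \<le> \<delta>" using \<delta> by (auto simp: field_simps)
      then have "?\<delta> \<le> d" using \<delta> by linarith
      from improve[OF H _ \<delta>n(1) this, of g] g obtain e where
        e: "e \<in> carrier H \<rightarrow> V" "\<And>x. x \<in> carrier H \<Longrightarrow> norm (l (e x)) \<le> M * ?\<delta>"
          "defect_le H (\<lambda>x. g x \<otimes> e x) (M * ?\<delta>\<^sup>2)" by (auto simp: P_def)
      have "(M * ?\<delta>) * ?\<delta> \<le> (1 / 2) * ?\<delta>"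
      proof (rule mult_right_mono)
        have "M * ?\<delta> \<le> M * \<delta>" using \<delta>n M by (intro mult_left_mono) auto
        then show "M * ?\<delta> \<le> 1 / 2" using \<delta>M by linarith
      qed (use \<delta>n in simp)
      then have "M * ?\<delta>\<^sup>2 \<le> \<delta> / 2 ^ Suc n" by (simp add: power2_eq_square mult.assoc)
      with e(3) have def': "defect_le H (\<lambda>x. g x \<otimes> e x) (\<delta> / 2 ^ Suc n)"
        unfolding defect_le_def by (meson order_trans)
      have "inv (f x) \<otimes> (g x \<otimes> e x) \<in> V \<and>
         norm (l (inv (f x) \<otimes> (g x \<otimes> e x))) \<le> 4 * (M * \<delta>) * (1 - 1 / 2 ^ Suc n)" if x: "x \<in> carrier H" for x
      proof -
        let ?w = "inv (f x) \<otimes> g x"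
        have w: "?w \<in> V" "norm (l ?w) \<le> 4 * (M * \<delta>) * (1 - 1 / 2 ^ n)" using g x by (auto simp: P_def)
        have "4 * (M * \<delta>) * (1 - 1 / 2 ^ n) \<le> 4 * (M * \<delta>) * 1"
          using M\<delta> by (intro mult_left_mono) auto
        then have w4: "norm (l ?w) \<le> 4 * (M * \<delta>)" using w by linarith
        have "M * ?\<delta> \<le> M * \<delta>" using \<delta>n M by (intro mult_left_mono) auto
        then have le: "norm (l (e x)) < R" using e(2)[OF x] \<delta>\<tau> \<tau> M\<delta> by linarith
        have wR: "norm (l ?w) < R" using w4 \<delta>\<tau> \<tau> M\<delta> by linarith
        have eV: "e x \<in> V" using e(1) x by auto
        have we: "?w \<otimes> e x \<in> V" "norm (l (?w \<otimes> e x)) \<le> norm (l ?w) + norm (l (e x)) + C * norm (l ?w) * norm (l (e x))"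
          using mult_bound[OF w(1) eV order_refl order_refl wR le] by auto
        \<comment> \<open>By the choice of \<delta> the product error is at most
          \<open>|l (e x)|\<close>, so a step increases the drift by at most twice the
          correction.\<close>
        have "C * norm (l ?w) * norm (l (e x)) \<le> 1 * norm (l (e x))"
        proof (rule mult_right_mono)
          have "C * norm (l ?w) \<le> C * (4 * (M * \<delta>))" using w4 C by (rule mult_left_mono)
          then show "C * norm (l ?w) \<le> 1" using \<delta>M by simp
        qed simp
        then have "norm (l (?w \<otimes> e x)) \<le> 4 * (M * \<delta>) * (1 - 1 / 2 ^ n) + 2 * (M * ?\<delta>)"
          using we(2) w(2) e(2)[OF x] by linarith
        also have "\<dots> = 4 * (M * \<delta>) * (1 - 1 / 2 ^ Suc n)" by (simp add: field_simps)
        finally have "norm (l (?w \<otimes> e x)) \<le> 4 * (M * \<delta>) * (1 - 1 / 2 ^ Suc n)" .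
        moreover have "?w \<otimes> e x = inv (f x) \<otimes> (g x \<otimes> e x)"
          using f g x eV V by (intro m_assoc) (auto simp: P_def)
        ultimately show ?thesis using we(1) by simp
      qed
      moreover have "(\<lambda>x. g x \<otimes> e x) \<in> carrier H \<rightarrow> carrier K" using g e(1) V by (auto simp: P_def)
      ultimately have "P (Suc n) (\<lambda>x. g x \<otimes> e x)" using def' by (simp add: P_def)
      then show "\<exists>g'. P (Suc n) g' \<and> True" by auto
    qed
    then obtain F where F: "\<And>n. P n (F n)" by blast
    \<comment> \<open>Limits along an ultrafilter exist at every point at once and respect products,
      so multiplicativity passes to the limit without a Cauchy estimate between iterates.\<close>
    obtain \<F> where \<F>: "\<F> \<le> sequentially" "ultrafilter \<F>" using ultrafilter_below[of sequentially] by auto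
    have nbot: "\<not> trivial_limit \<F>" using \<F> by (simp add: ultrafilter_def)
    have "\<exists>y. limitin T (\<lambda>n. F n x) y \<F>" if "x \<in> carrier H" for x
    proof -
      have "\<forall>\<^sub>F n in \<F>. F n x \<in> topspace T" 
        using F that by (intro always_eventually) (auto simp: P_def topspace_eq Pi_iff)
      then show ?thesis using compact_space_ultrafilter_limit[OF \<F>(2) compact] by metis
    qed
    then obtain h where h: "\<And>x. x \<in> carrier H \<Longrightarrow> limitin T (\<lambda>n. F n x) (h x) \<F>" by metis
    have hK: "h x \<in> carrier K" if "x \<in> carrier H" for x
      using h[OF that] by (simp add: limitin_def topspace_eq)
    have "h (x \<otimes>\<^bsub>H\<^esub> z) = h x \<otimes> h z" if x: "x \<in> carrier H" and z: "z \<in> carrier H" for x z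
    proof -
      have "limitin T (\<lambda>n. inv (F n (x \<otimes>\<^bsub>H\<^esub> z)) \<otimes> F n x \<otimes> F n z)
          (inv (h (x \<otimes>\<^bsub>H\<^esub> z)) \<otimes> h x \<otimes> h z) \<F>"
        using x z by (intro limitin_group_mult limitin_group_inv h) auto
      moreover have "limitin T (\<lambda>n. inv (F n (x \<otimes>\<^bsub>H\<^esub> z)) \<otimes> F n x \<otimes> F n z) \<one> \<F>"
        unfolding limitin_def
      proof (intro conjI allI impI)
        show "\<one> \<in> topspace T" by (simp add: topspace_eq)
        fix U assume "openin T U \<and> \<one> \<in> U"
        then obtain s where s: "0 < s" "ballV s \<subseteq> U" using ballV_base[of U R] R by blast
        have "(\<lambda>n. \<delta> * (1 / 2) ^ n) \<longlonglongrightarrow> \<delta> * 0"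
          by (intro tendsto_intros LIMSEQ_power_zero) auto
        then have "\<forall>\<^sub>F n in sequentially. \<delta> * (1 / 2) ^ n < s"
          using s by (intro order_tendstoD(2)[of _ 0]) auto
        then have "\<forall>\<^sub>F n in \<F>. \<delta> * (1 / 2) ^ n < s" using \<F>(1) by (rule filter_leD[rotated])
        then show "\<forall>\<^sub>F n in \<F>. inv (F n (x \<otimes>\<^bsub>H\<^esub> z)) \<otimes> F n x \<otimes> F n z \<in> U"
        proof eventually_elim
          case (elim n)
          have "inv (F n (x \<otimes>\<^bsub>H\<^esub> z)) \<otimes> F n x \<otimes> F n z \<in> V"
            "norm (l (inv (F n (x \<otimes>\<^bsub>H\<^esub> z)) \<otimes> F n x \<otimes> F n z)) \<le> \<delta> * (1 / 2) ^ n"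
            using F[of n] x z by (auto simp: P_def defect_le_def power_one_over)
          then have "inv (F n (x \<otimes>\<^bsub>H\<^esub> z)) \<otimes> F n x \<otimes> F n z \<in> ballV s"
            using elim by (auto simp: ballV_def)
          then show ?case using s by blast
        qed
      qed
      ultimately have "inv (h (x \<otimes>\<^bsub>H\<^esub> z)) \<otimes> h x \<otimes> h z = \<one>"
        using limitin_Hausdorff_unique[OF _ _ nbot Hausdorff] by blast
      then have "h (x \<otimes>\<^bsub>H\<^esub> z) \<otimes> (inv (h (x \<otimes>\<^bsub>H\<^esub> z)) \<otimes> (h x \<otimes> h z)) = h (x \<otimes>\<^bsub>H\<^esub> z) \<otimes> \<one>"
        using hK x z by (simp add: m_assoc)
      then show ?thesis using hK x z by simp
    qed
    then have "h \<in> hom H K" using hK by (auto simp: hom_def)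
    moreover have "inv (f x) \<otimes> h x \<in> N" if x: "x \<in> carrier H" for x
    proof -
      have fx: "limitin T (\<lambda>n. f x) (f x) \<F>" using f x by (auto simp: limitin_def topspace_eq)
      have "limitin T (\<lambda>n. inv (f x) \<otimes> F n x) (inv (f x) \<otimes> h x) \<F>"
        by (intro limitin_group_mult limitin_group_inv h x fx)
      \<comment> \<open>The iterates are kept in a closed subset of \<open>N\<close>, since the open
        set \<open>N\<close> itself need not contain the limit.\<close>
      moreover have "inv (f x) \<otimes> F n x \<in> Cl" for n
      proof -
        have w: "inv (f x) \<otimes> F n x \<in> V" "norm (l (inv (f x) \<otimes> F n x)) \<le> 4 * (M * \<delta>) * (1 - 1 / 2 ^ n)"
          using F[of n] x by (auto simp: P_def)
        have "4 * (M * \<delta>) * (1 - 1 / 2 ^ n) \<le> 4 * (M * \<delta>) * 1"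
          using M\<delta> by (intro mult_left_mono) auto
        then have "inv (f x) \<otimes> F n x \<in> ballV \<tau>" using w \<delta>\<tau> M\<delta> by (auto simp: ballV_def)
        then show ?thesis using \<tau> Cl by auto
      qed
      ultimately have "inv (f x) \<otimes> h x \<in> Cl"
        by (intro limitin_closedin[OF _ Cl(2) _ nbot]) auto
      then show ?thesis using Cl by auto
    qed
    ultimately show "\<exists>h\<in>hom H K. \<forall>x\<in>carrier H. inv (f x) \<otimes> h x \<in> N" by blast
  qed
qed

end

section \<open>Charts of Lie groups\<close>

definition coord_box :: "nat \<Rightarrow> (nat \<Rightarrow> real) \<Rightarrow> real \<Rightarrow> (nat \<Rightarrow> real) set" where
  "coord_box m c \<epsilon> = {y. (\<forall>i\<ge>m. y i = 0) \<and> (\<forall>i<m. \<bar>y i - c i\<bar> < \<epsilon>)}"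

lemma coord_box_mono: "\<epsilon> \<le> \<epsilon>' \<Longrightarrow> coord_box m c \<epsilon> \<subseteq> coord_box m c \<epsilon>'"
  by (auto simp: coord_box_def)

lemma openin_coord_box: "openin (Euclidean_space m) (coord_box m c \<epsilon>)"
proof -
  have "openin (Euclidean_space m) {y \<in> topspace (Euclidean_space m). \<forall>i<k. \<bar>y i - c i\<bar> < \<epsilon>}" for k
  proof (induction k)
    case (Suc k)
    have "continuous_map (Euclidean_space m) euclideanreal (\<lambda>y. y k)"
      unfolding Euclidean_space_def
      by (intro continuous_map_from_subtopology continuous_map_product_coordinates) simp
    then have "openin (Euclidean_space m) {y \<in> topspace (Euclidean_space m). y k \<in> ball (c k) \<epsilon>}"
      by (rule openin_continuous_map_preimage) simp
    from openin_Int[OF Suc this] show ?case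
      by (rule back_subst) (auto simp: dist_real_def less_Suc_eq abs_minus_commute)
  qed simp
  from this[of m] show ?thesis
    by (rule back_subst) (auto simp: coord_box_def topspace_Euclidean_space)
qed

lemma openin_contains_coord_box:
  assumes "openin (Euclidean_space m) U" "x \<in> U"
  obtains \<epsilon> where "0 < \<epsilon>" "coord_box m x \<epsilon> \<subseteq> U"
proof -
  obtain S where S: "openin (powertop_real UNIV) S" "U = S \<inter> {x. \<forall>i\<ge>m. x i = 0}"
    using assms(1) unfolding Euclidean_space_def openin_subtopology by blast
  then have "x \<in> S" and x0: "\<forall>i\<ge>m. x i = 0" using assms(2) by auto
  from product_topology_open_contains_basis[OF S(1) this(1)] obtain X where
    X: "x \<in> Pi\<^sub>E UNIV X" "\<And>i. openin euclideanreal (X i)" "Pi\<^sub>E UNIV X \<subseteq> S" by blast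
  have "\<exists>e>0. ball (x i) e \<subseteq> X i" for i
  proof -
    have "open (X i)" "x i \<in> X i" using X(1) X(2)[of i] by (auto simp: PiE_iff)
    then show ?thesis by (auto simp: open_contains_ball)
  qed
  then obtain e where e: "\<And>i. 0 < e i" "\<And>i. ball (x i) (e i) \<subseteq> X i" by metis
  define \<epsilon> where "\<epsilon> = Min (insert 1 (e ` {..<m}))"
  show ?thesis
  proof (rule that[of \<epsilon>])
    show "0 < \<epsilon>" unfolding \<epsilon>_def using e(1) by (subst Min_gr_iff) auto
    show "coord_box m x \<epsilon> \<subseteq> U"
    proof
      fix y assume y: "y \<in> coord_box m x \<epsilon>"
      have "y i \<in> X i" for i
      proof (cases "i < m")
        case True
        then have "\<epsilon> \<le> e i" unfolding \<epsilon>_def by (intro Min_le) auto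
        then have "y i \<in> ball (x i) (e i)"
          using y True by (force simp: coord_box_def dist_real_def abs_minus_commute)
        then show ?thesis using e(2) by blast
      next
        case False
        then have "y i = x i" using y x0 by (auto simp: coord_box_def)
        then show ?thesis using X(1) by (auto simp: PiE_iff)
      qed
      then have "y \<in> S" using X(3) by (auto simp: PiE_iff)
      then show "y \<in> U" using S(2) y by (auto simp: coord_box_def)
    qed
  qed
qed

text \<open>Pass from \<open>y\<close> to \<open>x\<close> one coordinate at a time. A box contains
  all the mixed points \<open>h k\<close>, and between consecutive ones the mean value theorem in
  one variable applies.\<close>

lemma coordinatewise_mean_value:
  assumes deriv: "\<And>i x. i < m \<Longrightarrow> x \<in> coord_box m c \<epsilon> \<Longrightarrow>
      ((\<lambda>t. f (x(i := t))) has_real_derivative g i x) (at (x i))"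
    and bound: "\<And>i x. i < m \<Longrightarrow> x \<in> coord_box m c \<epsilon> \<Longrightarrow> \<bar>g i x\<bar> \<le> M"
    and x: "x \<in> coord_box m c \<epsilon>" and y: "y \<in> coord_box m c \<epsilon>"
  shows "\<bar>f x - f y\<bar> \<le> M * (\<Sum>i<m. \<bar>x i - y i\<bar>)"
proof -
  define h where "h k i = (if i < k then x i else y i)" for k i :: nat
  have hn: "h m = x" using x y by (auto simp: h_def coord_box_def fun_eq_iff)
  have h0: "h 0 = y" by (auto simp: h_def)
  have "\<bar>f (h k) - f (h 0)\<bar> \<le> M * (\<Sum>i<k. \<bar>x i - y i\<bar>)" if "k \<le> m" for k
    using that
  proof (induction k)
    case (Suc k)
    let ?S = "{c k - \<epsilon><..<c k + \<epsilon>}"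
    have box: "(h k)(k := t) \<in> coord_box m c \<epsilon>" if "t \<in> ?S" for t
      using x y that Suc.prems by (auto simp: coord_box_def h_def)
    have eq: "h (Suc k) = (h k)(k := x k)" "h k = (h k)(k := y k)"
      by (auto simp: h_def fun_eq_iff less_Suc_eq)
    have "norm (f ((h k)(k := x k)) - f ((h k)(k := y k))) \<le> M * norm (x k - y k)"
    proof (rule field_differentiable_bound[where S = ?S])
      fix t assume t: "t \<in> ?S"
      have "((\<lambda>s. f (((h k)(k := t))(k := s))) has_real_derivative g k ((h k)(k := t)))
          (at (((h k)(k := t)) k))"
        using Suc.prems by (intro deriv box t) auto
      then have "((\<lambda>s. f ((h k)(k := s))) has_real_derivative g k ((h k)(k := t))) (at t)" by simp
      then show "((\<lambda>s. f ((h k)(k := s))) has_real_derivative g k ((h k)(k := t))) (at t within ?S)"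
        by (rule has_field_derivative_at_within)
      show "norm (g k ((h k)(k := t))) \<le> M" using bound[OF _ box[OF t]] Suc.prems by simp
    next
      have k: "k < m" using Suc.prems by simp
      have "\<bar>x k - c k\<bar> < \<epsilon>" "\<bar>y k - c k\<bar> < \<epsilon>" using x y k by (auto simp: coord_box_def)
      then show "x k \<in> ?S" "y k \<in> ?S" by auto
    qed auto
    then have "\<bar>f (h (Suc k)) - f (h k)\<bar> \<le> M * \<bar>x k - y k\<bar>" using eq by simp
    then show ?case using Suc by (simp add: algebra_simps)
  qed simp
  from this[of m] show ?thesis by (simp add: hn h0)
qed

lemma continuous_map_locally_bounded:
  assumes cont: "continuous_map (subtopology (Euclidean_space m) U) euclideanreal h"
    and U: "coord_box m c \<epsilon> \<subseteq> U" and c: "c \<in> U" "\<forall>i\<ge>m. c i = 0" and \<epsilon>: "0 < \<epsilon>"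
  shows "\<exists>\<epsilon>'. 0 < \<epsilon>' \<and> \<epsilon>' \<le> \<epsilon> \<and> (\<forall>x\<in>coord_box m c \<epsilon>'. \<bar>h x\<bar> \<le> \<bar>h c\<bar> + 1)"
proof -
  have "openin (subtopology (Euclidean_space m) U)
      {x \<in> topspace (subtopology (Euclidean_space m) U). h x \<in> ball (h c) 1}"
    using cont by (rule openin_continuous_map_preimage) simp
  then obtain S where S: "openin (Euclidean_space m) S"
    "{x \<in> topspace (subtopology (Euclidean_space m) U). h x \<in> ball (h c) 1} = S \<inter> U"
    unfolding openin_subtopology by blast
  have "c \<in> S \<inter> U" using c unfolding S(2)[symmetric] by (simp add: topspace_Euclidean_space)
  then obtain e where e: "0 < e" "coord_box m c e \<subseteq> S" using openin_contains_coord_box[OF S(1)] by blast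
  show ?thesis
  proof (intro exI[of _ "min e \<epsilon>"] conjI ballI)
    fix x assume "x \<in> coord_box m c (min e \<epsilon>)"
    then have "x \<in> S \<inter> U" using e U coord_box_mono[of "min e \<epsilon>" e m c] coord_box_mono[of "min e \<epsilon>" \<epsilon> m c] by auto
    then have "h x \<in> ball (h c) 1" unfolding S(2)[symmetric] by simp
    then show "\<bar>h x\<bar> \<le> \<bar>h c\<bar> + 1" by (auto simp: dist_real_def)
  qed (use e \<epsilon> in auto)
qed

text \<open>The mean value estimate applied twice. The difference \<open>F (x + q) - F x\<close>, as
  a function of \<open>x\<close>, has the partial derivatives \<open>g i (x + q) - g i x\<close>,
  and local bounds on the second derivatives make these at most linear in \<open>q\<close>.\<close>

lemma mixed_difference_bound:
  assumes F: "Ck_on 2 m U F" and U: "coord_box m c \<epsilon> \<subseteq> U" and \<epsilon>: "0 < \<epsilon>" and c: "\<forall>i\<ge>m. c i = 0"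
  obtains \<epsilon>' M where "0 < \<epsilon>'" "0 \<le> M"
    "\<And>p q. \<forall>i\<ge>m. p i = 0 \<Longrightarrow> \<forall>i\<ge>m. q i = 0 \<Longrightarrow> \<forall>i<m. \<bar>p i\<bar> < \<epsilon>' \<Longrightarrow> \<forall>i<m. \<bar>q i\<bar> < \<epsilon>' \<Longrightarrow>
       \<bar>F (\<lambda>i. c i + p i + q i) - F (\<lambda>i. c i + p i) - F (\<lambda>i. c i + q i) + F c\<bar>
       \<le> M * (\<Sum>i<m. \<bar>p i\<bar>) * (\<Sum>i<m. \<bar>q i\<bar>)"
proof -
  have cb: "c \<in> coord_box m c \<epsilon>" using c \<epsilon> by (auto simp: coord_box_def)
  then have cU: "c \<in> U" using U by blast
  have "\<forall>i<m. \<exists>g. (\<forall>x\<in>U. ((\<lambda>t. F (x(i := t))) has_real_derivative g x) (at (x i))) \<and> Ck_on 1 m U g"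
    using F by (simp add: numeral_2_eq_2)
  then obtain g where g: "\<And>i x. i < m \<Longrightarrow> x \<in> U \<Longrightarrow>
      ((\<lambda>t. F (x(i := t))) has_real_derivative g i x) (at (x i))"
    and g1: "\<And>i. i < m \<Longrightarrow> Ck_on 1 m U (g i)" by metis
  let ?P = "\<lambda>i j h. (\<forall>x\<in>U. ((\<lambda>t. g i (x(j := t))) has_real_derivative h x) (at (x j))) \<and>
      continuous_map (subtopology (Euclidean_space m) U) euclideanreal h"
  define h where "h i j = (SOME h. ?P i j h)" for i j
  have hP: "?P i j (h i j)" if "i < m" "j < m" for i j
  proof -
    have "\<exists>h. ?P i j h" using g1[OF that(1)] that(2) by simp
    then show ?thesis unfolding h_def by (rule someI_ex)
  qed
  have h: "((\<lambda>t. g i (x(j := t))) has_real_derivative h i j x) (at (x j))"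
    if "i < m" "j < m" "x \<in> U" for i j x using hP[OF that(1,2)] that(3) by blast
  have hc: "continuous_map (subtopology (Euclidean_space m) U) euclideanreal (h i j)"
    if "i < m" "j < m" for i j using hP[OF that] by blast
  let ?Q = "\<lambda>i j e. 0 < e \<and> e \<le> \<epsilon> \<and> (\<forall>x\<in>coord_box m c e. \<bar>h i j x\<bar> \<le> \<bar>h i j c\<bar> + 1)"
  define e where "e i j = (SOME e. ?Q i j e)" for i j
  have e: "?Q i j (e i j)" if "i < m" "j < m" for i j
  proof -
    have "\<exists>e. ?Q i j e" by (rule continuous_map_locally_bounded[OF hc[OF that] U cU c \<epsilon>])
    then show ?thesis unfolding e_def by (rule someI_ex)
  qed
  \<comment> \<open>The inserted values \<epsilon> and 0 also cover \<open>m = 0\<close>, where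
    there are no derivatives to bound.\<close>
  define E where "E = Min (insert \<epsilon> ((\<lambda>(i, j). e i j) ` ({..<m} \<times> {..<m})))"
  define M where "M = Max (insert 0 ((\<lambda>(i, j). \<bar>h i j c\<bar> + 1) ` ({..<m} \<times> {..<m})))"
  have E: "0 < E" "E \<le> \<epsilon>" "\<And>i j. i < m \<Longrightarrow> j < m \<Longrightarrow> E \<le> e i j"
  proof -
    show "0 < E" unfolding E_def using e \<epsilon> by (subst Min_gr_iff) auto
    show "E \<le> \<epsilon>" unfolding E_def by (intro Min_le) auto
    show "E \<le> e i j" if "i < m" "j < m" for i j unfolding E_def using that by (intro Min_le) auto
  qed
  have M: "0 \<le> M" "\<And>i j. i < m \<Longrightarrow> j < m \<Longrightarrow> \<bar>h i j c\<bar> + 1 \<le> M"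
  proof -
    show "0 \<le> M" unfolding M_def by (intro Max_ge) auto
    show "\<bar>h i j c\<bar> + 1 \<le> M" if "i < m" "j < m" for i j unfolding M_def using that by (intro Max_ge) auto
  qed
  have hM: "\<bar>h i j x\<bar> \<le> M" if "i < m" "j < m" "x \<in> coord_box m c E" for i j x
  proof -
    have "x \<in> coord_box m c (e i j)" using coord_box_mono[OF E(3)[OF that(1,2)]] that(3) by blast
    then have "\<bar>h i j x\<bar> \<le> \<bar>h i j c\<bar> + 1" using e[OF that(1,2)] by blast
    then show ?thesis using M(2)[OF that(1,2)] by linarith
  qed
  have EU: "coord_box m c E \<subseteq> U" using U E coord_box_mono by blast
  show ?thesis
  \<comment> \<open>The half radius leaves room for the shift by \<open>q\<close> inside the box of
    radius \<open>E\<close>.\<close>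
  proof (rule that[of "E / 2" M])
    fix p q :: "nat \<Rightarrow> real"
    assume p: "\<forall>i\<ge>m. p i = 0" "\<forall>i<m. \<bar>p i\<bar> < E / 2" and q: "\<forall>i\<ge>m. q i = 0" "\<forall>i<m. \<bar>q i\<bar> < E / 2"
    let ?f = "\<lambda>x. F (\<lambda>i. x i + q i) - F x"
    have shift: "(\<lambda>i. x i + q i) \<in> coord_box m c E" "x \<in> coord_box m c E" if "x \<in> coord_box m c (E / 2)" for x
    proof -
      have "\<bar>x i + q i - c i\<bar> < E" if i: "i < m" for i
      proof -
        have "\<bar>x i - c i\<bar> < E / 2" "\<bar>q i\<bar> < E / 2"
          using q(2) i \<open>x \<in> coord_box m c (E / 2)\<close> by (auto simp: coord_box_def)
        then show ?thesis by linarith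
      qed
      then show "(\<lambda>i. x i + q i) \<in> coord_box m c E" using q(1) that by (auto simp: coord_box_def)
      show "x \<in> coord_box m c E" using that E(1) coord_box_mono[of "E / 2" E m c] by auto
    qed
    have gq: "\<bar>g i (\<lambda>k. x k + q k) - g i x\<bar> \<le> M * (\<Sum>j<m. \<bar>q j\<bar>)"
      if "i < m" "x \<in> coord_box m c (E / 2)" for i x
    proof -
      have "\<bar>g i (\<lambda>k. x k + q k) - g i x\<bar> \<le> M * (\<Sum>j<m. \<bar>(x j + q j) - x j\<bar>)"
        by (rule coordinatewise_mean_value[OF h[OF that(1)] hM[OF that(1)] shift[OF that(2)]])
          (use EU in auto)
      then show ?thesis by simp
    qed
    have "\<bar>?f (\<lambda>i. c i + p i) - ?f c\<bar> \<le> (M * (\<Sum>j<m. \<bar>q j\<bar>)) * (\<Sum>i<m. \<bar>(c i + p i) - c i\<bar>)"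
    proof (rule coordinatewise_mean_value[where g = "\<lambda>i x. g i (\<lambda>k. x k + q k) - g i x"])
      fix i x assume i: "i < m" and x: "x \<in> coord_box m c (E / 2)"
      have "((\<lambda>t. F ((\<lambda>k. x k + q k)(i := t))) has_real_derivative g i (\<lambda>k. x k + q k)) (at (x i + q i))"
        using g[OF i, of "\<lambda>k. x k + q k"] shift[OF x] EU by auto
      then have "((\<lambda>t. F ((\<lambda>k. x k + q k)(i := t + q i))) has_real_derivative g i (\<lambda>k. x k + q k)) (at (x i))"
        by (subst (asm) DERIV_shift) simp
      moreover have "(\<lambda>k. x k + q k)(i := t + q i) = (\<lambda>k. (x(i := t)) k + q k)" for t
        by (auto simp: fun_eq_iff)
      ultimately have "((\<lambda>t. F (\<lambda>k. (x(i := t)) k + q k)) has_real_derivative g i (\<lambda>k. x k + q k)) (at (x i))"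
        by simp
      moreover have "((\<lambda>t. F (x(i := t))) has_real_derivative g i x) (at (x i))"
        using g[OF i, of x] shift[OF x] EU by auto
      ultimately show "((\<lambda>t. ?f (x(i := t))) has_real_derivative g i (\<lambda>k. x k + q k) - g i x) (at (x i))"
        by (rule DERIV_diff)
      show "\<bar>g i (\<lambda>k. x k + q k) - g i x\<bar> \<le> M * (\<Sum>j<m. \<bar>q j\<bar>)" by (rule gq[OF i x])
    next
      show "(\<lambda>i. c i + p i) \<in> coord_box m c (E / 2)" "c \<in> coord_box m c (E / 2)"
        using p c E by (auto simp: coord_box_def)
    qed
    moreover have "?f (\<lambda>i. c i + p i) - ?f c
        = F (\<lambda>i. c i + p i + q i) - F (\<lambda>i. c i + p i) - F (\<lambda>i. c i + q i) + F c"
      by (simp add: add.assoc)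
    ultimately show "\<bar>F (\<lambda>i. c i + p i + q i) - F (\<lambda>i. c i + p i) - F (\<lambda>i. c i + q i) + F c\<bar>
       \<le> M * (\<Sum>i<m. \<bar>p i\<bar>) * (\<Sum>i<m. \<bar>q i\<bar>)" by (simp add: algebra_simps)
  qed (use E M in auto)
qed

section \<open>Bounded sequences as a common model space\<close>

instantiation nat :: metric_space
begin

text \<open>The discrete metric induces the given topology of \<open>nat\<close>. Every sequence is
  then continuous, and the bounded real sequences form a Banach space under the sup norm.\<close>

definition dist_nat :: "nat \<Rightarrow> nat \<Rightarrow> real" where
  "dist_nat m n = (if m = n then 0 else 1)"

definition uniformity_nat :: "(nat \<times> nat) filter" where
  "uniformity_nat = (INF e\<in>{0 <..}. principal {(x, y). dist x y < e})"

instance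
proof
  fix x y z :: nat and U :: "nat set"
  show "uniformity = (INF e\<in>{0 <..}. principal {(x :: nat, y). dist x y < e})"
    by (rule uniformity_nat_def)
  have "\<forall>\<^sub>F (x', y) in uniformity. x' = x \<longrightarrow> y \<in> U" if "x \<in> U" for x
    unfolding uniformity_nat_def
    by (rule eventually_INF1[of 1]) (use that in \<open>auto simp: eventually_principal dist_nat_def split: if_splits\<close>)
  then show "open U \<longleftrightarrow> (\<forall>x\<in>U. \<forall>\<^sub>F (x', y) in uniformity. x' = x \<longrightarrow> y \<in> U)"
    by (simp add: open_discrete)
qed (auto simp: dist_nat_def)

end

instance bcontfun :: (metric_space, banach) banach ..

text \<open>The sup-normed copy of \<open>n\<close>-space inside the bounded sequences: a single normed type
  that serves every \<open>n\<close>.\<close>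

definition coord_space :: "nat \<Rightarrow> (nat \<Rightarrow>\<^sub>C real) set" where
  "coord_space n = {u. \<forall>i\<ge>n. apply_bcontfun u i = 0}"

lemma apply_Bcontfun_finite_support:
  fixes f :: "nat \<Rightarrow> real"
  assumes "\<forall>i\<ge>n. f i = 0"
  shows "apply_bcontfun (Bcontfun f) = f"
proof (rule Bcontfun_inverse)
  have "f i \<in> insert 0 (f ` {..<n})" for i
  proof (cases "i < n")
    case False
    then have "f i = 0" using assms by simp
    then show ?thesis by simp
  qed simp
  then have "range f \<subseteq> insert 0 (f ` {..<n})" by blast
  then have "finite (range f)" by (rule finite_subset) simp
  then show "f \<in> bcontfun" by (auto simp: bcontfun_def intro: finite_imp_bounded)
qed

lemma subspace_coord_space: "subspace (coord_space n)"
  by (auto simp: subspace_def coord_space_def)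

text \<open>Only finitely many coordinates can be nonzero, so their supremum is a maximum and strict
  bounds survive. Positivity of \<open>s\<close> covers the vanishing coordinates and the case
  \<open>n = 0\<close>.\<close>

lemma norm_coord_space_less_iff:
  assumes "u \<in> coord_space n" "0 < s"
  shows "norm u < s \<longleftrightarrow> (\<forall>i<n. \<bar>apply_bcontfun u i\<bar> < s)"
proof
  assume "norm u < s"
  then show "\<forall>i<n. \<bar>apply_bcontfun u i\<bar> < s" using norm_bounded[of u] by (auto intro: le_less_trans)
next
  assume *: "\<forall>i<n. \<bar>apply_bcontfun u i\<bar> < s"
  define b where "b = Max (insert 0 ((\<lambda>i. \<bar>apply_bcontfun u i\<bar>) ` {..<n}))"
  have "norm u \<le> b"
  proof (rule norm_bound)
    fix i show "norm (apply_bcontfun u i) \<le> b"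
    proof (cases "i < n")
      case True then show ?thesis unfolding b_def by (intro Max_ge) auto
    next
      case False
      have "0 \<le> b" unfolding b_def by (intro Max_ge) auto
      then show ?thesis using False assms(1) by (auto simp: coord_space_def)
    qed
  qed
  also have "b < s" unfolding b_def using * assms(2) by (subst Max_less_iff) auto
  finally show "norm u < s" .
qed

text \<open>Round every coordinate towards zero to a multiple of \<eta>. Towards zero, so that the
  norm does not grow; zero is fixed, so that the coordinates from \<open>n\<close> on remain zero;
  and a ball contains only finitely many grid points.\<close>

lemma coord_space_rounding:
  assumes "0 < \<eta>" "0 < d"
  shows "\<exists>\<rho>. finite (\<rho> ` {u\<in>coord_space n. norm u \<le> d}) \<and>
    (\<forall>u\<in>coord_space n. norm u \<le> d \<longrightarrow> \<rho> u \<in> coord_space n \<and> norm (\<rho> u) \<le> d \<and> norm (\<rho> u - u) \<le> \<eta>)"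
proof -
  define k where "k t = (if 0 \<le> t then \<lfloor>t / \<eta>\<rfloor> else \<lceil>t / \<eta>\<rceil>)" for t :: real
  define q where "q t = \<eta> * of_int (k t)" for t
  have q: "\<bar>q t\<bar> \<le> \<bar>t\<bar>" "\<bar>q t - t\<bar> \<le> \<eta>" for t
  proof -
    have k: "\<bar>of_int (k t)\<bar> \<le> \<bar>t / \<eta>\<bar> \<and> \<bar>of_int (k t) - t / \<eta>\<bar> \<le> 1"
    proof (cases "0 \<le> t")
      case True
      then have "0 \<le> t / \<eta>" using assms by simp
      moreover have "0 \<le> \<lfloor>z\<rfloor>" if "0 \<le> z" for z :: real using that by simp
      moreover have "k t = \<lfloor>t / \<eta>\<rfloor>" using True by (simp add: k_def)
      ultimately have "0 \<le> real_of_int (k t)" "real_of_int (k t) \<le> t / \<eta>" "t / \<eta> < real_of_int (k t) + 1"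
        by auto
      then show ?thesis by (intro conjI; linarith)
    next
      case False
      then have "t / \<eta> < 0" using assms by (simp add: divide_less_0_iff)
      moreover have "\<lceil>z\<rceil> \<le> 0" if "z < 0" for z :: real using that by (simp add: ceiling_le_iff)
      moreover have "k t = \<lceil>t / \<eta>\<rceil>" using False by (simp add: k_def)
      ultimately have "real_of_int (k t) \<le> 0" "t / \<eta> \<le> real_of_int (k t)" "real_of_int (k t) < t / \<eta> + 1"
        using ceiling_correct[of "t / \<eta>"] by auto
      then show ?thesis by (intro conjI; linarith)
    qed
    have "\<bar>q t\<bar> = \<eta> * \<bar>of_int (k t)\<bar>" "\<bar>t\<bar> = \<eta> * \<bar>t / \<eta>\<bar>"
      using assms by (simp_all add: q_def abs_mult)
    then show "\<bar>q t\<bar> \<le> \<bar>t\<bar>" using k assms by (simp only: mult_le_cancel_left_pos)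
    have "q t - t = \<eta> * (of_int (k t) - t / \<eta>)" using assms by (simp add: q_def right_diff_distrib)
    then have "\<bar>q t - t\<bar> = \<eta> * \<bar>of_int (k t) - t / \<eta>\<bar>" using assms by (simp only: abs_mult abs_of_pos)
    also have "\<dots> \<le> \<eta> * 1" using k assms by (intro mult_left_mono) auto
    finally show "\<bar>q t - t\<bar> \<le> \<eta>" by simp
  qed
  define \<rho> where "\<rho> u = Bcontfun (\<lambda>i. q (apply_bcontfun u i))" for u :: "nat \<Rightarrow>\<^sub>C real"
  have q0: "q 0 = 0" by (simp add: q_def k_def)
  have \<rho>: "apply_bcontfun (\<rho> u) = (\<lambda>i. q (apply_bcontfun u i))" if "u \<in> coord_space n" for u
    unfolding \<rho>_def by (rule apply_Bcontfun_finite_support[of n]) (use that q0 in \<open>auto simp: coord_space_def\<close>)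
  define B where "B = (\<lambda>j. \<eta> * of_int j) ` {- \<lceil>d / \<eta>\<rceil> .. \<lceil>d / \<eta>\<rceil>}"
  have qB: "q t \<in> B" if "\<bar>t\<bar> \<le> d" for t
  proof -
    have "\<eta> * \<bar>of_int (k t)\<bar> \<le> d" using q(1)[of t] that assms by (simp add: q_def abs_mult)
    then have "\<bar>of_int (k t)\<bar> \<le> d / \<eta>" using assms by (simp add: field_simps)
    then have "k t \<in> {- \<lceil>d / \<eta>\<rceil> .. \<lceil>d / \<eta>\<rceil>}" by (auto; linarith)
    then show ?thesis by (auto simp: B_def q_def)
  qed
  show ?thesis
  proof (intro exI[of _ \<rho>] conjI ballI impI)
    have "apply_bcontfun ` \<rho> ` {u\<in>coord_space n. norm u \<le> d}
        \<subseteq> {f. \<forall>i. (i \<in> {..<n} \<longrightarrow> f i \<in> B) \<and> (i \<notin> {..<n} \<longrightarrow> f i = 0)}"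
    proof
      fix f assume "f \<in> apply_bcontfun ` \<rho> ` {u\<in>coord_space n. norm u \<le> d}"
      then obtain u where u: "u \<in> coord_space n" "norm u \<le> d" "f = apply_bcontfun (\<rho> u)" by auto
      have "\<bar>apply_bcontfun u i\<bar> \<le> d" for i using norm_bounded[of u i] u(2) by simp
      then show "f \<in> {f. \<forall>i. (i \<in> {..<n} \<longrightarrow> f i \<in> B) \<and> (i \<notin> {..<n} \<longrightarrow> f i = 0)}"
        using qB q0 u(1) by (auto simp: u(3) \<rho>[OF u(1)] coord_space_def)
    qed
    moreover have "finite {f. \<forall>i. (i \<in> {..<n} \<longrightarrow> f i \<in> B) \<and> (i \<notin> {..<n} \<longrightarrow> f i = 0)}"
      by (rule finite_set_of_finite_funs) (auto simp: B_def)
    ultimately have "finite (apply_bcontfun ` \<rho> ` {u\<in>coord_space n. norm u \<le> d})" by (rule finite_subset)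
    then show "finite (\<rho> ` {u\<in>coord_space n. norm u \<le> d})"
      by (rule finite_imageD) (auto simp: inj_on_def apply_bcontfun_inject)
    fix u assume u: "u \<in> coord_space n" "norm u \<le> d"
    show "\<rho> u \<in> coord_space n" using \<rho>[OF u(1)] u(1) q0 by (simp add: coord_space_def)
    show "norm (\<rho> u) \<le> d"
    proof (rule norm_bound)
      fix i show "norm (apply_bcontfun (\<rho> u) i) \<le> d"
        using q(1)[of "apply_bcontfun u i"] norm_bounded[of u i] u(2) by (simp add: \<rho>[OF u(1)])
    qed
    show "norm (\<rho> u - u) \<le> \<eta>" by (rule norm_bound) (simp add: \<rho>[OF u(1)] q(2))
  qed
qed

section \<open>A chart at the identity of a compact Lie group\<close>

lemma (in compact_topological_group) product_neighbourhood:
  assumes "openin T N" "\<one> \<in> N"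
  obtains N' where "openin T N'" "\<one> \<in> N'" "\<And>p q. p \<in> N' \<Longrightarrow> q \<in> N' \<Longrightarrow> p \<otimes> q \<in> N"
proof -
  obtain A where A: "openin T A" "\<one> \<in> A" "\<And>p q. p \<in> A \<Longrightarrow> q \<in> A \<Longrightarrow> inv q \<otimes> p \<in> N"
    using quotient_neighbourhood[OF assms] by blast
  have "openin T {x \<in> topspace T. inv x \<in> A}"
    using continuous_inv A(1) by (rule openin_continuous_map_preimage)
  then have op: "openin T (A \<inter> {x \<in> topspace T. inv x \<in> A})" using A(1) by blast
  show ?thesis
  proof (rule that[OF op])
    show "p \<otimes> q \<in> N" if "p \<in> A \<inter> {x \<in> topspace T. inv x \<in> A}" "q \<in> A \<inter> {x \<in> topspace T. inv x \<in> A}" for p q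
      using A(3)[of q "inv p"] that by (simp add: topspace_eq)
  qed (use A in \<open>simp add: topspace_eq\<close>)
qed

text \<open>Recentre a chart, \<open>l x = \<phi> x - \<phi> \<one>\<close>, and let
  \<open>F\<close> be multiplication in coordinates on \<open>2 n\<close>-space. With increments
  \<open>p = (l x, 0)\<close> and \<open>q = (0, l y)\<close> at the point
  \<open>(\<phi> \<one>, \<phi> \<one>)\<close>, the mixed second difference of \<open>F\<close> is
  exactly \<open>l (xy) - l x - l y\<close>, because \<open>x \<one> = x\<close> and
  \<open>\<one> y = y\<close>. Two continuous derivatives of \<open>F\<close> thus give the product
  estimate.\<close>

lemma Lie_group_almost_additive_chart:
  fixes K :: "('k, 'z) monoid_scheme" (structure)
  assumes Lie: "Lie_group n K T \<A>" and compact: "compact_space T"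
  shows "\<exists>V (l :: 'k \<Rightarrow> nat \<Rightarrow>\<^sub>C real) R C. almost_additive_chart K T (coord_space n) V l R C"
proof -
  note Lie' = Lie[unfolded Lie_group_def]
  interpret K: group K using Lie' by simp
  interpret compact_topological_group K T
    using Lie' compact by unfold_locales auto
  have atlas: "smooth_atlas n T \<A>" using Lie' by simp
  have "\<one> \<in> (\<Union>(V, \<phi>) \<in> \<A>. V)" using atlas by (simp add: smooth_atlas_def topspace_eq)
  then obtain V \<phi> where c\<A>: "(V, \<phi>) \<in> \<A>" and one_V: "\<one> \<in> V" by auto
  have "is_chart n T (V, \<phi>)" using atlas c\<A> by (auto simp: smooth_atlas_def)
  then have VT: "openin T V" and \<phi>V: "openin (Euclidean_space n) (\<phi> ` V)"
    and hom: "homeomorphic_map (subtopology T V) (subtopology (Euclidean_space n) (\<phi> ` V)) \<phi>"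
    by (auto simp: is_chart_def)
  have VK: "V \<subseteq> carrier K" using openin_subset[OF VT] by (simp add: topspace_eq)
  have tsV: "topspace (subtopology T V) = V" using openin_subset[OF VT] by auto
  have inj: "inj_on \<phi> V" using homeomorphic_imp_injective_map[OF hom] by (simp only: tsV)
  have \<phi>0: "\<phi> x i = 0" if "x \<in> V" "n \<le> i" for x i
  proof -
    have "\<phi> x \<in> topspace (Euclidean_space n)" using openin_subset[OF \<phi>V] that by auto
    then show ?thesis using that(2) by (simp add: topspace_Euclidean_space)
  qed
  define c where "c = \<phi> \<one>"
  have c0: "c i = 0" if "n \<le> i" for i using \<phi>0[OF one_V that] by (simp add: c_def)
  have inv\<phi>: "inv_into V \<phi> (\<phi> x) = x" if "x \<in> V" for x using inv_into_f_f[OF inj that] .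
  define l where "l x = Bcontfun (\<lambda>i. \<phi> x i - c i)" for x
  have l: "apply_bcontfun (l x) = (\<lambda>i. \<phi> x i - c i)" if "x \<in> V" for x
    unfolding l_def by (rule apply_Bcontfun_finite_support[of n]) (use that \<phi>0 c0 in auto)
  have lW: "l x \<in> coord_space n" if "x \<in> V" for x using l[OF that] \<phi>0[OF that] c0 by (simp add: coord_space_def)
  have box: "norm (l x) < s \<longleftrightarrow> \<phi> x \<in> coord_box n c s" if "x \<in> V" "0 < s" for x s
    using norm_coord_space_less_iff[OF lW[OF that(1)] that(2)] \<phi>0[OF that(1)] by (simp add: l[OF that(1)] coord_box_def)
  have open_image: "openin (Euclidean_space n) (\<phi> ` (N \<inter> V))" if "openin T N" for N
  proof -
    have "openin (subtopology T V) (N \<inter> V)" using that by (auto simp: openin_subtopology)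
    then have "openin (subtopology (Euclidean_space n) (\<phi> ` V)) (\<phi> ` (N \<inter> V))"
      using homeomorphic_imp_open_map[OF hom] by (simp add: open_map_def)
    then show ?thesis using openin_trans_full \<phi>V by blast
  qed
  have base: "\<exists>s>0. {x\<in>V. norm (l x) < s} \<subseteq> N" if N: "openin T N" "\<one> \<in> N" for N
  proof -
    have "c \<in> \<phi> ` (N \<inter> V)" using N one_V by (auto simp: c_def)
    then obtain s where s: "0 < s" "coord_box n c s \<subseteq> \<phi> ` (N \<inter> V)"
      using openin_contains_coord_box[OF open_image[OF N(1)]] by blast
    have "x \<in> N" if x: "x \<in> V" "norm (l x) < s" for x
    proof -
      have "\<phi> x \<in> \<phi> ` (N \<inter> V)" using box[OF x(1) s(1)] x(2) s(2) by blast
      then show ?thesis using inj x(1) by (auto dest: inj_onD)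
    qed
    then show ?thesis using s(1) by blast
  qed
  have open_ball: "openin T {x\<in>V. norm (l x) < s}" if "0 < s" for s
  proof -
    have "continuous_map (subtopology T V) (Euclidean_space n) \<phi>"
      using homeomorphic_imp_continuous_map[OF hom] by (simp add: continuous_map_in_subtopology)
    then have "openin (subtopology T V) {x \<in> topspace (subtopology T V). \<phi> x \<in> coord_box n c s}"
      using openin_coord_box by (rule openin_continuous_map_preimage)
    then have "openin (subtopology T V) {x\<in>V. norm (l x) < s}"
      by (rule back_subst) (use tsV box that in auto)
    then show ?thesis using VT openin_trans_full by blast
  qed
  obtain N1 where N1: "openin T N1" "\<one> \<in> N1"
    "\<And>p q. p \<in> N1 \<Longrightarrow> q \<in> N1 \<Longrightarrow> p \<otimes> q \<in> V"
    using product_neighbourhood[OF VT one_V] by blast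
  have "c \<in> \<phi> ` (N1 \<inter> V)" using N1 one_V by (auto simp: c_def)
  \<comment> \<open>The points with coordinates in this box have products in \<open>V\<close>, so
    \<open>F\<close> is smooth on the box of the same radius around the doubled centre
    \<open>c2\<close>.\<close>
  then obtain e0 where e0: "0 < e0" "coord_box n c e0 \<subseteq> \<phi> ` (N1 \<inter> V)"
    using openin_contains_coord_box[OF open_image[OF N1(1)]] by blast
  have invN1: "inv_into V \<phi> w \<in> N1" "w \<in> \<phi> ` V" if "w \<in> coord_box n c e0" for w
    using e0(2) that inv\<phi> by auto
  define U where "U = {z \<in> topspace (Euclidean_space (2 * n)).
     fst_half n z \<in> \<phi> ` V \<and> snd_half n z \<in> \<phi> ` V \<and>
     inv_into V \<phi> (fst_half n z) \<otimes> inv_into V \<phi> (snd_half n z) \<in> V}"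
  define F where "F j = (\<lambda>z. \<phi> (inv_into V \<phi> (fst_half n z) \<otimes> inv_into V \<phi> (snd_half n z)) j)" for j
  have "smooth_on (2 * n) U (\<lambda>z. \<phi> (inv_into V \<phi> (fst_half n z) \<otimes> inv_into V \<phi> (snd_half n z)))"
    using Lie' c\<A> unfolding U_def by fast
  then have F: "Ck_on 2 (2 * n) U (F j)" for j by (simp add: smooth_on_def F_def)
  define c2 where "c2 i = (if i < n then c i else if i < 2 * n then c (i - n) else 0)" for i
  have boxU: "coord_box (2 * n) c2 e0 \<subseteq> U"
  proof
    fix z assume z: "z \<in> coord_box (2 * n) c2 e0"
    have "\<bar>z i - c i\<bar> < e0" "\<bar>z (n + i) - c i\<bar> < e0" if "i < n" for i
    proof -
      have "\<bar>z i - c2 i\<bar> < e0" "\<bar>z (n + i) - c2 (n + i)\<bar> < e0"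
        using z that by (auto simp: coord_box_def)
      then show "\<bar>z i - c i\<bar> < e0" "\<bar>z (n + i) - c i\<bar> < e0" using that by (auto simp: c2_def)
    qed
    then have "fst_half n z \<in> coord_box n c e0" "snd_half n z \<in> coord_box n c e0"
      by (auto simp: coord_box_def fst_half_def snd_half_def)
    then show "z \<in> U"
      using invN1 N1(3) z by (auto simp: U_def topspace_Euclidean_space coord_box_def)
  qed
  let ?P = "\<lambda>j \<epsilon> M. \<forall>p q. (\<forall>i\<ge>2*n. p i = 0) \<longrightarrow> (\<forall>i\<ge>2*n. q i = 0) \<longrightarrow>
      (\<forall>i<2*n. \<bar>p i\<bar> < \<epsilon>) \<longrightarrow> (\<forall>i<2*n. \<bar>q i\<bar> < \<epsilon>) \<longrightarrow>
      \<bar>F j (\<lambda>i. c2 i + p i + q i) - F j (\<lambda>i. c2 i + p i) - F j (\<lambda>i. c2 i + q i) + F j c2\<bar>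
       \<le> M * (\<Sum>i<2*n. \<bar>p i\<bar>) * (\<Sum>i<2*n. \<bar>q i\<bar>)"
  have ex: "\<exists>\<epsilon> M. 0 < \<epsilon> \<and> 0 \<le> M \<and> ?P j \<epsilon> M" for j
  proof -
    obtain \<epsilon> M where "0 < \<epsilon>" "0 \<le> M" and
      "\<And>p q. \<forall>i\<ge>2*n. p i = 0 \<Longrightarrow> \<forall>i\<ge>2*n. q i = 0 \<Longrightarrow> \<forall>i<2*n. \<bar>p i\<bar> < \<epsilon> \<Longrightarrow> \<forall>i<2*n. \<bar>q i\<bar> < \<epsilon> \<Longrightarrow>
       \<bar>F j (\<lambda>i. c2 i + p i + q i) - F j (\<lambda>i. c2 i + p i) - F j (\<lambda>i. c2 i + q i) + F j c2\<bar>
       \<le> M * (\<Sum>i<2*n. \<bar>p i\<bar>) * (\<Sum>i<2*n. \<bar>q i\<bar>)"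
      by (rule mixed_difference_bound[OF F boxU e0(1), of j]) (auto simp: c2_def)
    then show ?thesis by (intro exI[of _ \<epsilon>] exI[of _ M]) simp
  qed
  define \<epsilon> where "\<epsilon> j = (SOME \<epsilon>. \<exists>M. 0 < \<epsilon> \<and> 0 \<le> M \<and> ?P j \<epsilon> M)" for j
  have ex': "\<exists>M. 0 < \<epsilon> j \<and> 0 \<le> M \<and> ?P j (\<epsilon> j) M" for j
    unfolding \<epsilon>_def by (rule someI_ex) (rule ex)
  define M where "M j = (SOME M. 0 < \<epsilon> j \<and> 0 \<le> M \<and> ?P j (\<epsilon> j) M)" for j
  have \<epsilon>M: "0 < \<epsilon> j \<and> 0 \<le> M j \<and> ?P j (\<epsilon> j) (M j)" for j
    unfolding M_def by (rule someI_ex) (rule ex')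
  \<comment> \<open>One radius and one constant for all coordinates; the inserted values also cover
    \<open>n = 0\<close>.\<close>
  define R where "R = Min (insert e0 (\<epsilon> ` {..<n}))"
  define D where "D = Max (insert 0 (M ` {..<n}))"
  have R: "0 < R" "R \<le> e0" "\<And>j. j < n \<Longrightarrow> R \<le> \<epsilon> j"
  proof -
    show "0 < R" unfolding R_def using e0(1) \<epsilon>M by (subst Min_gr_iff) auto
    show "R \<le> e0" unfolding R_def by (intro Min_le) auto
    show "R \<le> \<epsilon> j" if "j < n" for j unfolding R_def using that by (intro Min_le) auto
  qed
  have D: "0 \<le> D" "\<And>j. j < n \<Longrightarrow> M j \<le> D"
  proof -
    show "0 \<le> D" unfolding D_def by (intro Max_ge) auto
    show "M j \<le> D" if "j < n" for j unfolding D_def using that by (intro Max_ge) auto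
  qed
  \<comment> \<open>Each sum over \<open>2 n\<close> coordinates is at most \<open>2 n\<close> times
    the sup norm.\<close>
  define C where "C = D * real (2 * n) * real (2 * n)"
  have C: "0 \<le> C" using D by (simp add: C_def)
  have mult: "x \<otimes> y \<in> V \<and> norm (l (x \<otimes> y) - l x - l y) \<le> C * norm (l x) * norm (l y)"
    if x: "x \<in> V" "norm (l x) < R" and y: "y \<in> V" "norm (l y) < R" for x y
  proof -
    have "norm (l x) < e0" "norm (l y) < e0" using x y R(2) by linarith+
    then have "\<phi> x \<in> coord_box n c e0" "\<phi> y \<in> coord_box n c e0"
      using box[OF _ e0(1)] x(1) y(1) by auto
    then have "x \<in> N1" "y \<in> N1" using invN1(1) inv\<phi> x(1) y(1) by metis+
    then have xy: "x \<otimes> y \<in> V" by (rule N1(3))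
    define p where "p i = (if i < n then apply_bcontfun (l x) i else 0)" for i
    define q where "q i = (if n \<le> i \<and> i < 2 * n then apply_bcontfun (l y) (i - n) else 0)" for i
    have pq: "\<bar>p i\<bar> \<le> norm (l x)" "\<bar>q i\<bar> \<le> norm (l y)" for i
      using norm_bounded[of "l x" i] norm_bounded[of "l y" "i - n"] by (auto simp: p_def q_def)
    have halves: "fst_half n (\<lambda>i. c2 i + p i + q i) = \<phi> x" "snd_half n (\<lambda>i. c2 i + p i + q i) = \<phi> y"
      "fst_half n (\<lambda>i. c2 i + p i) = \<phi> x" "snd_half n (\<lambda>i. c2 i + p i) = c"
      "fst_half n (\<lambda>i. c2 i + q i) = c" "snd_half n (\<lambda>i. c2 i + q i) = \<phi> y"
      "fst_half n c2 = c" "snd_half n c2 = c"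
      using \<phi>0[OF x(1)] \<phi>0[OF y(1)] c0
      by (auto simp: fst_half_def snd_half_def c2_def p_def q_def l[OF x(1)] l[OF y(1)] fun_eq_iff)
    have invc: "inv_into V \<phi> c = \<one>" using inv\<phi>[OF one_V] by (simp add: c_def)
    have xK: "x \<in> carrier K" "y \<in> carrier K" using x y VK by auto
    have FF: "F j (\<lambda>i. c2 i + p i + q i) = \<phi> (x \<otimes> y) j" "F j (\<lambda>i. c2 i + p i) = \<phi> x j"
      "F j (\<lambda>i. c2 i + q i) = \<phi> y j" "F j c2 = c j" for j
      unfolding F_def halves inv\<phi>[OF x(1)] inv\<phi>[OF y(1)] invc using xK by (simp_all add: c_def)
    have "norm (l (x \<otimes> y) - l x - l y) \<le> C * norm (l x) * norm (l y)"
    proof (rule norm_bound)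
      fix j
      have eq: "apply_bcontfun (l (x \<otimes> y) - l x - l y) j = \<phi> (x \<otimes> y) j - \<phi> x j - \<phi> y j + c j"
        by (simp add: l[OF x(1)] l[OF y(1)] l[OF xy])
      show "norm (apply_bcontfun (l (x \<otimes> y) - l x - l y) j) \<le> C * norm (l x) * norm (l y)"
      proof (cases "j < n")
        case True
        have small: "norm (l x) < \<epsilon> j" "norm (l y) < \<epsilon> j" using x y R(3)[OF True] by linarith+
        have "\<bar>p i\<bar> < \<epsilon> j" "\<bar>q i\<bar> < \<epsilon> j" for i
          using pq[of i] small by linarith+
        moreover have "\<forall>i\<ge>2*n. p i = 0" "\<forall>i\<ge>2*n. q i = 0" by (auto simp: p_def q_def)
        ultimately have "\<bar>F j (\<lambda>i. c2 i + p i + q i) - F j (\<lambda>i. c2 i + p i) - F j (\<lambda>i. c2 i + q i) + F j c2\<bar>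
            \<le> M j * (\<Sum>i<2*n. \<bar>p i\<bar>) * (\<Sum>i<2*n. \<bar>q i\<bar>)"
          using \<epsilon>M[of j] by blast
        also have "\<dots> \<le> D * (real (2 * n) * norm (l x)) * (real (2 * n) * norm (l y))"
        proof (intro mult_mono)
          show "M j \<le> D" by (rule D(2)[OF True])
          show "(\<Sum>i<2*n. \<bar>p i\<bar>) \<le> real (2 * n) * norm (l x)"
            using sum_bounded_above[of "{..<2*n}" "\<lambda>i. \<bar>p i\<bar>" "norm (l x)"] pq(1) by simp
          show "(\<Sum>i<2*n. \<bar>q i\<bar>) \<le> real (2 * n) * norm (l y)"
            using sum_bounded_above[of "{..<2*n}" "\<lambda>i. \<bar>q i\<bar>" "norm (l y)"] pq(2) by simp
        qed (use D in \<open>auto intro: sum_nonneg\<close>)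
        also have "\<dots> = C * norm (l x) * norm (l y)" by (simp add: C_def)
        finally show ?thesis unfolding eq FF by simp
      next
        case False
        then have "\<phi> (x \<otimes> y) j - \<phi> x j - \<phi> y j + c j = 0" using \<phi>0 xy x(1) y(1) c0 by simp
        then show ?thesis unfolding eq using C by simp
      qed
    qed
    with xy show ?thesis by blast
  qed
  have surj: "\<exists>x\<in>V. l x = u" if u: "u \<in> coord_space n" "norm u < R" for u
  proof -
    let ?w = "\<lambda>i. c i + apply_bcontfun u i"
    have "norm u < e0" using u(2) R(2) by linarith
    then have "?w \<in> coord_box n c e0"
      using norm_coord_space_less_iff[OF u(1) e0(1)] u(1) c0 by (auto simp: coord_box_def coord_space_def)
    then obtain x where x: "x \<in> V" "?w = \<phi> x" using invN1(2) by blast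
    have "l x = u"
    proof (rule bcontfun_eqI)
      fix i show "apply_bcontfun (l x) i = apply_bcontfun u i"
        using fun_cong[OF x(2), of i] by (simp add: l[OF x(1)])
    qed
    then show ?thesis using x(1) by blast
  qed
  have injl: "inj_on l V"
  proof (rule inj_onI)
    fix x y assume xy: "x \<in> V" "y \<in> V" "l x = l y"
    then have "(\<lambda>i. \<phi> x i - c i) = (\<lambda>i. \<phi> y i - c i)" using l by metis
    then have "\<phi> x = \<phi> y" by (simp add: fun_eq_iff)
    then show "x = y" using inj xy by (auto dest: inj_onD)
  qed
  have l1: "l \<one> = 0"
    by (rule bcontfun_eqI) (simp add: l[OF one_V] c_def)
  have "almost_additive_chart K T (coord_space n) V l R C"
    by unfold_locales
      (use subspace_coord_space R(1) C VK one_V l1 lW injl surj open_ball base mult coord_space_rounding in auto)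
  then show ?thesis by blast
qed

section \<open>Internal homomorphisms\<close>

context compact_topological_group begin

lemma openin_inv: "openin T N \<Longrightarrow> openin T {x \<in> carrier K. inv x \<in> N}"
  using openin_continuous_map_preimage[OF continuous_inv] by (simp add: topspace_eq)

lemma openin_left_translate:
  assumes "openin T N" "k \<in> carrier K"
  shows "openin T {x \<in> carrier K. k \<otimes> x \<in> N}"
proof -
  have "continuous_map T T (\<lambda>x. k \<otimes> x)"
    using assms(2) by (intro continuous_map_group_mult) (auto simp: topspace_eq)
  from openin_continuous_map_preimage[OF this assms(1)] show ?thesis by (simp add: topspace_eq)
qed

text \<open>Serves two substitutions: the plain word compares the final homomorphisms with the given
  map, and the word with a conjugated middle factor expresses the defect of an approximation through
  its errors at three points. There \<open>k\<close> ranges over all of \<open>K\<close>, hence the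
  use of equicontinuity.\<close>

lemma word_neighbourhood:
  assumes "openin T N" "\<one> \<in> N"
  obtains N' where "openin T N'" "\<one> \<in> N'" "N' \<subseteq> carrier K"
    "\<And>p q r. p \<in> N' \<Longrightarrow> q \<in> N' \<Longrightarrow> r \<in> N' \<Longrightarrow> inv p \<otimes> q \<otimes> inv r \<in> N"
    "\<And>k p q r. k \<in> carrier K \<Longrightarrow> p \<in> N' \<Longrightarrow> q \<in> N' \<Longrightarrow> r \<in> N' \<Longrightarrow>
       p \<otimes> (k \<otimes> inv q \<otimes> inv k) \<otimes> inv r \<in> N"
proof -
  obtain A where A: "openin T A" "\<one> \<in> A" "\<And>p q. p \<in> A \<Longrightarrow> q \<in> A \<Longrightarrow> p \<otimes> q \<in> N"
    using product_neighbourhood[OF assms] by blast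
  obtain B where B: "openin T B" "\<one> \<in> B" "\<And>p q. p \<in> B \<Longrightarrow> q \<in> B \<Longrightarrow> p \<otimes> q \<in> A"
    using product_neighbourhood[OF A(1,2)] by blast
  obtain Q where Q: "openin T Q" "\<one> \<in> Q"
    "\<And>k x. k \<in> carrier K \<Longrightarrow> x \<in> Q \<Longrightarrow> k \<otimes> x \<otimes> inv k \<in> B"
    using conjugation_equicontinuous[OF B(1,2)] by blast
  let ?N = "B \<inter> {x \<in> carrier K. inv x \<in> A \<inter> B \<inter> Q}"
  show ?thesis
  proof (rule that[of ?N])
    show "openin T ?N" using A(1) B(1) Q(1) by (intro openin_Int openin_inv)
    show "\<one> \<in> ?N" "?N \<subseteq> carrier K" using A(2) B(2) Q(2) by auto
    show "inv p \<otimes> q \<otimes> inv r \<in> N" if "p \<in> ?N" "q \<in> ?N" "r \<in> ?N" for p q r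
      using that by (intro A(3) B(3)) auto
    show "p \<otimes> (k \<otimes> inv q \<otimes> inv k) \<otimes> inv r \<in> N"
      if "k \<in> carrier K" "p \<in> ?N" "q \<in> ?N" "r \<in> ?N" for k p q r
      using that by (intro A(3) B(3) Q(3)) auto
  qed
qed

end

text \<open>The map \<open>t\<close> sends a choice of representatives \<open>a\<close> to \<open>\<tau>\<close> of its class; \<open>separation\<close> is all
  that is used of definability: the preimages of a closed set and of an open set containing it
  are separated by an internal set.\<close>

locale internal_homomorphism = almost_additive_chart K T W V l R C
  for K (structure) and T and W :: "'v::banach set" and V l R C +
  fixes \<U> :: "'i filter" and H :: "'i \<Rightarrow> ('h, 'm) monoid_scheme" and t :: "('i \<Rightarrow> 'h) \<Rightarrow> 'a"
  assumes ultra: "ultrafilter \<U>" and incomplete: "countably_incomplete \<U>"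
    and amenable: "amenable_group (H i)"
    and t_carrier: "(\<And>i. a i \<in> carrier (H i)) \<Longrightarrow> t a \<in> carrier K"
    and t_mult: "(\<And>i. a i \<in> carrier (H i)) \<Longrightarrow> (\<And>i. b i \<in> carrier (H i)) \<Longrightarrow>
        t (\<lambda>i. a i \<otimes>\<^bsub>H i\<^esub> b i) = t a \<otimes> t b"
    and separation: "closedin T D \<Longrightarrow> openin T O' \<Longrightarrow> D \<subseteq> O' \<Longrightarrow>
        \<exists>X. \<forall>a. (\<forall>i. a i \<in> carrier (H i)) \<longrightarrow>
          (t a \<in> D \<longrightarrow> (\<forall>\<^sub>F i in \<U>. a i \<in> X i)) \<and> ((\<forall>\<^sub>F i in \<U>. a i \<in> X i) \<longrightarrow> t a \<in> O')"
begin

lemma group_H: "group (H i)" using amenable by (simp add: amenable_group_def)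

text \<open>Cover \<open>K\<close> by finitely many open \<open>A k\<close>, each separated by an
  internal set \<open>X k\<close> from the complement of a small neighbourhood of \<open>k\<close>,
  and let \<open>f i x\<close> be some \<open>k\<close> with \<open>x\<close> in
  \<open>X k i\<close>. Along a section the chosen \<open>k\<close> is constant on a large set,
  there being finitely many, and then \<open>t a\<close> lies near that \<open>k\<close>.\<close>

lemma internal_approximation:
  assumes N: "openin T N" "\<one> \<in> N"
  obtains f where "\<And>i. f i \<in> carrier (H i) \<rightarrow> carrier K"
    "\<And>a. (\<And>i. a i \<in> carrier (H i)) \<Longrightarrow> \<forall>\<^sub>F i in \<U>. inv (f i (a i)) \<otimes> t a \<in> N"
proof -
  let ?O = "\<lambda>k. {x \<in> carrier K. inv k \<otimes> x \<in> N}"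
  let ?Sep = "\<lambda>k A X. openin T A \<and> k \<in> A \<and> (\<forall>a. (\<forall>i. a i \<in> carrier (H i)) \<longrightarrow>
      (t a \<in> A \<longrightarrow> (\<forall>\<^sub>F i in \<U>. a i \<in> X i)) \<and> ((\<forall>\<^sub>F i in \<U>. a i \<in> X i) \<longrightarrow> t a \<in> ?O k))"
  have ex: "\<exists>A X. ?Sep k A X" if k: "k \<in> carrier K" for k
  proof -
    have "openin T (?O k)" using N(1) k by (intro openin_left_translate) auto
    moreover have "k \<in> ?O k" using k N(2) by simp
    ultimately obtain A D where AD: "openin T A" "closedin T D" "k \<in> A" "A \<subseteq> D" "D \<subseteq> ?O k"
      by (rule closed_neighbourhood)
    from separation[OF AD(2) \<open>openin T (?O k)\<close> AD(5)] obtain X where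
      "\<forall>a. (\<forall>i. a i \<in> carrier (H i)) \<longrightarrow> (t a \<in> D \<longrightarrow> (\<forall>\<^sub>F i in \<U>. a i \<in> X i)) \<and>
         ((\<forall>\<^sub>F i in \<U>. a i \<in> X i) \<longrightarrow> t a \<in> ?O k)" by (rule exE)
    then show ?thesis using AD(1,3,4) by (intro exI[of _ A] exI[of _ X]) blast
  qed
  define A where "A k = (SOME A. \<exists>X. ?Sep k A X)" for k
  have ex': "\<exists>X. ?Sep k (A k) X" if "k \<in> carrier K" for k
    unfolding A_def by (rule someI_ex) (rule ex[OF that])
  define X where "X k = (SOME X. ?Sep k (A k) X)" for k
  have AX: "?Sep k (A k) (X k)" if "k \<in> carrier K" for k
    unfolding X_def by (rule someI_ex[OF ex'[OF that]])
  have "\<exists>\<F>. finite \<F> \<and> \<F> \<subseteq> A ` carrier K \<and> topspace T \<subseteq> \<Union>\<F>"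
    by (rule compact[unfolded compact_space_alt, rule_format]) (use AX topspace_eq in auto)
  then obtain P where P: "finite P" "P \<subseteq> carrier K" "carrier K \<subseteq> (\<Union>k\<in>P. A k)"
    using topspace_eq by (metis finite_subset_image)
  \<comment> \<open>The default value is harmless: a section meets some \<open>X k i\<close> on a
    large set.\<close>
  define f where "f i x = (if \<exists>k\<in>P. x \<in> X k i then SOME k. k \<in> P \<and> x \<in> X k i else \<one>)" for i x
  have f: "f i x \<in> P \<and> x \<in> X (f i x) i" if "k \<in> P" "x \<in> X k i" for i x k
    using someI[of "\<lambda>k. k \<in> P \<and> x \<in> X k i" k] that by (auto simp: f_def)
  show ?thesis
  proof (rule that[of f])
    fix i show "f i \<in> carrier (H i) \<rightarrow> carrier K"
    proof
      fix x show "f i x \<in> carrier K"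
      proof (cases "\<exists>k\<in>P. x \<in> X k i")
        case True then show ?thesis using f P(2) by blast
      qed (simp add: f_def)
    qed
  next
    fix a assume a: "\<And>i. a i \<in> carrier (H i)"
    obtain k where k: "k \<in> P" "t a \<in> A k" using P(3) t_carrier[OF a] by blast
    then have "\<forall>\<^sub>F i in \<U>. a i \<in> X k i" using AX[of k] P(2) a by blast
    then have "\<forall>\<^sub>F i in \<U>. \<exists>k\<in>P. f i (a i) = k \<and> a i \<in> X k i"
      by eventually_elim (use f k(1) in blast)
    from ultrafilter_eventually_bex_finite[OF ultra P(1) this] obtain k' where
      k': "k' \<in> P" "\<forall>\<^sub>F i in \<U>. f i (a i) = k' \<and> a i \<in> X k' i" by blast
    from k'(2) have "\<forall>\<^sub>F i in \<U>. a i \<in> X k' i" by eventually_elim simp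
    then have "t a \<in> ?O k'" using AX[of k'] k'(1) P(2) a by blast
    then have "inv k' \<otimes> t a \<in> N" by simp
    then show "\<forall>\<^sub>F i in \<U>. inv (f i (a i)) \<otimes> t a \<in> N"
      by (intro eventually_mono[OF k'(2)]) auto
  qed
qed

text \<open>Counterexamples on a large set of indices could be chosen factor by factor, giving two
  sections that violate the assumption. This turns statements about single sections into uniform
  ones on the factors.\<close>

lemma uniformly_eventually:
  assumes "\<And>a b. (\<And>i. a i \<in> carrier (H i)) \<Longrightarrow> (\<And>i. b i \<in> carrier (H i)) \<Longrightarrow>
      \<forall>\<^sub>F i in \<U>. Q i (a i) (b i)"
  shows "\<forall>\<^sub>F i in \<U>. \<forall>x\<in>carrier (H i). \<forall>z\<in>carrier (H i). Q i x z"
proof (rule ccontr)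
  assume "\<not> ?thesis"
  then have bad: "\<forall>\<^sub>F i in \<U>. \<exists>x\<in>carrier (H i). \<exists>z\<in>carrier (H i). \<not> Q i x z"
    by (simp add: ultrafilter_not_eventually[OF ultra])
  have ex: "\<exists>p. fst p \<in> carrier (H i) \<and> snd p \<in> carrier (H i) \<and>
      ((\<exists>x\<in>carrier (H i). \<exists>z\<in>carrier (H i). \<not> Q i x z) \<longrightarrow> \<not> Q i (fst p) (snd p))" for i
  proof (cases "\<exists>x\<in>carrier (H i). \<exists>z\<in>carrier (H i). \<not> Q i x z")
    case True
    then obtain x z where "x \<in> carrier (H i)" "z \<in> carrier (H i)" "\<not> Q i x z" by blast
    then show ?thesis by (intro exI[of _ "(x, z)"]) simp
  next
    case False
    then show ?thesis
      using monoid.one_closed[OF group.is_monoid[OF group_H]] by (intro exI[of _ "(\<one>\<^bsub>H i\<^esub>, \<one>\<^bsub>H i\<^esub>)"]) simp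
  qed
  define p where "p i = (SOME p. fst p \<in> carrier (H i) \<and> snd p \<in> carrier (H i) \<and>
      ((\<exists>x\<in>carrier (H i). \<exists>z\<in>carrier (H i). \<not> Q i x z) \<longrightarrow> \<not> Q i (fst p) (snd p)))" for i
  have p: "fst (p i) \<in> carrier (H i) \<and> snd (p i) \<in> carrier (H i) \<and>
      ((\<exists>x\<in>carrier (H i). \<exists>z\<in>carrier (H i). \<not> Q i x z) \<longrightarrow> \<not> Q i (fst (p i)) (snd (p i)))" for i
    unfolding p_def by (rule someI_ex) (rule ex)
  have "\<forall>\<^sub>F i in \<U>. Q i (fst (p i)) (snd (p i))" by (rule assms) (use p in auto)
  with bad have "eventually (\<lambda>_. False) \<U>" by eventually_elim (use p in blast)
  then show False using ultra by (simp add: ultrafilter_def trivial_limit_def)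
qed

lemma internal_hom_approximation:
  assumes N: "openin T N" "\<one> \<in> N"
  obtains h where "\<And>i. h i \<in> hom (H i) K"
    "\<And>a. (\<And>i. a i \<in> carrier (H i)) \<Longrightarrow> \<forall>\<^sub>F i in \<U>. inv (h i (a i)) \<otimes> t a \<in> N"
proof -
  obtain N2 where N2: "openin T N2" "\<one> \<in> N2" "\<And>p q. p \<in> N2 \<Longrightarrow> q \<in> N2 \<Longrightarrow> inv q \<otimes> p \<in> N"
    using quotient_neighbourhood[OF N] by blast
  obtain N3 where N3: "openin T N3" "\<one> \<in> N3"
    and stable: "\<And>(H :: ('h, 'm) monoid_scheme) f. amenable_group H \<Longrightarrow> f \<in> carrier H \<rightarrow> carrier K \<Longrightarrow>
       (\<And>x z. x \<in> carrier H \<Longrightarrow> z \<in> carrier H \<Longrightarrow> inv (f (x \<otimes>\<^bsub>H\<^esub> z)) \<otimes> f x \<otimes> f z \<in> N3) \<Longrightarrow>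
       \<exists>h\<in>hom H K. \<forall>x\<in>carrier H. inv (f x) \<otimes> h x \<in> N2"
    by (rule Ulam_stability[OF N2(1,2)]) blast
  obtain N4 where N4: "openin T N4" "\<one> \<in> N4" "N4 \<subseteq> carrier K"
    and word: "\<And>k p q r. k \<in> carrier K \<Longrightarrow> p \<in> N4 \<Longrightarrow> q \<in> N4 \<Longrightarrow> r \<in> N4 \<Longrightarrow>
       p \<otimes> (k \<otimes> inv q \<otimes> inv k) \<otimes> inv r \<in> N3"
    by (rule word_neighbourhood[OF N3]) blast
  have N24: "openin T (N2 \<inter> N4)" "\<one> \<in> N2 \<inter> N4" using N2 N4 by auto
  obtain f where f: "\<And>i. f i \<in> carrier (H i) \<rightarrow> carrier K"
    and ft: "\<And>a. (\<And>i. a i \<in> carrier (H i)) \<Longrightarrow> \<forall>\<^sub>F i in \<U>. inv (f i (a i)) \<otimes> t a \<in> N2 \<inter> N4"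
    by (rule internal_approximation[OF N24]) blast
  have fK: "f i x \<in> carrier K" if "x \<in> carrier (H i)" for i x using f that by auto
  have "\<forall>\<^sub>F i in \<U>. \<forall>x\<in>carrier (H i). \<forall>z\<in>carrier (H i). inv (f i (x \<otimes>\<^bsub>H i\<^esub> z)) \<otimes> f i x \<otimes> f i z \<in> N3"
  proof (rule uniformly_eventually)
    fix a b assume a: "\<And>i. a i \<in> carrier (H i)" and b: "\<And>i. b i \<in> carrier (H i)"
    have ab: "a i \<otimes>\<^bsub>H i\<^esub> b i \<in> carrier (H i)" for i
      using a b monoid.m_closed[OF group.is_monoid[OF group_H]] by blast
    show "\<forall>\<^sub>F i in \<U>. inv (f i (a i \<otimes>\<^bsub>H i\<^esub> b i)) \<otimes> f i (a i) \<otimes> f i (b i) \<in> N3"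
      using ft[OF a] ft[OF b] ft[of "\<lambda>i. a i \<otimes>\<^bsub>H i\<^esub> b i", OF ab]
    proof eventually_elim
      case (elim i)
      \<comment> \<open>With \<open>p\<close>, \<open>q\<close>, \<open>r\<close> the errors of
        \<open>f i\<close> at \<open>ab\<close>, \<open>a\<close> and \<open>b\<close>,
        multiplicativity of \<open>t\<close> writes the defect as
        \<open>p (t(b)^-1 q^-1 t(b)) r^-1\<close>, the second word of
        \<open>word_neighbourhood\<close> with \<open>k\<close> the inverse of
        \<open>t b\<close>.\<close>
      let ?p = "inv (f i (a i \<otimes>\<^bsub>H i\<^esub> b i)) \<otimes> t (\<lambda>i. a i \<otimes>\<^bsub>H i\<^esub> b i)"
      have "?p \<otimes> (inv (t b) \<otimes> inv (inv (f i (a i)) \<otimes> t a) \<otimes> inv (inv (t b))) \<otimes>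
          inv (inv (f i (b i)) \<otimes> t b) \<in> N3"
        using elim t_carrier[OF b] by (intro word) auto
      also have "?p \<otimes> (inv (t b) \<otimes> inv (inv (f i (a i)) \<otimes> t a) \<otimes> inv (inv (t b))) \<otimes>
          inv (inv (f i (b i)) \<otimes> t b) = inv (f i (a i \<otimes>\<^bsub>H i\<^esub> b i)) \<otimes> f i (a i) \<otimes> f i (b i)"
        using t_carrier[OF a] t_carrier[OF b] fK[OF a] fK[OF b] fK[OF ab]
        by (simp add: t_mult[OF a b] m_assoc inv_mult_group)
      finally show ?case .
    qed
  qed
  then have hom: "\<forall>\<^sub>F i in \<U>. \<exists>h\<in>hom (H i) K. \<forall>x\<in>carrier (H i). inv (f i x) \<otimes> h x \<in> N2"
    by eventually_elim (rule stable[OF amenable f], blast)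
  have triv: "(\<lambda>_. \<one>) \<in> hom (H i) K" for i by (auto simp: hom_def)
  \<comment> \<open>Where stability yields nothing, the trivial homomorphism is taken, since a
    homomorphism is demanded at every index.\<close>
  define h where "h i = (if \<exists>h\<in>hom (H i) K. \<forall>x\<in>carrier (H i). inv (f i x) \<otimes> h x \<in> N2
      then SOME h. h \<in> hom (H i) K \<and> (\<forall>x\<in>carrier (H i). inv (f i x) \<otimes> h x \<in> N2) else (\<lambda>_. \<one>))" for i
  have h: "h i \<in> hom (H i) K \<and> (\<forall>x\<in>carrier (H i). inv (f i x) \<otimes> h i x \<in> N2)"
    if "\<exists>h\<in>hom (H i) K. \<forall>x\<in>carrier (H i). inv (f i x) \<otimes> h x \<in> N2" for i
  proof -
    have eq: "h i = (SOME h. h \<in> hom (H i) K \<and> (\<forall>x\<in>carrier (H i). inv (f i x) \<otimes> h x \<in> N2))"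
      using that by (simp add: h_def)
    have "\<exists>h. h \<in> hom (H i) K \<and> (\<forall>x\<in>carrier (H i). inv (f i x) \<otimes> h x \<in> N2)" using that by blast
    then show ?thesis unfolding eq by (rule someI_ex)
  qed
  show ?thesis
  proof (rule that[of h])
    show hh: "h i \<in> hom (H i) K" for i
    proof (cases "\<exists>h\<in>hom (H i) K. \<forall>x\<in>carrier (H i). inv (f i x) \<otimes> h x \<in> N2")
      case True then show ?thesis using h by blast
    next
      case False
      then have "h i = (\<lambda>_. \<one>)" unfolding h_def by (rule if_not_P)
      then show ?thesis using triv by simp
    qed
    fix a assume a: "\<And>i. a i \<in> carrier (H i)"
    show "\<forall>\<^sub>F i in \<U>. inv (h i (a i)) \<otimes> t a \<in> N"
      using hom ft[OF a]
    proof eventually_elim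
      case (elim i)
      have hK: "h i (a i) \<in> carrier K" using hom_in_carrier[OF hh a] .
      have "inv (inv (f i (a i)) \<otimes> h i (a i)) \<otimes> (inv (f i (a i)) \<otimes> t a) \<in> N"
        using h[OF elim(1)] elim(2) a by (intro N2(3)) auto
      also have "inv (inv (f i (a i)) \<otimes> h i (a i)) \<otimes> (inv (f i (a i)) \<otimes> t a) = inv (h i (a i)) \<otimes> t a"
        using hK fK[OF a] t_carrier[OF a] by (simp add: m_assoc inv_mult_group)
      finally show ?case .
    qed
  qed
qed

text \<open>Diagonalisation. The accuracy \<open>B m\<close> of \<open>h m\<close> is attained along
  a section on a large set depending on that section. The comparison of \<open>h j i\<close> with
  \<open>h k i\<close> is uniform over the factor, however, so large sets \<open>S m\<close> can be
  fixed beforehand on which \<open>h m\<close> is close to all earlier \<open>h j\<close>. At the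
  index \<open>i\<close> the largest \<open>m\<close> with \<open>i\<close> in \<open>S m\<close> is
  used.\<close>

theorem internal_homomorphism_limit:
  obtains \<sigma> where "\<And>i. \<sigma> i \<in> hom (H i) K"
    "\<And>a. (\<And>i. a i \<in> carrier (H i)) \<Longrightarrow> limitin T (\<lambda>i. \<sigma> i (a i)) (t a) \<U>"
proof -
  define B where "B m = ballV (R / real (Suc m))" for m
  have B: "openin T (B m)" "\<one> \<in> B m" for m
  proof -
    have m: "0 < R / real (Suc m)" "R / real (Suc m) \<le> R" using R by (auto simp: field_simps)
    show "openin T (B m)" unfolding B_def ballV_def using m by (rule open_ball)
    show "\<one> \<in> B m" unfolding B_def using m(1) by (rule one_ballV)
  qed
  have Bmono: "B k \<subseteq> B j" if "j \<le> k" for j k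
    unfolding B_def by (rule ballV_mono) (use that R in \<open>auto intro!: divide_left_mono\<close>)
  have Bbase: "\<exists>j. B j \<subseteq> N" if N: "openin T N" "\<one> \<in> N" for N
  proof -
    obtain s where s: "0 < s" "ballV s \<subseteq> N" by (rule ballV_base[OF N R])
    obtain j where "R / s < real j" using reals_Archimedean2 by blast
    then have "R / real (Suc j) \<le> s" using s(1) by (simp add: field_simps)
    then have "B j \<subseteq> ballV s" unfolding B_def by (rule ballV_mono)
    then show ?thesis using s(2) by blast
  qed
  have "\<exists>h. (\<forall>i. h i \<in> hom (H i) K) \<and>
      (\<forall>a. (\<forall>i. a i \<in> carrier (H i)) \<longrightarrow> (\<forall>\<^sub>F i in \<U>. inv (h i (a i)) \<otimes> t a \<in> B m))" for m
    by (rule internal_hom_approximation[OF B[of m]]) blast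
  then obtain h where hom: "\<And>m i. h m i \<in> hom (H i) K"
    and ht: "\<And>m a. (\<And>i. a i \<in> carrier (H i)) \<Longrightarrow> \<forall>\<^sub>F i in \<U>. inv (h m i (a i)) \<otimes> t a \<in> B m"
    by metis
  have hK: "h m i x \<in> carrier K" if "x \<in> carrier (H i)" for m i x using hom_in_carrier[OF hom that] .
  define Q where "Q j = {p \<otimes> inv q | p q. p \<in> B j \<and> q \<in> B j}" for j
  have close: "\<forall>\<^sub>F i in \<U>. \<forall>x\<in>carrier (H i). \<forall>z\<in>carrier (H i). inv (h j i x) \<otimes> h k i x \<in> Q j"
    if jk: "j \<le> k" for j k
  proof (rule uniformly_eventually)
    fix a :: "'i \<Rightarrow> 'h" assume a: "\<And>i. a i \<in> carrier (H i)"
    show "\<forall>\<^sub>F i in \<U>. inv (h j i (a i)) \<otimes> h k i (a i) \<in> Q j"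
      using ht[OF a, of j] ht[OF a, of k]
    proof eventually_elim
      case (elim i)
      have "inv (h j i (a i)) \<otimes> h k i (a i)
          = (inv (h j i (a i)) \<otimes> t a) \<otimes> inv (inv (h k i (a i)) \<otimes> t a)"
        using hK[OF a] t_carrier[OF a] by (simp add: m_assoc inv_mult_group)
      then show ?case using elim Bmono[OF jk] unfolding Q_def by blast
    qed
  qed
  obtain \<F> where F: "countable \<F>" "\<And>S. S \<in> \<F> \<Longrightarrow> \<forall>\<^sub>F i in \<U>. i \<in> S" "\<Inter>\<F> = {}"
    using incomplete unfolding countably_incomplete_def by blast
  then have "\<F> \<noteq> {}" by auto
  define Y where "Y = from_nat_into \<F>"
  have Y: "\<forall>\<^sub>F i in \<U>. i \<in> Y m" "(\<Inter>m. Y m) = {}" for m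
    using F(2) from_nat_into[OF \<open>\<F> \<noteq> {}\<close>] range_from_nat_into[OF \<open>\<F> \<noteq> {}\<close> F(1)] F(3)
    by (auto simp: Y_def)
  \<comment> \<open>Since the sets \<open>Y j\<close> have empty intersection, each \<open>i\<close>
    lies in only finitely many \<open>S m\<close>.\<close>
  define S where "S m = {i. (\<forall>j\<le>m. i \<in> Y j) \<and>
      (\<forall>j\<le>m. \<forall>x\<in>carrier (H i). \<forall>z\<in>carrier (H i). inv (h j i x) \<otimes> h m i x \<in> Q j)}" for m
  have S: "\<forall>\<^sub>F i in \<U>. i \<in> S m" for m
  proof -
    have "\<forall>\<^sub>F i in \<U>. \<forall>j\<in>{..m}. i \<in> Y j" by (intro eventually_ball_finite ballI Y) simp
    moreover have "\<forall>\<^sub>F i in \<U>. \<forall>j\<in>{..m}. \<forall>x\<in>carrier (H i). \<forall>z\<in>carrier (H i). inv (h j i x) \<otimes> h m i x \<in> Q j"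
      by (intro eventually_ball_finite ballI close) auto
    ultimately show ?thesis by eventually_elim (auto simp: S_def)
  qed
  have Sfin: "finite {m. i \<in> S m}" for i
  proof -
    obtain j where "i \<notin> Y j" using Y(2) by blast
    then have "{m. i \<in> S m} \<subseteq> {..<j}" by (auto simp: S_def not_le[symmetric])
    then show ?thesis by (rule finite_subset) simp
  qed
  \<comment> \<open>If \<open>i\<close> lies in no \<open>S m\<close>, the maximum is an unspecified
    number, but \<open>h\<close> at that number is still a homomorphism, and convergence is only
    tested on the sets \<open>S j\<close>.\<close>
  define \<sigma> where "\<sigma> i = h (Max {m. i \<in> S m}) i" for i
  have \<sigma>: "inv (h j i x) \<otimes> \<sigma> i x \<in> Q j" if "i \<in> S j" "x \<in> carrier (H i)" for i j x
  proof -
    define m where "m = Max {m. i \<in> S m}"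
    have "j \<le> m" unfolding m_def using that(1) Sfin by (intro Max_ge) auto
    moreover have "i \<in> S m" unfolding m_def using Max_in[OF Sfin, of i] that(1) by blast
    ultimately have "inv (h j i x) \<otimes> h m i x \<in> Q j" using that(2) unfolding S_def by blast
    then show ?thesis by (simp add: \<sigma>_def m_def)
  qed
  show ?thesis
  proof (rule that[of \<sigma>])
    show \<sigma>hom: "\<sigma> i \<in> hom (H i) K" for i using hom by (simp add: \<sigma>_def)
    fix a assume a: "\<And>i. a i \<in> carrier (H i)"
    note ta = t_carrier[OF a]
    show "limitin T (\<lambda>i. \<sigma> i (a i)) (t a) \<U>"
      unfolding limitin_def
    proof (intro conjI allI impI)
      show "t a \<in> topspace T" using ta by (simp add: topspace_eq)
      fix O' assume O': "openin T O' \<and> t a \<in> O'"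
      let ?N = "{x \<in> carrier K. t a \<otimes> x \<in> O'}"
      have N: "openin T ?N" "\<one> \<in> ?N" using openin_left_translate O' ta by auto
      obtain N' where N': "openin T N'" "\<one> \<in> N'"
        "\<And>p q r. p \<in> N' \<Longrightarrow> q \<in> N' \<Longrightarrow> r \<in> N' \<Longrightarrow> inv p \<otimes> q \<otimes> inv r \<in> ?N"
        by (rule word_neighbourhood[OF N]) blast
      obtain j where j: "B j \<subseteq> N'" using Bbase[OF N'(1,2)] by blast
      show "\<forall>\<^sub>F i in \<U>. \<sigma> i (a i) \<in> O'"
        using S[of j] ht[OF a, of j]
      proof eventually_elim
        case (elim i)
        let ?g = "h j i (a i)" and ?s = "\<sigma> i (a i)"
        have K: "?g \<in> carrier K" "?s \<in> carrier K" using hK[OF a] hom_in_carrier[OF \<sigma>hom a] by auto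
        \<comment> \<open>The intermediate value of \<open>h j\<close> cancels: the quotient of
          \<sigma> by \<open>t a\<close> is the inverse of the error of \<open>h j\<close> times
          \<open>p q^-1\<close>, the first word of \<open>word_neighbourhood\<close>.\<close>
        obtain p q where pq: "inv ?g \<otimes> ?s = p \<otimes> inv q" "p \<in> B j" "q \<in> B j"
          using \<sigma>[OF elim(1) a] unfolding Q_def by blast
        have pqK: "p \<in> carrier K" "q \<in> carrier K" using pq openin_subset[OF B(1)] topspace_eq by auto
        have "inv (inv ?g \<otimes> t a) \<otimes> p \<otimes> inv q \<in> ?N" using elim(2) pq j by (intro N'(3)) auto
        also have "inv (inv ?g \<otimes> t a) \<otimes> p \<otimes> inv q = inv (t a) \<otimes> ?s"
        proof -
          have "inv (inv ?g \<otimes> t a) \<otimes> p \<otimes> inv q = inv (inv ?g \<otimes> t a) \<otimes> (inv ?g \<otimes> ?s)"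
            using K ta pqK by (simp add: m_assoc pq(1))
          then show ?thesis using K ta by (simp add: m_assoc inv_mult_group)
        qed
        finally show ?case using K ta by simp
      qed
    qed
  qed
qed

end

section \<open>Ultraproducts\<close>

text \<open>The part of the ultraproduct construction common to both logics; \<open>\<sim>\<close> identifies the
  sections that represent the same element.\<close>

locale structure_ultraproduct =
  fixes L :: "('f, 'r, 'x) lang_scheme" and G :: "'i \<Rightarrow> ('a, 'f, 'y) fun_structure_scheme"
    and M :: "(('i \<Rightarrow> 'a) set, 'f, 'w) fun_structure_scheme"
    and sim :: "('i \<Rightarrow> 'a) \<Rightarrow> ('i \<Rightarrow> 'a) \<Rightarrow> bool" (infix \<open>\<sim>\<close> 50)
  assumes refl: "(\<And>i. a i \<in> univ (G i)) \<Longrightarrow> a \<sim> a" and sim_sym: "a \<sim> b \<Longrightarrow> b \<sim> a"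
    and trans: "a \<sim> b \<Longrightarrow> b \<sim> c \<Longrightarrow> (\<And>i. a i \<in> univ (G i)) \<Longrightarrow> (\<And>i. b i \<in> univ (G i)) \<Longrightarrow>
      (\<And>i. c i \<in> univ (G i)) \<Longrightarrow> a \<sim> c"
    and univ: "univ M = (\<lambda>a. {b. (\<forall>i. b i \<in> univ (G i)) \<and> a \<sim> b}) ` {a. \<forall>i. a i \<in> univ (G i)}"
    and fn: "fn M f As = {b. (\<forall>i. b i \<in> univ (G i)) \<and>
      (\<lambda>i. fn (G i) f (map (\<lambda>A. (SOME a. a \<in> A) i) As)) \<sim> b}"
    and fn_closed: "f \<in> fun_syms L \<Longrightarrow> xs \<in> tuples (univ (G i)) (fun_arity L f) \<Longrightarrow>
      fn (G i) f xs \<in> univ (G i)"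
    and fn_sim: "f \<in> fun_syms L \<Longrightarrow> (\<And>i. map (\<lambda>a. a i) as \<in> tuples (univ (G i)) (fun_arity L f)) \<Longrightarrow>
      (\<And>i. map (\<lambda>a. a i) bs \<in> tuples (univ (G i)) (fun_arity L f)) \<Longrightarrow> list_all2 (\<sim>) as bs \<Longrightarrow>
      (\<lambda>i. fn (G i) f (map (\<lambda>a. a i) as)) \<sim> (\<lambda>i. fn (G i) f (map (\<lambda>a. a i) bs))"
begin

definition sections :: "('i \<Rightarrow> 'a) set" where "sections = {a. \<forall>i. a i \<in> univ (G i)}"

definition cls :: "('i \<Rightarrow> 'a) \<Rightarrow> ('i \<Rightarrow> 'a) set" where "cls a = {b \<in> sections. a \<sim> b}"

definition rep :: "('i \<Rightarrow> 'a) set \<Rightarrow> 'i \<Rightarrow> 'a" where "rep A = (SOME a. a \<in> A)"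

lemma univ_M: "univ M = cls ` sections"
  by (simp add: univ cls_def sections_def)

lemma fn_M: "fn M f As = cls (\<lambda>i. fn (G i) f (map (\<lambda>A. rep A i) As))"
  by (simp add: fn cls_def sections_def rep_def)

lemma sections_D: "a \<in> sections \<Longrightarrow> a i \<in> univ (G i)" by (simp add: sections_def)

lemma cls_eq_iff:
  assumes "a \<in> sections" "b \<in> sections"
  shows "cls a = cls b \<longleftrightarrow> a \<sim> b"
  using assms refl sim_sym trans unfolding cls_def sections_def by blast

lemma in_univ_M:
  assumes "A \<in> univ M" "a \<in> A"
  shows "a \<in> sections" "cls a = A"
proof -
  obtain b where b: "b \<in> sections" "A = cls b" using assms(1) univ_M by auto
  then show a: "a \<in> sections" using assms(2) by (simp add: cls_def)
  have "b \<sim> a" using assms(2) b by (simp add: cls_def)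
  then show "cls a = A" using b(2) cls_eq_iff[OF b(1) a] by simp
qed

lemma rep:
  assumes "A \<in> univ M"
  shows "rep A \<in> sections" "cls (rep A) = A"
proof -
  obtain b where b: "b \<in> sections" "A = cls b" using assms univ_M by auto
  then have "b \<in> A" using refl by (simp add: cls_def sections_def)
  then have "rep A \<in> A" unfolding rep_def by (rule someI[of "\<lambda>a. a \<in> A"])
  with in_univ_M[OF assms] show "rep A \<in> sections" "cls (rep A) = A" by auto
qed

lemma rep_cls:
  assumes "a \<in> sections"
  shows "rep (cls a) \<in> sections" "rep (cls a) \<sim> a"
proof -
  have "cls a \<in> univ M" using assms univ_M by blast
  then show "rep (cls a) \<in> sections" "rep (cls a) \<sim> a"
    using rep[of "cls a"] cls_eq_iff[OF _ assms] by auto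
qed

lemma reps_sections: "set as \<subseteq> sections \<Longrightarrow> set (map (\<lambda>a. rep (cls a)) as) \<subseteq> sections"
  using rep_cls(1) by auto

lemma reps_sim: "set as \<subseteq> sections \<Longrightarrow> list_all2 (\<sim>) (map (\<lambda>a. rep (cls a)) as) as"
  using rep_cls(2) by (auto simp: list_all2_map1 list_all2_same)

lemma section_tuple: "set as \<subseteq> sections \<Longrightarrow> map (\<lambda>a. a i) as \<in> tuples (univ (G i)) (length as)"
  by (auto simp: tuples_def sections_D)

lemma fn_section:
  "f \<in> fun_syms L \<Longrightarrow> length as = fun_arity L f \<Longrightarrow> set as \<subseteq> sections \<Longrightarrow>
   (\<lambda>i. fn (G i) f (map (\<lambda>a. a i) as)) \<in> sections"
  using fn_closed[of f] section_tuple[of as] unfolding sections_def by simp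

text \<open>The symbols of \<open>M\<close> act on chosen representatives; \<open>fn_sim\<close>
  makes the class of the result independent of the choice.\<close>

lemma fn_M_cls:
  assumes f: "f \<in> fun_syms L" "length as = fun_arity L f" and as: "set as \<subseteq> sections"
  shows "fn M f (map cls as) = cls (\<lambda>i. fn (G i) f (map (\<lambda>a. a i) as))"
proof -
  let ?rs = "map (\<lambda>a. rep (cls a)) as"
  have "fn M f (map cls as) = cls (\<lambda>i. fn (G i) f (map (\<lambda>a. a i) ?rs))"
    by (simp add: fn_M o_def)
  also have "\<dots> = cls (\<lambda>i. fn (G i) f (map (\<lambda>a. a i) as))"
    using fn_section[OF f(1), of ?rs] fn_section[OF f as] reps_sections[OF as] f(2)
      fn_sim[OF f(1) _ _ reps_sim[OF as]] section_tuple[OF as] section_tuple[OF reps_sections[OF as]]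
    by (subst cls_eq_iff) auto
  finally show ?thesis .
qed

text \<open>A parameter is a class; the coordinate at \<open>i\<close> of its chosen representative
  stands in for it in the factor at \<open>i\<close>.\<close>

definition trm_at :: "'i \<Rightarrow> (('i \<Rightarrow> 'a) set, 'f) trm \<Rightarrow> ('a, 'f) trm" where
  "trm_at i = map_trm (\<lambda>A. rep A i) (\<lambda>f. f)"

lemma trm_val_at_closed:
  assumes "\<And>n. w n \<in> univ (G i)" "wf_trm L (univ M) s"
  shows "trm_val (G i) w (trm_at i s) \<in> univ (G i)"
  using assms(2)
proof (induction s)
  case (Param A)
  then show ?case using rep(1)[of A] by (simp add: trm_at_def sections_D)
next
  case (App f ts)
  have "map (trm_val (G i) w) (map (trm_at i) ts) \<in> tuples (univ (G i)) (fun_arity L f)"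
    using App by (auto simp: tuples_def)
  then show ?case using fn_closed[of f _ i] App.prems by (simp add: trm_at_def)
qed (simp add: trm_at_def assms(1))

lemma trm_val_at_section:
  assumes "\<And>n. v n \<in> sections" "wf_trm L (univ M) s"
  shows "(\<lambda>i. trm_val (G i) (\<lambda>n. v n i) (trm_at i s)) \<in> sections"
  using trm_val_at_closed[OF sections_D assms(2)] assms(1) by (auto simp: sections_def)

lemma trm_val_M:
  assumes v: "\<And>n. v n \<in> sections" and "wf_trm L (univ M) s"
  shows "trm_val M (\<lambda>n. cls (v n)) s = cls (\<lambda>i. trm_val (G i) (\<lambda>n. v n i) (trm_at i s))"
  using assms(2)
proof (induction s)
  case (Var x)
  then show ?case by (simp add: trm_at_def)
next
  case (Param A)
  then show ?case using rep(2)[of A] by (simp add: trm_at_def)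
next
  case (App f ts)
  define as where "as = map (\<lambda>s i. trm_val (G i) (\<lambda>n. v n i) (trm_at i s)) ts"
  have wf: "f \<in> fun_syms L" "length as = fun_arity L f" using App.prems by (auto simp: as_def)
  have as: "set as \<subseteq> sections" using App.prems trm_val_at_section[OF v] by (auto simp: as_def)
  have eq: "map (trm_val M (\<lambda>n. cls (v n))) ts = map cls as" using App by (auto simp: as_def)
  have at: "(\<lambda>i. trm_val (G i) (\<lambda>n. v n i) (trm_at i (App f ts))) = (\<lambda>i. fn (G i) f (map (\<lambda>a. a i) as))"
    by (simp add: trm_at_def as_def o_def)
  show ?case unfolding trm_val.simps(3)[of M] eq at by (rule fn_M_cls[OF wf as])
qed

lemma trm_vals_M:
  assumes v: "\<And>n. v n \<in> sections" and ts: "\<forall>s\<in>set ts. wf_trm L (univ M) s"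
  obtains as where "set as \<subseteq> sections" "length as = length ts"
    "map (trm_val M (\<lambda>n. cls (v n))) ts = map cls as"
    "\<And>i. map (trm_val (G i) (\<lambda>n. v n i)) (map (trm_at i) ts) = map (\<lambda>a. a i) as"
  by (rule that[of "map (\<lambda>s i. trm_val (G i) (\<lambda>n. v n i) (trm_at i s)) ts"])
    (use trm_val_at_section[OF v] trm_val_M[OF v] ts in auto)

text \<open>The passage from the ultraproduct to sections, for both logics at once: what depends on
  the logic is condensed in the hypothesis \<open>sep\<close>, and by \<open>fn_M_cls\<close> the
  product of classes is computed factor by factor.\<close>

lemma homomorphism_limit:
  fixes K :: "('k, 'z) monoid_scheme" (structure)
  assumes chart: "almost_additive_chart K T W V l R C"
    and ultra: "ultrafilter \<U>" and inc: "countably_incomplete \<U>"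
    and grp: "extends_group_language L" and amen: "\<And>i. expands_amenable_group L (G i)"
    and hom: "\<tau> \<in> hom (group_reduct L M) K"
    and sep: "\<And>D O'. closedin T D \<Longrightarrow> openin T O' \<Longrightarrow> D \<subseteq> O' \<Longrightarrow> \<exists>X. \<forall>a\<in>sections.
      (\<tau> (cls a) \<in> D \<longrightarrow> (\<forall>\<^sub>F i in \<U>. a i \<in> X i)) \<and> ((\<forall>\<^sub>F i in \<U>. a i \<in> X i) \<longrightarrow> \<tau> (cls a) \<in> O')"
  shows "\<exists>\<sigma> :: 'i \<Rightarrow> 'a \<Rightarrow> 'k. (\<forall>i. \<sigma> i \<in> hom (group_reduct L (G i)) K) \<and>
    (\<forall>A \<in> univ M. \<forall>a \<in> A. limitin T (\<lambda>i. \<sigma> i (a i)) (\<tau> A) \<U>)"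
proof -
  let ?H = "\<lambda>i. group_reduct L (G i)" and ?t = "\<lambda>a. \<tau> (cls a)"
  have sec: "(\<forall>i. a i \<in> carrier (?H i)) \<longleftrightarrow> a \<in> sections" for a
    by (simp add: group_reduct_def sections_def)
  have cls_carrier: "cls a \<in> carrier (group_reduct L M)" if "a \<in> sections" for a
    using that univ_M by (auto simp: group_reduct_def)
  have mult: "mult_sym L \<in> fun_syms L" "fun_arity L (mult_sym L) = 2"
    using grp by (auto simp: extends_group_language_def)
  interpret internal_homomorphism K T W V l R C \<U> ?H ?t
  proof (intro internal_homomorphism.intro chart internal_homomorphism_axioms.intro ultra inc)
    show "amenable_group (?H i)" for i using amen by (simp add: expands_amenable_group_def)
    show "?t a \<in> carrier K" if "\<And>i. a i \<in> carrier (?H i)" for a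
      using hom_in_carrier[OF hom cls_carrier] that sec by blast
    show "?t (\<lambda>i. a i \<otimes>\<^bsub>?H i\<^esub> b i) = ?t a \<otimes> ?t b"
      if "\<And>i. a i \<in> carrier (?H i)" "\<And>i. b i \<in> carrier (?H i)" for a b
    proof -
      have ab: "a \<in> sections" "b \<in> sections" using that sec by blast+
      then have "\<tau> (fn M (mult_sym L) [cls a, cls b]) = ?t a \<otimes> ?t b"
        using hom_mult[OF hom cls_carrier cls_carrier, of a b] by (simp add: group_reduct_def)
      moreover have "fn M (mult_sym L) [cls a, cls b] = cls (\<lambda>i. fn (G i) (mult_sym L) [a i, b i])"
        using fn_M_cls[of "mult_sym L" "[a, b]"] mult ab by auto
      ultimately show ?thesis by (simp add: group_reduct_def)
    qed
    fix D O' assume "closedin T D" "openin T O'" "D \<subseteq> O'"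
    from sep[OF this]
    show "\<exists>X. \<forall>a. (\<forall>i. a i \<in> carrier (?H i)) \<longrightarrow> (?t a \<in> D \<longrightarrow> (\<forall>\<^sub>F i in \<U>. a i \<in> X i)) \<and>
        ((\<forall>\<^sub>F i in \<U>. a i \<in> X i) \<longrightarrow> ?t a \<in> O')"
      unfolding sec Ball_def .
  qed
  obtain \<sigma> where \<sigma>: "\<And>i. \<sigma> i \<in> hom (?H i) K"
    "\<And>a. (\<And>i. a i \<in> carrier (?H i)) \<Longrightarrow> limitin T (\<lambda>i. \<sigma> i (a i)) (?t a) \<U>"
    by (rule internal_homomorphism_limit) blast
  have "limitin T (\<lambda>i. \<sigma> i (a i)) (\<tau> A) \<U>" if "A \<in> univ M" "a \<in> A" for A a
  proof -
    have "\<And>i. a i \<in> carrier (?H i)" using in_univ_M(1)[OF that] sec by blast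
    from \<sigma>(2)[OF this] show ?thesis by (simp add: in_univ_M(2)[OF that])
  qed
  with \<sigma>(1) show ?thesis by blast
qed

end

text \<open>If no finite subfamily covers \<open>D\<close>, the complements in \<open>D\<close>
  generate a proper filter, and an ultrafilter below it contradicts the hypothesis. This stands in
  for compactness of the type spaces, as an ultrafilter on the elements of \<open>M\<close> has a
  limit type.\<close>

lemma ultrafilter_cover:
  assumes "\<And>F. ultrafilter F \<Longrightarrow> \<forall>\<^sub>F x in F. x \<in> D \<Longrightarrow> \<exists>P\<in>\<I>. \<forall>\<^sub>F x in F. x \<in> P"
  obtains \<P> where "finite \<P>" "\<P> \<subseteq> \<I>" "D \<subseteq> \<Union>\<P>"
proof -
  have "\<exists>\<P>. finite \<P> \<and> \<P> \<subseteq> \<I> \<and> D \<subseteq> \<Union>\<P>"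
  proof (rule ccontr)
    assume no: "\<not> ?thesis"
    \<comment> \<open>The added empty set contributes \<open>D\<close> itself, so the filter lives
      on \<open>D\<close> even when \<I> is empty.\<close>
    define F0 where "F0 = (INF P\<in>insert {} \<I>. principal (D - P))"
    have "F0 \<noteq> bot"
      unfolding F0_def
    proof (rule INF_filter_not_bot)
      fix \<P> assume P: "\<P> \<subseteq> insert {} \<I>" "finite \<P>"
      have "\<not> D \<subseteq> \<Union>(\<P> - {{}})" using no P by blast
      then have "(\<Inter>P\<in>\<P>. D - P) \<noteq> {}" by blast
      then show "(INF P\<in>\<P>. principal (D - P)) \<noteq> bot"
        by (simp add: INF_principal_finite[OF P(2)] principal_eq_bot_iff)
    qed
    then obtain F where F: "F \<le> F0" "ultrafilter F" by (rule ultrafilter_below)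
    have ev: "\<forall>\<^sub>F x in F. x \<in> D - P" if "P \<in> insert {} \<I>" for P
    proof -
      have "F \<le> principal (D - P)" using F(1) that unfolding F0_def by (meson INF_lower order_trans)
      then show ?thesis by (simp add: le_principal)
    qed
    have "\<forall>\<^sub>F x in F. x \<in> D" using ev[of "{}"] by simp
    from assms[OF F(2) this] obtain P where P: "P \<in> \<I>" "\<forall>\<^sub>F x in F. x \<in> P" by blast
    from P(2) ev[of P] P(1) have "eventually (\<lambda>_. False) F"
      by (auto elim: eventually_elim2)
    then show False using F(2) by (simp add: ultrafilter_def trivial_limit_def)
  qed
  then show ?thesis using that by blast
qed

section \<open>Classical logic\<close>

locale fo_structure_family =
  fixes \<U> :: "'i filter" and L :: "('f, 'r) lang" and G :: "'i \<Rightarrow> ('a, 'f, 'r) fo_structure"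
  assumes ultra: "ultrafilter \<U>" and struct: "is_fo_structure L (G i)"
begin

abbreviation "M \<equiv> fo_ultraproduct \<U> G"

lemma eventually_map_eq:
  fixes as bs :: "('i \<Rightarrow> 'a) list"
  assumes "list_all2 (\<lambda>a b. \<forall>\<^sub>F i in \<U>. a i = b i) as bs"
  shows "\<forall>\<^sub>F i in \<U>. map (\<lambda>a. a i) as = map (\<lambda>a. a i) bs"
  using assms
proof (induction rule: list_all2_induct)
  case (Cons a as b bs)
  then show ?case by (auto elim: eventually_elim2)
qed simp

sublocale structure_ultraproduct L G M "\<lambda>a b. \<forall>\<^sub>F i in \<U>. a i = b i"
proof
  show "\<forall>\<^sub>F i in \<U>. a i = c i" if "\<forall>\<^sub>F i in \<U>. a i = b i" "\<forall>\<^sub>F i in \<U>. b i = c i" for a b c :: "'i \<Rightarrow> 'a"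
    using that by eventually_elim simp
  show "fn (G i) f xs \<in> univ (G i)"
    if "f \<in> fun_syms L" "xs \<in> tuples (univ (G i)) (fun_arity L f)" for f xs i
    using struct[of i] that by (auto simp: is_fo_structure_def)
  show "\<forall>\<^sub>F i in \<U>. fn (G i) f (map (\<lambda>a. a i) as) = fn (G i) f (map (\<lambda>a. a i) bs)"
    if "list_all2 (\<lambda>a b. \<forall>\<^sub>F i in \<U>. a i = b i) as bs" for f as bs
    by (rule eventually_mono[OF eventually_map_eq[OF that]]) simp
qed (auto simp: fo_ultraproduct_def fo_class_def elim: eventually_mono)

lemma rel_M_cls:
  assumes as: "set as \<subseteq> sections"
  shows "rel M r (map cls as) \<longleftrightarrow> (\<forall>\<^sub>F i in \<U>. rel (G i) r (map (\<lambda>a. a i) as))"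
proof -
  have "rel M r (map cls as) \<longleftrightarrow> (\<forall>\<^sub>F i in \<U>. rel (G i) r (map (\<lambda>a. a i) (map (\<lambda>a. rep (cls a)) as)))"
    by (simp add: fo_ultraproduct_def rep_def o_def)
  also have "\<dots> \<longleftrightarrow> (\<forall>\<^sub>F i in \<U>. rel (G i) r (map (\<lambda>a. a i) as))"
    by (rule eventually_cong[OF eventually_map_eq[OF reps_sim[OF as]]]) (simp only:)
  finally show ?thesis .
qed

definition fm_at :: "'i \<Rightarrow> (('i \<Rightarrow> 'a) set, 'f, 'r) fo_fm \<Rightarrow> ('a, 'f, 'r) fo_fm" where
  "fm_at i = map_fo_fm (\<lambda>A. rep A i) (\<lambda>f. f) (\<lambda>r. r)"

theorem Los:
  assumes "\<And>n. v n \<in> sections" "wf_fo L (univ M) \<phi>"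
  shows "fo_sat M (\<lambda>n. cls (v n)) \<phi> \<longleftrightarrow> (\<forall>\<^sub>F i in \<U>. fo_sat (G i) (\<lambda>n. v n i) (fm_at i \<phi>))"
  using assms
proof (induction \<phi> arbitrary: v)
  case (Equal s t)
  then show ?case
    using trm_val_M[of v] trm_val_at_section[of v] cls_eq_iff by (simp add: fm_at_def trm_at_def)
next
  case (Rel r ts)
  then have wf: "\<forall>s\<in>set ts. wf_trm L (univ M) s" by simp
  obtain as where as: "set as \<subseteq> sections" "map (trm_val M (\<lambda>n. cls (v n))) ts = map cls as"
    "\<And>i. map (trm_val (G i) (\<lambda>n. v n i)) (map (trm_at i) ts) = map (\<lambda>a. a i) as"
    by (rule trm_vals_M[of v ts, OF Rel.prems(1) wf]) (rule that)
  have "fm_at i (Rel r ts) = Rel r (map (trm_at i) ts)" for i by (simp add: fm_at_def trm_at_def)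
  then show ?case by (simp only: fo_sat.simps as rel_M_cls[OF as(1)])
next
  case (Neg \<phi>)
  then show ?case using ultrafilter_not_eventually[OF ultra] by (simp add: fm_at_def)
next
  case (Conj \<phi> \<psi>)
  then show ?case by (simp add: fm_at_def eventually_conj_iff)
next
  case (Exists x \<phi>)
  have IH: "fo_sat M ((\<lambda>n. cls (v n))(x := cls b)) \<phi> \<longleftrightarrow>
      (\<forall>\<^sub>F i in \<U>. fo_sat (G i) ((\<lambda>n. v n i)(x := b i)) (fm_at i \<phi>))" if "b \<in> sections" for b
  proof -
    have "(\<lambda>n. cls ((v(x := b)) n)) = (\<lambda>n. cls (v n))(x := cls b)"
      "\<And>i. (\<lambda>n. (v(x := b)) n i) = (\<lambda>n. v n i)(x := b i)" by (auto simp: fun_eq_iff)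
    moreover have "fo_sat M (\<lambda>n. cls ((v(x := b)) n)) \<phi> \<longleftrightarrow>
        (\<forall>\<^sub>F i in \<U>. fo_sat (G i) (\<lambda>n. (v(x := b)) n i) (fm_at i \<phi>))"
      using Exists.prems that by (intro Exists.IH) auto
    ultimately show ?thesis by simp
  qed
  have fm: "fm_at i (Exists x \<phi>) = Exists x (fm_at i \<phi>)" for i by (simp add: fm_at_def)
  show ?case
  proof
    assume "fo_sat M (\<lambda>n. cls (v n)) (Exists x \<phi>)"
    then obtain b where b: "b \<in> sections" "fo_sat M ((\<lambda>n. cls (v n))(x := cls b)) \<phi>"
      using univ_M by auto
    then have "\<forall>\<^sub>F i in \<U>. fo_sat (G i) ((\<lambda>n. v n i)(x := b i)) (fm_at i \<phi>)" using IH by simp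
    then show "\<forall>\<^sub>F i in \<U>. fo_sat (G i) (\<lambda>n. v n i) (fm_at i (Exists x \<phi>))"
      by eventually_elim (use b(1) in \<open>auto simp: fm sections_def\<close>)
  next
    assume ev: "\<forall>\<^sub>F i in \<U>. fo_sat (G i) (\<lambda>n. v n i) (fm_at i (Exists x \<phi>))"
    \<comment> \<open>Witnesses are chosen factor by factor; where there is none,
      \<open>v 0 i\<close> keeps \<open>b\<close> a section.\<close>
    define b where "b i = (if \<exists>a\<in>univ (G i). fo_sat (G i) ((\<lambda>n. v n i)(x := a)) (fm_at i \<phi>)
      then SOME a. a \<in> univ (G i) \<and> fo_sat (G i) ((\<lambda>n. v n i)(x := a)) (fm_at i \<phi>) else v 0 i)" for i
    have b1: "b i \<in> univ (G i) \<and> fo_sat (G i) ((\<lambda>n. v n i)(x := b i)) (fm_at i \<phi>)"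
      if ex: "\<exists>a\<in>univ (G i). fo_sat (G i) ((\<lambda>n. v n i)(x := a)) (fm_at i \<phi>)" for i
    proof -
      have eq: "b i = (SOME a. a \<in> univ (G i) \<and> fo_sat (G i) ((\<lambda>n. v n i)(x := a)) (fm_at i \<phi>))"
        unfolding b_def using ex by (rule if_P)
      have "\<exists>a. a \<in> univ (G i) \<and> fo_sat (G i) ((\<lambda>n. v n i)(x := a)) (fm_at i \<phi>)" using ex by blast
      then show ?thesis unfolding eq by (rule someI_ex)
    qed
    have b: "b \<in> sections"
      unfolding sections_def
    proof safe
      fix i show "b i \<in> univ (G i)"
      proof (cases "\<exists>a\<in>univ (G i). fo_sat (G i) ((\<lambda>n. v n i)(x := a)) (fm_at i \<phi>)")
        case True then show ?thesis using b1 by blast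
      next
        case False
        then have "b i = v 0 i" unfolding b_def by (rule if_not_P)
        then show ?thesis using Exists.prems(1)[of 0] by (simp add: sections_def)
      qed
    qed
    have "\<forall>\<^sub>F i in \<U>. fo_sat (G i) ((\<lambda>n. v n i)(x := b i)) (fm_at i \<phi>)"
      using ev by eventually_elim (use b1 in \<open>auto simp: fm\<close>)
    then have "fo_sat M ((\<lambda>n. cls (v n))(x := cls b)) \<phi>" using IH[OF b] by simp
    then show "fo_sat M (\<lambda>n. cls (v n)) (Exists x \<phi>)" using b univ_M by auto
  qed
qed

text \<open>Finitely many formulas that hold eventually hold together at some element, and
  completeness is the dichotomy of the ultrafilter.\<close>

lemma type_of_ultrafilter:
  assumes F: "ultrafilter F" "\<forall>\<^sub>F A in F. A \<in> univ M"
  shows "{\<phi> \<in> fo_fms L M. \<forall>\<^sub>F A in F. fo_sat M (\<lambda>_. A) \<phi>} \<in> fo_types L M" (is "?p \<in> _")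
proof -
  have "\<exists>A\<in>univ M. \<forall>\<phi>\<in>\<Phi>. fo_sat M (\<lambda>_. A) \<phi>"
    if "finite \<Phi>" "\<Phi> \<subseteq> {\<phi> \<in> fo_fms L M. \<forall>\<^sub>F A in F. fo_sat M (\<lambda>_. A) \<phi>}" for \<Phi>
  proof -
    have "\<forall>\<^sub>F A in F. \<forall>\<phi>\<in>\<Phi>. fo_sat M (\<lambda>_. A) \<phi>" using that by (intro eventually_ball_finite) auto
    then have "\<forall>\<^sub>F A in F. A \<in> univ M \<and> (\<forall>\<phi>\<in>\<Phi>. fo_sat M (\<lambda>_. A) \<phi>)"
      using F(2) by (rule eventually_elim2) blast
    from eventually_happens'[OF _ this] show ?thesis using F(1) by (auto simp: ultrafilter_def)
  qed
  moreover have "\<phi> \<in> ?p \<or> Neg \<phi> \<in> ?p" if "\<phi> \<in> fo_fms L M" for \<phi>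
  proof -
    have "Neg \<phi> \<in> fo_fms L M" using that by (simp add: fo_fms_def)
    moreover have "(\<forall>\<^sub>F A in F. fo_sat M (\<lambda>_. A) \<phi>) \<or> (\<forall>\<^sub>F A in F. fo_sat M (\<lambda>_. A) (Neg \<phi>))"
      using ultrafilter_not_eventually[OF F(1), of "\<lambda>A. fo_sat M (\<lambda>_. A) \<phi>"] 
      by (simp only: fo_sat.simps) blast
    ultimately show ?thesis using that by simp
  qed
  ultimately show ?thesis unfolding fo_types_def by (intro CollectI conjI) auto
qed

lemma fo_tp_in_types:
  assumes "A \<in> univ M"
  shows "fo_tp L M A \<in> fo_types L M"
proof -
  have "Neg \<phi> \<in> fo_fms L M" if "\<phi> \<in> fo_fms L M" for \<phi> using that by (simp add: fo_fms_def)
  then show ?thesis using assms by (auto simp: fo_types_def fo_tp_def)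
qed

text \<open>Types respect conjunction, so the generating sets are closed under binary intersections
  and a single formula suffices.\<close>

lemma openin_fo_type_space:
  assumes "openin (fo_type_space L M) Q" "p \<in> Q"
  obtains \<phi> where "\<phi> \<in> fo_fms L M" "\<phi> \<in> p" "{q \<in> fo_types L M. \<phi> \<in> q} \<subseteq> Q"
proof -
  have Conj_iff: "Conj \<phi> \<psi> \<in> q \<longleftrightarrow> \<phi> \<in> q \<and> \<psi> \<in> q"
    if q: "q \<in> fo_types L M" and fms: "\<phi> \<in> fo_fms L M" "\<psi> \<in> fo_fms L M" for q \<phi> \<psi>
  proof -
    have sat: "\<exists>a\<in>univ M. \<forall>\<theta>\<in>\<Phi>. fo_sat M (\<lambda>_. a) \<theta>" if "finite \<Phi>" "\<Phi> \<subseteq> q" for \<Phi>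
      using q that by (simp add: fo_types_def)
    have compl: "\<theta> \<in> q \<or> Neg \<theta> \<in> q" if "\<theta> \<in> fo_fms L M" for \<theta> using q that by (simp add: fo_types_def)
    have Cf: "Conj \<phi> \<psi> \<in> fo_fms L M" using fms by (auto simp: fo_fms_def)
    show ?thesis
      using sat[of "{Conj \<phi> \<psi>, Neg \<phi>}"] sat[of "{Conj \<phi> \<psi>, Neg \<psi>}"] sat[of "{Neg (Conj \<phi> \<psi>), \<phi>, \<psi>}"]
        compl[OF fms(1)] compl[OF fms(2)] compl[OF Cf] by auto
  qed
  have "generate_topology_on {{p \<in> fo_types L M. \<phi> \<in> p} | \<phi>. \<phi> \<in> fo_fms L M} Q"
    using assms(1) unfolding fo_type_space_def openin_topology_generated_by_iff .
  then have "p \<in> Q \<Longrightarrow> \<exists>\<phi>\<in>fo_fms L M. p \<in> fo_types L M \<and> \<phi> \<in> p \<and> {q \<in> fo_types L M. \<phi> \<in> q} \<subseteq> Q"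
  proof (induction rule: generate_topology_on.induct)
    case (Int a b)
    then obtain \<phi> \<psi> where *: "\<phi> \<in> fo_fms L M" "p \<in> fo_types L M" "\<phi> \<in> p" "{q \<in> fo_types L M. \<phi> \<in> q} \<subseteq> a"
      "\<psi> \<in> fo_fms L M" "\<psi> \<in> p" "{q \<in> fo_types L M. \<psi> \<in> q} \<subseteq> b" by auto
    have "Conj \<phi> \<psi> \<in> fo_fms L M" using * by (auto simp: fo_fms_def)
    moreover have "Conj \<phi> \<psi> \<in> p" using Conj_iff * by blast
    moreover have "{q \<in> fo_types L M. Conj \<phi> \<psi> \<in> q} \<subseteq> a \<inter> b" using Conj_iff * by blast
    ultimately show ?case using *(2) by blast
  next
    case (UN \<K>)
    then show ?case by blast
  qed auto
  then show ?thesis using assms(2) that by blast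
qed

text \<open>An ultrafilter on the elements that \<tau> maps into \<open>D\<close> has a limit type,
  and \<open>g\<close> sends this type into \<open>D\<close>: otherwise a formula of the type would
  force \<tau> out of \<open>D\<close> on a large set. As \<open>D\<close> lies in
  \<open>O'\<close>, some formula of the type defines a set inside the preimage of
  \<open>O'\<close>. By \<open>ultrafilter_cover\<close> finitely many such formulas suffice, and
  \<open>Los\<close> turns their disjunction into an internal set.\<close>

lemma definable_separation:
  assumes def: "fo_definable_map L M T \<tau>" and D: "closedin T D" and O': "openin T O'" and sub: "D \<subseteq> O'"
  shows "\<exists>X. \<forall>a\<in>sections. (\<tau> (cls a) \<in> D \<longrightarrow> (\<forall>\<^sub>F i in \<U>. a i \<in> X i)) \<and>
    ((\<forall>\<^sub>F i in \<U>. a i \<in> X i) \<longrightarrow> \<tau> (cls a) \<in> O')"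
proof -
  obtain g where g: "continuous_map (fo_type_space L M) T g"
    and g\<tau>: "\<And>A. A \<in> univ M \<Longrightarrow> g (fo_tp L M A) = \<tau> A"
    using def unfolding fo_definable_map_def by blast
  define sat where "sat \<phi> = {A \<in> univ M. fo_sat M (\<lambda>_. A) \<phi>}" for \<phi>
  let ?I = "{sat \<phi> | \<phi>. \<phi> \<in> fo_fms L M \<and> sat \<phi> \<subseteq> \<tau> -` O'}"
  have nbhd: "\<exists>\<phi>\<in>fo_fms L M. (\<forall>\<^sub>F A in F. fo_sat M (\<lambda>_. A) \<phi>) \<and> sat \<phi> \<subseteq> \<tau> -` Q"
    if F: "ultrafilter F" "\<forall>\<^sub>F A in F. A \<in> univ M" and Q: "openin T Q"
      "g {\<phi> \<in> fo_fms L M. \<forall>\<^sub>F A in F. fo_sat M (\<lambda>_. A) \<phi>} \<in> Q" for F Q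
  proof -
    let ?p = "{\<phi> \<in> fo_fms L M. \<forall>\<^sub>F A in F. fo_sat M (\<lambda>_. A) \<phi>}"
    \<comment> \<open>A formula in the type places it in a generating set, and the underlying set of
      the topology is the union of those.\<close>
    have "Equal (Var 0) (Var 0) \<in> ?p" by (simp add: fo_fms_def)
    then have "?p \<in> topspace (fo_type_space L M)"
      using type_of_ultrafilter[OF F] unfolding fo_type_space_def topology_generated_by_topspace
      by blast
    then have "?p \<in> {p \<in> topspace (fo_type_space L M). g p \<in> Q}" using Q(2) by blast
    from openin_fo_type_space[OF openin_continuous_map_preimage[OF g Q(1)] this]
    obtain \<phi> where \<phi>: "\<phi> \<in> fo_fms L M" "\<phi> \<in> ?p"
      "{q \<in> fo_types L M. \<phi> \<in> q} \<subseteq> {p \<in> topspace (fo_type_space L M). g p \<in> Q}" by blast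
    have "\<tau> A \<in> Q" if "A \<in> sat \<phi>" for A
    proof -
      have "\<phi> \<in> fo_tp L M A" "A \<in> univ M" using that \<phi>(1) by (auto simp: sat_def fo_tp_def)
      then show ?thesis using \<phi>(3) fo_tp_in_types g\<tau> by force
    qed
    then show ?thesis using \<phi>(1,2) by blast
  qed
  obtain \<P> where \<P>: "finite \<P>" "\<P> \<subseteq> ?I" "{A \<in> univ M. \<tau> A \<in> D} \<subseteq> \<Union>\<P>"
  proof (rule ultrafilter_cover)
    fix F assume F: "ultrafilter F" and ev: "\<forall>\<^sub>F A in F. A \<in> {A \<in> univ M. \<tau> A \<in> D}"
    let ?p = "{\<phi> \<in> fo_fms L M. \<forall>\<^sub>F A in F. fo_sat M (\<lambda>_. A) \<phi>}"
    have univ: "\<forall>\<^sub>F A in F. A \<in> univ M" using ev by eventually_elim simp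
    have gp: "g ?p \<in> D"
    proof (rule ccontr)
      assume "g ?p \<notin> D"
      moreover have "?p \<in> topspace (fo_type_space L M)"
      proof -
        have "Equal (Var 0) (Var 0) \<in> ?p" by (simp add: fo_fms_def)
        then show ?thesis
          using type_of_ultrafilter[OF F univ] unfolding fo_type_space_def topology_generated_by_topspace
          by blast
      qed
      then have "g ?p \<in> topspace T" using g by (auto simp: continuous_map_def)
      ultimately have "g ?p \<in> topspace T - D" by blast
      moreover have "openin T (topspace T - D)" using D by blast
      ultimately obtain \<phi> where \<phi>: "\<forall>\<^sub>F A in F. fo_sat M (\<lambda>_. A) \<phi>" "sat \<phi> \<subseteq> \<tau> -` (topspace T - D)"
        using nbhd[OF F univ] by blast
      from \<phi>(1) ev have "eventually (\<lambda>_. False) F"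
        by eventually_elim (use \<phi>(2) in \<open>auto simp: sat_def\<close>)
      then show False using F by (simp add: ultrafilter_def trivial_limit_def)
    qed
    then have "g ?p \<in> O'" using sub by blast
    from nbhd[OF F univ O' this] obtain \<phi> where
      \<phi>: "\<phi> \<in> fo_fms L M" "\<forall>\<^sub>F A in F. fo_sat M (\<lambda>_. A) \<phi>" "sat \<phi> \<subseteq> \<tau> -` O'" by blast
    have "\<forall>\<^sub>F A in F. A \<in> sat \<phi>" using \<phi>(2) univ by eventually_elim (simp add: sat_def)
    then show "\<exists>P\<in>?I. \<forall>\<^sub>F x in F. x \<in> P" using \<phi>(1,3) by blast
  qed
  have "\<forall>P\<in>\<P>. \<exists>\<phi>. P = sat \<phi> \<and> \<phi> \<in> fo_fms L M \<and> sat \<phi> \<subseteq> \<tau> -` O'" using \<P>(2) by blast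
  then obtain \<Phi> where \<Phi>: "\<And>P. P \<in> \<P> \<Longrightarrow> P = sat (\<Phi> P) \<and> \<Phi> P \<in> fo_fms L M \<and> sat (\<Phi> P) \<subseteq> \<tau> -` O'"
    by metis
  have los: "cls a \<in> P \<longleftrightarrow> (\<forall>\<^sub>F i in \<U>. fo_sat (G i) (\<lambda>_. a i) (fm_at i (\<Phi> P)))"
    if "a \<in> sections" "P \<in> \<P>" for a P
  proof -
    have "cls a \<in> P \<longleftrightarrow> fo_sat M (\<lambda>_. cls a) (\<Phi> P)"
    proof -
      have "cls a \<in> univ M" using that(1) univ_M by blast
      moreover have "cls a \<in> P \<longleftrightarrow> cls a \<in> sat (\<Phi> P)" using \<Phi>[OF that(2)] by blast
      ultimately show ?thesis by (simp add: sat_def)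
    qed
    also have "\<dots> \<longleftrightarrow> (\<forall>\<^sub>F i in \<U>. fo_sat (G i) (\<lambda>_. a i) (fm_at i (\<Phi> P)))"
      using Los[of "\<lambda>_. a" "\<Phi> P"] that \<Phi>[OF that(2)] by (simp add: fo_fms_def)
    finally show ?thesis .
  qed
  show ?thesis
  proof (intro exI ballI conjI impI)
    let ?X = "\<lambda>i. {x. \<exists>P\<in>\<P>. fo_sat (G i) (\<lambda>_. x) (fm_at i (\<Phi> P))}"
    fix a assume a: "a \<in> sections"
    have aM: "cls a \<in> univ M" using a univ_M by blast
    show "\<forall>\<^sub>F i in \<U>. a i \<in> ?X i" if aD: "\<tau> (cls a) \<in> D"
    proof -
      obtain P where P: "P \<in> \<P>" "cls a \<in> P" using \<P>(3) aD aM by blast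
      then have "\<forall>\<^sub>F i in \<U>. fo_sat (G i) (\<lambda>_. a i) (fm_at i (\<Phi> P))" using los[OF a] by simp
      then show ?thesis by eventually_elim (use P(1) in blast)
    qed
    show "\<tau> (cls a) \<in> O'" if "\<forall>\<^sub>F i in \<U>. a i \<in> ?X i"
    proof -
      have "\<forall>\<^sub>F i in \<U>. \<exists>P\<in>\<P>. fo_sat (G i) (\<lambda>_. a i) (fm_at i (\<Phi> P))"
        using that by eventually_elim simp
      from ultrafilter_eventually_bex_finite[OF ultra \<P>(1) this] obtain P where
        P: "P \<in> \<P>" "cls a \<in> P" using los[OF a] by blast
      then show ?thesis using \<Phi>[OF P(1)] by blast
    qed
  qed
qed

end

section \<open>Continuous logic\<close>

lemma ultrafilter_bounded_tendsto:
  fixes f :: "'i \<Rightarrow> real"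
  assumes U: "ultrafilter U" and B: "\<forall>\<^sub>F i in U. \<bar>f i\<bar> \<le> B"
  shows "(f \<longlongrightarrow> Lim U f) U"
proof -
  let ?T = "subtopology euclideanreal {-B..B}"
  have "compact_space ?T" by (simp add: compact_space_subtopology)
  moreover have "\<forall>\<^sub>F i in U. f i \<in> topspace ?T" using B by eventually_elim auto
  ultimately obtain l where "limitin ?T f l U" by (rule compact_space_ultrafilter_limit[OF U])
  then have "(f \<longlongrightarrow> l) U" by (simp add: limitin_subtopology)
  moreover from this have "Lim U f = l" using U by (intro tendsto_Lim) (simp add: ultrafilter_def)
  ultimately show ?thesis by simp
qed

lemma limitin_Euclidean_space:
  assumes "\<forall>\<^sub>F i in F. f i \<in> topspace (Euclidean_space m)" "l \<in> topspace (Euclidean_space m)"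
    "\<And>k. k < m \<Longrightarrow> ((\<lambda>i. f i k) \<longlongrightarrow> l k) F"
  shows "limitin (Euclidean_space m) f l F"
proof -
  have "((\<lambda>i. f i k) \<longlongrightarrow> l k) F" for k
  proof (cases "k < m")
    case False
    have "\<forall>\<^sub>F i in F. f i k = l k"
      using assms(1) by eventually_elim (use False assms(2) in \<open>auto simp: topspace_Euclidean_space\<close>)
    then show ?thesis by (rule tendsto_eventually)
  qed (rule assms(3))
  then show ?thesis
    using assms(1,2) unfolding Euclidean_space_def limitin_subtopology limitin_componentwise by simp
qed

text \<open>The cube is compact as a product of compact sets. The bound depends only on
  \<open>u\<close>, the dimension and \<open>B\<close>, which keeps the values of formulas bounded
  uniformly in the factors.\<close>

lemma continuous_map_Euclidean_space_bounded:
  assumes "continuous_map (Euclidean_space m) euclideanreal u"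
  obtains B' where "\<And>x. x \<in> topspace (Euclidean_space m) \<Longrightarrow> (\<And>i. i < m \<Longrightarrow> \<bar>x i\<bar> \<le> B) \<Longrightarrow> \<bar>u x\<bar> \<le> B'"
proof -
  let ?S = "Pi\<^sub>E UNIV (\<lambda>i. if i < m then {-B..B} else {0::real})"
  have "compactin (powertop_real UNIV) ?S" by (simp add: compactin_PiE)
  moreover have "?S \<subseteq> {x. \<forall>i\<ge>m. x i = 0}"
  proof safe
    fix x i assume x: "x \<in> ?S" and i: "m \<le> i"
    from PiE_mem[OF x UNIV_I, of i] show "x i = 0" using i by simp
  qed
  ultimately have "compactin (Euclidean_space m) ?S"
    unfolding Euclidean_space_def compactin_subtopology by simp
  then have "compactin euclideanreal (u ` ?S)" using assms by (rule image_compactin)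
  then have "bounded (u ` ?S)" by (simp add: compact_imp_bounded)
  then obtain B' where B': "\<And>x. x \<in> ?S \<Longrightarrow> \<bar>u x\<bar> \<le> B'" by (auto simp: bounded_iff)
  have "x \<in> ?S" if "x \<in> topspace (Euclidean_space m)" "\<And>i. i < m \<Longrightarrow> \<bar>x i\<bar> \<le> B" for x
    using that by (auto simp: topspace_Euclidean_space PiE_iff abs_le_iff minus_le_iff)
  then show ?thesis using that[of B'] B' by blast
qed

text \<open>Reduces infima to suprema, so that \<open>SUP_ultralimit\<close> serves both
  quantifiers.\<close>

lemma uminus_SUP_uminus: "(INF a\<in>S. f a :: real) = - (SUP a\<in>S. - f a)"
  by (simp add: Inf_real_def image_image)

locale metric_structure_family =
  fixes \<U> :: "'i filter" and L :: "('f, 'r) metric_lang" and G :: "'i \<Rightarrow> ('a, 'f, 'r) metric_structure"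
  assumes ultra: "ultrafilter \<U>" and lang: "is_metric_lang L" and struct: "is_metric_structure L (G i)"
begin

abbreviation "M \<equiv> metric_ultraproduct \<U> G"
lemma nontrivial: "\<U> \<noteq> bot" using ultra by (simp add: ultrafilter_def)

lemma metric: "Metric_space (univ (G i)) (metr (G i))"
  using struct[of i] by (simp add: is_metric_structure_def)

lemmas metr_nonneg = Metric_space.nonneg[OF metric]
  and metr_commute = Metric_space.commute[OF metric]
  and metr_triangle = Metric_space.triangle[OF metric]

lemma metr_refl: "x \<in> univ (G i) \<Longrightarrow> metr (G i) x x = 0"
  using Metric_space.zero[OF metric] by blast

lemma metr_bound: "x \<in> univ (G i) \<Longrightarrow> y \<in> univ (G i) \<Longrightarrow> \<bar>metr (G i) x y\<bar> \<le> diam_bound L"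
  using struct[of i] metr_nonneg[of i x y] by (simp add: is_metric_structure_def)

lemma pred_bound:
  assumes "r \<in> rel_syms L" "xs \<in> tuples (univ (G i)) (rel_arity L r)"
  shows "\<bar>pred (G i) r xs\<bar> \<le> max \<bar>pred_lo L r\<bar> \<bar>pred_hi L r\<bar>"
proof -
  have "pred (G i) r xs \<in> {pred_lo L r .. pred_hi L r}"
    using struct[of i] assms by (simp add: is_metric_structure_def)
  then show ?thesis by auto
qed

lemma fn_modulus:
  assumes "f \<in> fun_syms L" "0 < \<epsilon>" "xs \<in> tuples (univ (G i)) (fun_arity L f)"
    "ys \<in> tuples (univ (G i)) (fun_arity L f)"
    "\<And>k. k < fun_arity L f \<Longrightarrow> metr (G i) (xs ! k) (ys ! k) < fun_modulus L f \<epsilon>"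
  shows "metr (G i) (fn (G i) f xs) (fn (G i) f ys) \<le> \<epsilon>"
  using struct[of i] assms unfolding is_metric_structure_def by blast

lemma pred_modulus:
  assumes "r \<in> rel_syms L" "0 < \<epsilon>" "xs \<in> tuples (univ (G i)) (rel_arity L r)"
    "ys \<in> tuples (univ (G i)) (rel_arity L r)"
    "\<And>k. k < rel_arity L r \<Longrightarrow> metr (G i) (xs ! k) (ys ! k) < metric_lang.pred_modulus L r \<epsilon>"
  shows "\<bar>pred (G i) r xs - pred (G i) r ys\<bar> \<le> \<epsilon>"
  using struct[of i] assms unfolding is_metric_structure_def by blast

definition infclose :: "('i \<Rightarrow> 'a) \<Rightarrow> ('i \<Rightarrow> 'a) \<Rightarrow> bool" where
  "infclose a b \<longleftrightarrow> ((\<lambda>i. metr (G i) (a i) (b i)) \<longlongrightarrow> 0) \<U>"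

lemma infclose_iff: "infclose a b \<longleftrightarrow> (\<forall>\<epsilon>>0. \<forall>\<^sub>F i in \<U>. metr (G i) (a i) (b i) < \<epsilon>)"
  unfolding infclose_def tendsto_iff dist_real_def using metr_nonneg by simp

lemma infclose_trans:
  assumes "infclose a b" "infclose b c" and univ: "\<And>i. a i \<in> univ (G i)" "\<And>i. b i \<in> univ (G i)"
    "\<And>i. c i \<in> univ (G i)"
  shows "infclose a c"
  unfolding infclose_iff
proof (intro allI impI)
  fix \<epsilon> :: real assume "0 < \<epsilon>"
  then have "\<forall>\<^sub>F i in \<U>. metr (G i) (a i) (b i) < \<epsilon> / 2" "\<forall>\<^sub>F i in \<U>. metr (G i) (b i) (c i) < \<epsilon> / 2"
    using assms(1,2) unfolding infclose_iff by (meson half_gt_zero)+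
  then show "\<forall>\<^sub>F i in \<U>. metr (G i) (a i) (c i) < \<epsilon>"
  proof eventually_elim
    case (elim i)
    then show ?case using metr_triangle[OF univ, of i] by linarith
  qed
qed

lemma eventually_list_close:
  assumes "list_all2 infclose as bs" "0 < \<epsilon>"
  shows "\<forall>\<^sub>F i in \<U>. \<forall>k<length as. metr (G i) (map (\<lambda>a. a i) as ! k) (map (\<lambda>a. a i) bs ! k) < \<epsilon>"
proof -
  have "\<forall>\<^sub>F i in \<U>. \<forall>k\<in>{..<length as}. metr (G i) ((as ! k) i) ((bs ! k) i) < \<epsilon>"
    using assms by (intro eventually_ball_finite) (auto simp: list_all2_conv_all_nth infclose_iff)
  then show ?thesis
    by eventually_elim (use assms(1) in \<open>auto simp: list_all2_lengthD\<close>)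
qed

sublocale structure_ultraproduct L G M infclose
proof
  show "infclose a a" if "\<And>i. a i \<in> univ (G i)" for a using that by (simp add: infclose_def metr_refl)
  show "infclose b a" if "infclose a b" for a b using that by (simp add: infclose_def metr_commute)
  show "infclose a c" if "infclose a b" "infclose b c" "\<And>i. a i \<in> univ (G i)" "\<And>i. b i \<in> univ (G i)"
    "\<And>i. c i \<in> univ (G i)" for a b c using that by (rule infclose_trans)
  show "fn (G i) f xs \<in> univ (G i)"
    if "f \<in> fun_syms L" "xs \<in> tuples (univ (G i)) (fun_arity L f)" for f xs i
    using struct[of i] that by (simp add: is_metric_structure_def)
  show "infclose (\<lambda>i. fn (G i) f (map (\<lambda>a. a i) as)) (\<lambda>i. fn (G i) f (map (\<lambda>a. a i) bs))"
    if f: "f \<in> fun_syms L" and as: "\<And>i. map (\<lambda>a. a i) as \<in> tuples (univ (G i)) (fun_arity L f)"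
      and bs: "\<And>i. map (\<lambda>a. a i) bs \<in> tuples (univ (G i)) (fun_arity L f)"
      and sim: "list_all2 infclose as bs" for f as bs
    unfolding infclose_iff
  proof (intro allI impI)
    fix \<epsilon> :: real assume \<epsilon>: "0 < \<epsilon>"
    have len: "length as = fun_arity L f" using as by (simp add: tuples_def)
    \<comment> \<open>Half of \<epsilon>, because the modulus yields a non-strict bound.\<close>
    have "0 < fun_modulus L f (\<epsilon> / 2)" using lang f \<epsilon> by (simp add: is_metric_lang_def)
    from eventually_list_close[OF sim this]
    show "\<forall>\<^sub>F i in \<U>. metr (G i) (fn (G i) f (map (\<lambda>a. a i) as)) (fn (G i) f (map (\<lambda>a. a i) bs)) < \<epsilon>"
    proof eventually_elim
      case (elim i)
      have "metr (G i) (fn (G i) f (map (\<lambda>a. a i) as)) (fn (G i) f (map (\<lambda>a. a i) bs)) \<le> \<epsilon> / 2"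
        using \<epsilon> len elim by (intro fn_modulus[OF f _ as bs]) auto
      then show ?case using \<epsilon> by linarith
    qed
  qed
qed (auto simp: metric_ultraproduct_def metric_class_def infclose_def)

lemma metr_M: "metr M A B = Lim \<U> (\<lambda>i. metr (G i) (rep A i) (rep B i))"
  by (simp add: metric_ultraproduct_def rep_def)

lemma pred_M_cls:
  assumes r: "r \<in> rel_syms L" "length as = rel_arity L r" and as: "set as \<subseteq> sections"
  shows "((\<lambda>i. pred (G i) r (map (\<lambda>a. a i) as)) \<longlongrightarrow> pred M r (map cls as)) \<U>"
proof -
  let ?rs = "map (\<lambda>a. rep (cls a)) as"
  have t1: "map (\<lambda>a. a i) as \<in> tuples (univ (G i)) (rel_arity L r)" for i
    using section_tuple[OF as] r(2) by simp
  have t2: "map (\<lambda>a. a i) ?rs \<in> tuples (univ (G i)) (rel_arity L r)" for i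
    using section_tuple[OF reps_sections[OF as]] r(2) by simp
  have "pred M r (map cls as) = Lim \<U> (\<lambda>i. pred (G i) r (map (\<lambda>a. a i) ?rs))"
    by (simp add: metric_ultraproduct_def rep_def o_def)
  moreover have "((\<lambda>i. pred (G i) r (map (\<lambda>a. a i) ?rs)) \<longlongrightarrow> Lim \<U> (\<lambda>i. pred (G i) r (map (\<lambda>a. a i) ?rs))) \<U>"
    by (rule ultrafilter_bounded_tendsto[OF ultra always_eventually], rule allI)
      (rule pred_bound[OF r(1) t2])
  moreover have "((\<lambda>i. pred (G i) r (map (\<lambda>a. a i) as) - pred (G i) r (map (\<lambda>a. a i) ?rs)) \<longlongrightarrow> 0) \<U>"
    unfolding tendsto_iff dist_real_def
  proof (intro allI impI)
    fix \<epsilon> :: real assume \<epsilon>: "0 < \<epsilon>"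
    have "0 < metric_lang.pred_modulus L r (\<epsilon> / 2)" using lang r(1) \<epsilon> by (simp add: is_metric_lang_def)
    from eventually_list_close[OF reps_sim[OF as] this]
    show "\<forall>\<^sub>F i in \<U>. \<bar>pred (G i) r (map (\<lambda>a. a i) as) - pred (G i) r (map (\<lambda>a. a i) ?rs) - 0\<bar> < \<epsilon>"
    proof eventually_elim
      case (elim i)
      have "\<bar>pred (G i) r (map (\<lambda>a. a i) ?rs) - pred (G i) r (map (\<lambda>a. a i) as)\<bar> \<le> \<epsilon> / 2"
        using \<epsilon> r(2) elim by (intro pred_modulus[OF r(1) _ t2 t1]) auto
      then show ?case using \<epsilon> by linarith
    qed
  qed
  ultimately have "((\<lambda>i. pred (G i) r (map (\<lambda>a. a i) ?rs)
      + (pred (G i) r (map (\<lambda>a. a i) as) - pred (G i) r (map (\<lambda>a. a i) ?rs)))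
      \<longlongrightarrow> pred M r (map cls as) + 0) \<U>" by (intro tendsto_add) simp_all
  then show ?thesis by simp
qed

lemma metr_M_cls:
  assumes a: "a \<in> sections" and b: "b \<in> sections"
  shows "((\<lambda>i. metr (G i) (a i) (b i)) \<longlongrightarrow> metr M (cls a) (cls b)) \<U>"
proof -
  let ?a = "rep (cls a)" and ?b = "rep (cls b)"
  note ra = rep_cls[OF a] and rb = rep_cls[OF b]
  have "((\<lambda>i. metr (G i) (?a i) (?b i)) \<longlongrightarrow> metr M (cls a) (cls b)) \<U>"
    unfolding metr_M
    by (rule ultrafilter_bounded_tendsto[OF ultra always_eventually], rule allI)
      (rule metr_bound[OF sections_D[OF ra(1)] sections_D[OF rb(1)]])
  moreover have "((\<lambda>i. metr (G i) (a i) (b i) - metr (G i) (?a i) (?b i)) \<longlongrightarrow> 0) \<U>"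
    unfolding tendsto_iff dist_real_def
  proof (intro allI impI)
    fix \<epsilon> :: real assume \<epsilon>: "0 < \<epsilon>"
    have "\<forall>\<^sub>F i in \<U>. metr (G i) (?a i) (a i) < \<epsilon> / 2" "\<forall>\<^sub>F i in \<U>. metr (G i) (?b i) (b i) < \<epsilon> / 2"
      using ra(2) rb(2) \<epsilon> unfolding infclose_iff by (meson half_gt_zero)+
    then show "\<forall>\<^sub>F i in \<U>. \<bar>metr (G i) (a i) (b i) - metr (G i) (?a i) (?b i) - 0\<bar> < \<epsilon>"
    proof eventually_elim
      case (elim i)
      note in_univ = sections_D[OF a, of i] sections_D[OF b, of i] sections_D[OF ra(1), of i] sections_D[OF rb(1), of i]
      have "metr (G i) (a i) (b i) \<le> metr (G i) (a i) (?a i) + metr (G i) (?a i) (b i)"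
        "metr (G i) (?a i) (b i) \<le> metr (G i) (?a i) (?b i) + metr (G i) (?b i) (b i)"
        "metr (G i) (?a i) (?b i) \<le> metr (G i) (?a i) (a i) + metr (G i) (a i) (?b i)"
        "metr (G i) (a i) (?b i) \<le> metr (G i) (a i) (b i) + metr (G i) (b i) (?b i)"
        using in_univ by (auto intro: metr_triangle)
      then show ?case
        using elim metr_commute[of i "a i" "?a i"] metr_commute[of i "b i" "?b i"] by linarith
    qed
  qed
  ultimately have "((\<lambda>i. metr (G i) (?a i) (?b i) + (metr (G i) (a i) (b i) - metr (G i) (?a i) (?b i)))
      \<longlongrightarrow> metr M (cls a) (cls b) + 0) \<U>" by (rule tendsto_add)
  then show ?thesis by simp
qed

definition fm_at :: "'i \<Rightarrow> (('i \<Rightarrow> 'a) set, 'f, 'r) metric_fm \<Rightarrow> ('a, 'f, 'r) metric_fm" where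
  "fm_at i = map_metric_fm (\<lambda>A. rep A i) (\<lambda>f. f) (\<lambda>r. r)"

lemma fm_at_simps:
  "fm_at i (Dist s t) = Dist (trm_at i s) (trm_at i t)"
  "fm_at i (Pred r ts) = Pred r (map (trm_at i) ts)"
  "fm_at i (Conn u \<phi>s) = Conn u (map (fm_at i) \<phi>s)"
  "fm_at i (SupQ x \<phi>) = SupQ x (fm_at i \<phi>)"
  "fm_at i (InfQ x \<phi>) = InfQ x (fm_at i \<phi>)"
  by (simp_all add: fm_at_def trm_at_def)

text \<open>One bound for all factors and assignments: it comes from the bounds in the language and
  passes through connectives by compactness of cubes. It makes ultralimits of values exist and keeps
  suprema and infima finite.\<close>

lemma metric_val_bounded:
  assumes "wf_metric L (univ M) \<phi>"
  shows "\<exists>B. \<forall>i (w :: nat \<Rightarrow> 'a). (\<forall>n. w n \<in> univ (G i)) \<longrightarrow> \<bar>metric_val (G i) w (fm_at i \<phi>)\<bar> \<le> B"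
  using assms
proof (induction \<phi>)
  case (Dist s t)
  then show ?case
    using trm_val_at_closed by (intro exI[of _ "diam_bound L"]) (auto simp: fm_at_simps intro!: metr_bound)
next
  case (Pred r ts)
  show ?case
  proof (intro exI allI impI)
    fix i and w :: "nat \<Rightarrow> 'a" assume w: "\<forall>n. w n \<in> univ (G i)"
    have "map (trm_val (G i) w) (map (trm_at i) ts) \<in> tuples (univ (G i)) (rel_arity L r)"
      using Pred trm_val_at_closed[of w i] w by (auto simp: tuples_def)
    from pred_bound[OF _ this]
    show "\<bar>metric_val (G i) w (fm_at i (Pred r ts))\<bar> \<le> max \<bar>pred_lo L r\<bar> \<bar>pred_hi L r\<bar>"
      using Pred by (simp add: fm_at_simps)
  qed
next
  case (Conn u \<phi>s)
  let ?P = "\<lambda>\<phi> B. \<forall>i w. (\<forall>n. w n \<in> univ (G i)) \<longrightarrow> \<bar>metric_val (G i) w (fm_at i \<phi>)\<bar> \<le> B"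
  have "\<forall>\<phi>\<in>set \<phi>s. \<exists>B. ?P \<phi> B" using Conn by auto
  then obtain B where B: "\<And>\<phi>. \<phi> \<in> set \<phi>s \<Longrightarrow> ?P \<phi> (B \<phi>)" by metis
  define B0 where "B0 = Max (insert 0 (B ` set \<phi>s))"
  have B0: "B \<phi> \<le> B0" if "\<phi> \<in> set \<phi>s" for \<phi> unfolding B0_def using that by (intro Max_ge) auto
  have cont: "continuous_map (Euclidean_space (length \<phi>s)) euclideanreal u" using Conn.prems by simp
  obtain B' where B': "\<And>x. x \<in> topspace (Euclidean_space (length \<phi>s)) \<Longrightarrow>
      (\<And>k. k < length \<phi>s \<Longrightarrow> \<bar>x k\<bar> \<le> B0) \<Longrightarrow> \<bar>u x\<bar> \<le> B'"
    by (rule continuous_map_Euclidean_space_bounded[OF cont, of B0]) blast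
  show ?case
  proof (intro exI allI impI)
    fix i and w :: "nat \<Rightarrow> 'a" assume w: "\<forall>n. w n \<in> univ (G i)"
    let ?x = "\<lambda>k. if k < length \<phi>s then metric_val (G i) w (fm_at i (\<phi>s ! k)) else 0"
    have "metric_val (G i) w (fm_at i (Conn u \<phi>s)) = u ?x"
      unfolding fm_at_simps metric_val.simps by (rule arg_cong[of _ _ u]) (auto simp: fun_eq_iff)
    moreover have "\<bar>u ?x\<bar> \<le> B'"
    proof (rule B')
      show "?x \<in> topspace (Euclidean_space (length \<phi>s))" by (simp add: topspace_Euclidean_space)
      fix k assume k: "k < length \<phi>s"
      have "\<bar>metric_val (G i) w (fm_at i (\<phi>s ! k))\<bar> \<le> B (\<phi>s ! k)" using B[OF nth_mem[OF k]] w by blast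
      then show "\<bar>?x k\<bar> \<le> B0" using k B0[OF nth_mem[OF k]] by simp
    qed
    ultimately show "\<bar>metric_val (G i) w (fm_at i (Conn u \<phi>s))\<bar> \<le> B'" by simp
  qed
next
  case (SupQ x \<phi>)
  then obtain B where B: "\<And>i w. \<forall>n. w n \<in> univ (G i) \<Longrightarrow> \<bar>metric_val (G i) w (fm_at i \<phi>)\<bar> \<le> B" by auto
  show ?case
  proof (intro exI allI impI)
    fix i and w :: "nat \<Rightarrow> 'a" assume w: "\<forall>n. w n \<in> univ (G i)"
    then show "\<bar>metric_val (G i) w (fm_at i (SupQ x \<phi>))\<bar> \<le> B"
      unfolding fm_at_simps metric_val.simps by (intro cSup_abs_le) (auto intro!: B)
  qed
next
  case (InfQ x \<phi>)
  then obtain B where B: "\<And>i w. \<forall>n. w n \<in> univ (G i) \<Longrightarrow> \<bar>metric_val (G i) w (fm_at i \<phi>)\<bar> \<le> B" by auto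
  show ?case
  proof (intro exI allI impI)
    fix i and w :: "nat \<Rightarrow> 'a" assume w: "\<forall>n. w n \<in> univ (G i)"
    then show "\<bar>metric_val (G i) w (fm_at i (InfQ x \<phi>))\<bar> \<le> B"
      unfolding fm_at_simps metric_val.simps by (intro cInf_abs_ge) (auto intro!: B)
  qed
qed

text \<open>The limit at a section is at most the limit of the suprema. Conversely, points that come
  within \<open>e\<close> of the supremum in every factor form a section whose limit comes within
  \<open>e\<close> of the limit of the suprema.\<close>

lemma SUP_ultralimit:
  fixes F :: "'i \<Rightarrow> 'a \<Rightarrow> real"
  assumes bound: "\<And>i a. a \<in> univ (G i) \<Longrightarrow> \<bar>F i a\<bar> \<le> B"
    and lim: "\<And>b. b \<in> sections \<Longrightarrow> ((\<lambda>i. F i (b i)) \<longlongrightarrow> l b) \<U>"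
  shows "((\<lambda>i. SUP a\<in>univ (G i). F i a) \<longlongrightarrow> (SUP b\<in>sections. l b)) \<U>"
proof -
  define s where "s i = (SUP a\<in>univ (G i). F i a)" for i
  have ne: "univ (G i) \<noteq> {}" for i using struct[of i] by (simp add: is_metric_structure_def)
  then have sne: "sections \<noteq> {}"
    unfolding sections_def by (auto intro!: exI[of _ "\<lambda>i. SOME a. a \<in> univ (G i)"] simp: some_in_eq)
  have bdd: "bdd_above (F i ` univ (G i))" for i
    by (rule bdd_aboveI2[of _ _ B]) (use bound in \<open>auto simp: abs_le_iff\<close>)
  have sB: "\<bar>s i\<bar> \<le> B" for i unfolding s_def using ne bound by (intro cSup_abs_le) auto
  define m where "m = Lim \<U> s"
  have m: "(s \<longlongrightarrow> m) \<U>"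
    unfolding m_def by (rule ultrafilter_bounded_tendsto[OF ultra always_eventually], rule allI) (rule sB)
  have le: "l b \<le> m" if "b \<in> sections" for b
  proof (rule tendsto_le[OF nontrivial m lim[OF that]])
    have "F i (b i) \<le> s i" for i
      unfolding s_def using sections_D[OF that] bdd by (rule cSUP_upper)
    then show "\<forall>\<^sub>F i in \<U>. F i (b i) \<le> s i" by simp
  qed
  have "(SUP b\<in>sections. l b) = m"
  proof (rule antisym)
    show "(SUP b\<in>sections. l b) \<le> m" using sne le by (rule cSUP_least)
    show "m \<le> (SUP b\<in>sections. l b)"
    proof (rule field_le_epsilon)
      fix e :: real assume e: "0 < e"
      have "\<exists>a\<in>univ (G i). s i - e < F i a" for i
        using less_cSUP_iff[OF ne bdd, of "s i - e" i] e by (simp add: s_def)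
      then obtain b where b: "\<And>i. b i \<in> univ (G i)" "\<And>i. s i - e < F i (b i)" by metis
      then have bs: "b \<in> sections" by (simp add: sections_def)
      have "m - e \<le> l b"
      proof (rule tendsto_le[OF nontrivial lim[OF bs]])
        show "((\<lambda>i. s i - e) \<longlongrightarrow> m - e) \<U>" by (intro tendsto_intros m)
        show "\<forall>\<^sub>F i in \<U>. s i - e \<le> F i (b i)" using b(2) by (simp add: less_imp_le)
      qed
      also have "l b \<le> (SUP b\<in>sections. l b)"
        using bs le by (intro cSUP_upper bdd_aboveI2[of _ _ m]) auto
      finally show "m \<le> (SUP b\<in>sections. l b) + e" by simp
    qed
  qed
  moreover have "(\<lambda>i. SUP a\<in>univ (G i). F i a) = s" by (rule ext) (simp add: s_def)
  ultimately show ?thesis using m by (simp only:)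
qed

theorem Los:
  assumes "\<And>n. v n \<in> sections" "wf_metric L (univ M) \<phi>"
  shows "((\<lambda>i. metric_val (G i) (\<lambda>n. v n i) (fm_at i \<phi>)) \<longlongrightarrow> metric_val M (\<lambda>n. cls (v n)) \<phi>) \<U>"
  using assms
proof (induction \<phi> arbitrary: v)
  case (Dist s t)
  then show ?case
    using trm_val_M[of v] trm_val_at_section[of v] metr_M_cls by (simp add: fm_at_simps)
next
  case (Pred r ts)
  then have wf: "\<forall>s\<in>set ts. wf_trm L (univ M) s" "r \<in> rel_syms L" "length ts = rel_arity L r"
    by simp_all
  obtain as where as: "set as \<subseteq> sections" "length as = length ts"
    "map (trm_val M (\<lambda>n. cls (v n))) ts = map cls as"
    "\<And>i. map (trm_val (G i) (\<lambda>n. v n i)) (map (trm_at i) ts) = map (\<lambda>a. a i) as"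
    by (rule trm_vals_M[of v ts, OF Pred.prems(1) wf(1)]) (rule that)
  show ?case
    unfolding fm_at_simps metric_val.simps as(3,4) using as(1,2) wf(2,3) by (intro pred_M_cls) auto
next
  case (Conn u \<phi>s)
  have cont: "continuous_map (Euclidean_space (length \<phi>s)) euclideanreal u" using Conn.prems by simp
  let ?x = "\<lambda>i k. if k < length \<phi>s then metric_val (G i) (\<lambda>n. v n i) (fm_at i (\<phi>s ! k)) else 0"
  let ?y = "\<lambda>k. if k < length \<phi>s then metric_val M (\<lambda>n. cls (v n)) (\<phi>s ! k) else 0"
  have "limitin (Euclidean_space (length \<phi>s)) ?x ?y \<U>"
  proof (rule limitin_Euclidean_space)
    fix k assume k: "k < length \<phi>s"
    have "((\<lambda>i. metric_val (G i) (\<lambda>n. v n i) (fm_at i (\<phi>s ! k))) \<longlongrightarrow> metric_val M (\<lambda>n. cls (v n)) (\<phi>s ! k)) \<U>"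
      using Conn.prems k by (intro Conn.IH nth_mem) auto
    then show "((\<lambda>i. ?x i k) \<longlongrightarrow> ?y k) \<U>" using k by simp
  qed (simp_all add: topspace_Euclidean_space)
  from continuous_map_limit[OF cont this] have "((\<lambda>i. u (?x i)) \<longlongrightarrow> u ?y) \<U>" by (simp add: o_def)
  moreover have "metric_val (G i) (\<lambda>n. v n i) (fm_at i (Conn u \<phi>s)) = u (?x i)" for i
    unfolding fm_at_simps metric_val.simps by (rule arg_cong[of _ _ u]) (auto simp: fun_eq_iff)
  moreover have "metric_val M (\<lambda>n. cls (v n)) (Conn u \<phi>s) = u ?y"
    unfolding metric_val.simps by (rule arg_cong[of _ _ u]) (auto simp: fun_eq_iff)
  ultimately show ?case by simp
next
  case (SupQ x \<phi>)
  have IH: "((\<lambda>i. metric_val (G i) ((\<lambda>n. v n i)(x := b i)) (fm_at i \<phi>)) \<longlongrightarrow>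
      metric_val M ((\<lambda>n. cls (v n))(x := cls b)) \<phi>) \<U>" if "b \<in> sections" for b
  proof -
    have "(\<lambda>n. cls ((v(x := b)) n)) = (\<lambda>n. cls (v n))(x := cls b)"
      "\<And>i. (\<lambda>n. (v(x := b)) n i) = (\<lambda>n. v n i)(x := b i)" by (auto simp: fun_eq_iff)
    moreover have "((\<lambda>i. metric_val (G i) (\<lambda>n. (v(x := b)) n i) (fm_at i \<phi>)) \<longlongrightarrow>
        metric_val M (\<lambda>n. cls ((v(x := b)) n)) \<phi>) \<U>"
      using SupQ.prems that by (intro SupQ.IH) auto
    ultimately show ?thesis by simp
  qed
  obtain B where B: "\<And>i w. \<forall>n. w n \<in> univ (G i) \<Longrightarrow> \<bar>metric_val (G i) w (fm_at i \<phi>)\<bar> \<le> B"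
    using metric_val_bounded[of \<phi>] SupQ.prems by auto
  have "((\<lambda>i. SUP a\<in>univ (G i). metric_val (G i) ((\<lambda>n. v n i)(x := a)) (fm_at i \<phi>)) \<longlongrightarrow>
      (SUP b\<in>sections. metric_val M ((\<lambda>n. cls (v n))(x := cls b)) \<phi>)) \<U>"
    by (rule SUP_ultralimit[where B = B, OF _ IH]) (use sections_D[OF SupQ.prems(1)] in \<open>auto intro!: B\<close>)
  then show ?case by (simp add: fm_at_simps univ_M image_image)
next
  case (InfQ x \<phi>)
  have IH: "((\<lambda>i. metric_val (G i) ((\<lambda>n. v n i)(x := b i)) (fm_at i \<phi>)) \<longlongrightarrow>
      metric_val M ((\<lambda>n. cls (v n))(x := cls b)) \<phi>) \<U>" if "b \<in> sections" for b
  proof -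
    have "(\<lambda>n. cls ((v(x := b)) n)) = (\<lambda>n. cls (v n))(x := cls b)"
      "\<And>i. (\<lambda>n. (v(x := b)) n i) = (\<lambda>n. v n i)(x := b i)" by (auto simp: fun_eq_iff)
    moreover have "((\<lambda>i. metric_val (G i) (\<lambda>n. (v(x := b)) n i) (fm_at i \<phi>)) \<longlongrightarrow>
        metric_val M (\<lambda>n. cls ((v(x := b)) n)) \<phi>) \<U>"
      using InfQ.prems that by (intro InfQ.IH) auto
    ultimately show ?thesis by simp
  qed
  obtain B where B: "\<And>i w. \<forall>n. w n \<in> univ (G i) \<Longrightarrow> \<bar>metric_val (G i) w (fm_at i \<phi>)\<bar> \<le> B"
    using metric_val_bounded[of \<phi>] InfQ.prems by auto
  have "((\<lambda>i. SUP a\<in>univ (G i). - metric_val (G i) ((\<lambda>n. v n i)(x := a)) (fm_at i \<phi>)) \<longlongrightarrow>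
      (SUP b\<in>sections. - metric_val M ((\<lambda>n. cls (v n))(x := cls b)) \<phi>)) \<U>"
    by (rule SUP_ultralimit[where B = B, OF _ tendsto_minus[OF IH]])
      (use sections_D[OF InfQ.prems(1)] in \<open>auto intro!: B\<close>)
  from tendsto_minus[OF this] show ?case
    unfolding fm_at_simps metric_val.simps uminus_SUP_uminus univ_M image_image .
qed

lemma metric_val_M_bounded:
  assumes "wf_metric L (univ M) \<phi>"
  obtains B where "\<And>A. A \<in> univ M \<Longrightarrow> \<bar>metric_val M (\<lambda>_. A) \<phi>\<bar> \<le> B"
proof -
  obtain B where B: "\<And>i w. \<forall>n. w n \<in> univ (G i) \<Longrightarrow> \<bar>metric_val (G i) w (fm_at i \<phi>)\<bar> \<le> B"
    using metric_val_bounded[OF assms] by auto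
  show ?thesis
  proof (rule that[of B])
    fix A assume "A \<in> univ M"
    then obtain a where a: "a \<in> sections" "A = cls a" using univ_M by auto
    have "((\<lambda>i. \<bar>metric_val (G i) (\<lambda>_. a i) (fm_at i \<phi>)\<bar>) \<longlongrightarrow> \<bar>metric_val M (\<lambda>_. A) \<phi>\<bar>) \<U>"
      using tendsto_rabs[OF Los[of "\<lambda>_. a", OF a(1) assms]] a(2) by simp
    then show "\<bar>metric_val M (\<lambda>_. A) \<phi>\<bar> \<le> B"
      by (rule tendsto_upperbound[OF _ always_eventually nontrivial])
        (use B sections_D[OF a(1)] in simp)
  qed
qed

text \<open>The limit of the types of elements along \<open>F\<close>, taken formula by formula;
  boundedness of each formula on \<open>M\<close> makes it a genuine limit when \<open>F\<close> is
  an ultrafilter on the universe.\<close>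

definition type_limit :: "('i \<Rightarrow> 'a) set filter \<Rightarrow> (('i \<Rightarrow> 'a) set, 'f, 'r) metric_fm \<Rightarrow> real" where
  "type_limit F = (\<lambda>\<phi>\<in>metric_fms L M. Lim F (\<lambda>A. metric_val M (\<lambda>_. A) \<phi>))"

lemma type_limit_tendsto:
  assumes F: "ultrafilter F" "\<forall>\<^sub>F A in F. A \<in> univ M" and \<phi>: "\<phi> \<in> metric_fms L M"
  shows "((\<lambda>A. metric_val M (\<lambda>_. A) \<phi>) \<longlongrightarrow> type_limit F \<phi>) F"
proof -
  have "wf_metric L (univ M) \<phi>" using \<phi> by (simp add: metric_fms_def)
  then obtain B where B: "\<And>A. A \<in> univ M \<Longrightarrow> \<bar>metric_val M (\<lambda>_. A) \<phi>\<bar> \<le> B"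
    by (rule metric_val_M_bounded) blast
  have "\<forall>\<^sub>F A in F. \<bar>metric_val M (\<lambda>_. A) \<phi>\<bar> \<le> B" using F(2) by eventually_elim (rule B)
  from ultrafilter_bounded_tendsto[OF F(1) this] show ?thesis using \<phi> by (simp add: type_limit_def)
qed

lemma eventually_near_type_limit:
  assumes F: "ultrafilter F" "\<forall>\<^sub>F A in F. A \<in> univ M"
    and \<Phi>: "finite \<Phi>" "\<Phi> \<subseteq> metric_fms L M" and \<epsilon>: "0 < \<epsilon>"
  shows "\<forall>\<^sub>F A in F. \<forall>\<phi>\<in>\<Phi>. \<bar>metric_val M (\<lambda>_. A) \<phi> - type_limit F \<phi>\<bar> < \<epsilon>"
proof (rule eventually_ball_finite[OF \<Phi>(1)], rule ballI)
  fix \<phi> assume "\<phi> \<in> \<Phi>"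
  then have "((\<lambda>A. metric_val M (\<lambda>_. A) \<phi>) \<longlongrightarrow> type_limit F \<phi>) F"
    using \<Phi>(2) by (intro type_limit_tendsto[OF F]) auto
  from tendstoD[OF this \<epsilon>] show "\<forall>\<^sub>F A in F. \<bar>metric_val M (\<lambda>_. A) \<phi> - type_limit F \<phi>\<bar> < \<epsilon>"
    by (simp add: dist_real_def)
qed

lemma type_limit_in_types:
  assumes F: "ultrafilter F" "\<forall>\<^sub>F A in F. A \<in> univ M"
  shows "type_limit F \<in> metric_types L M"
proof -
  have "\<exists>A\<in>univ M. \<forall>\<phi>\<in>\<Phi>. \<bar>metric_val M (\<lambda>_. A) \<phi> - type_limit F \<phi>\<bar> < \<epsilon>"
    if "finite \<Phi>" "\<Phi> \<subseteq> metric_fms L M" "0 < \<epsilon>" for \<Phi> \<epsilon>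
  proof -
    have "\<forall>\<^sub>F A in F. A \<in> univ M \<and> (\<forall>\<phi>\<in>\<Phi>. \<bar>metric_val M (\<lambda>_. A) \<phi> - type_limit F \<phi>\<bar> < \<epsilon>)"
      using F(2) eventually_near_type_limit[OF F that] by (rule eventually_conj)
    from eventually_happens'[OF _ this] show ?thesis using F(1) by (auto simp: ultrafilter_def)
  qed
  then show ?thesis by (simp add: metric_types_def type_limit_def)
qed

lemma metric_tp_in_types:
  assumes "A \<in> univ M"
  shows "metric_tp L M A \<in> metric_types L M"
proof -
  have "\<exists>A'\<in>univ M. \<forall>\<phi>\<in>\<Phi>. \<bar>metric_val M (\<lambda>_. A') \<phi> - metric_tp L M A \<phi>\<bar> < \<epsilon>"
    if "\<Phi> \<subseteq> metric_fms L M" "0 < \<epsilon>" for \<Phi> \<epsilon>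
    using that assms by (intro bexI[of _ A]) (auto simp: metric_tp_def)
  then show ?thesis by (simp add: metric_types_def metric_tp_def)
qed

lemma topspace_metric_type_space: "topspace (metric_type_space L M) = metric_types L M"
proof -
  have "metric_types L M \<subseteq> extensional (metric_fms L M)" unfolding metric_types_def by blast
  then show ?thesis by (simp add: metric_type_space_def PiE_def Int_absorb1)
qed

text \<open>An open set of the product constrains only finitely many formulas near \<open>p\<close>,
  and the minimum of their radii serves as \<epsilon>.\<close>

lemma openin_metric_type_space:
  assumes "openin (metric_type_space L M) Q" "p \<in> Q"
  obtains \<Phi> \<epsilon> where "finite \<Phi>" "\<Phi> \<subseteq> metric_fms L M" "0 < \<epsilon>"
    "\<And>q. q \<in> metric_types L M \<Longrightarrow> (\<And>\<phi>. \<phi> \<in> \<Phi> \<Longrightarrow> \<bar>q \<phi> - p \<phi>\<bar> < \<epsilon>) \<Longrightarrow> q \<in> Q"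
proof -
  let ?I = "metric_fms L M"
  obtain S where S: "openin (product_topology (\<lambda>_. euclideanreal) ?I) S" "Q = S \<inter> metric_types L M"
    using assms(1) unfolding metric_type_space_def openin_subtopology by blast
  then have "p \<in> S" using assms(2) by blast
  from product_topology_open_contains_basis[OF S(1) this] obtain X where
    X: "p \<in> Pi\<^sub>E ?I X" "\<And>i. openin euclideanreal (X i)" "finite {i. X i \<noteq> UNIV}" "Pi\<^sub>E ?I X \<subseteq> S" by auto
  define \<Phi> where "\<Phi> = {\<phi> \<in> ?I. X \<phi> \<noteq> UNIV}"
  have fin: "finite \<Phi>" unfolding \<Phi>_def by (rule finite_subset[OF _ X(3)]) auto
  have "\<exists>e>0. ball (p \<phi>) e \<subseteq> X \<phi>" if "\<phi> \<in> \<Phi>" for \<phi>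
  proof -
    have "open (X \<phi>)" "p \<phi> \<in> X \<phi>" using X(1) X(2)[of \<phi>] that by (auto simp: PiE_iff \<Phi>_def)
    then show ?thesis by (auto simp: open_contains_ball)
  qed
  then obtain e where e: "\<And>\<phi>. \<phi> \<in> \<Phi> \<Longrightarrow> 0 < e \<phi> \<and> ball (p \<phi>) (e \<phi>) \<subseteq> X \<phi>" by metis
  define \<epsilon> where "\<epsilon> = Min (insert 1 (e ` \<Phi>))"
  show ?thesis
  proof (rule that[of \<Phi> \<epsilon>])
    show "0 < \<epsilon>" unfolding \<epsilon>_def using e fin by (subst Min_gr_iff) auto
    fix q assume q: "q \<in> metric_types L M" "\<And>\<phi>. \<phi> \<in> \<Phi> \<Longrightarrow> \<bar>q \<phi> - p \<phi>\<bar> < \<epsilon>"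
    have "q \<phi> \<in> X \<phi>" if "\<phi> \<in> ?I" for \<phi>
    proof (cases "\<phi> \<in> \<Phi>")
      case True
      then have "\<epsilon> \<le> e \<phi>" unfolding \<epsilon>_def using fin by (intro Min_le) auto
      then have "q \<phi> \<in> ball (p \<phi>) (e \<phi>)" using q(2)[OF True] by (simp add: dist_real_def abs_minus_commute)
      then show ?thesis using e[OF True] by blast
    next
      case False
      then show ?thesis using that by (auto simp: \<Phi>_def)
    qed
    moreover have "q \<in> extensional ?I" using q(1) by (simp add: metric_types_def)
    ultimately have "q \<in> Pi\<^sub>E ?I X" unfolding PiE_iff by blast
    then show "q \<in> Q" using X(4) S(2) q(1) by blast
  qed (use fin in \<open>auto simp: \<Phi>_def\<close>)
qed

text \<open>Basic neighbourhoods of a type, pulled back to \<open>M\<close>. The data form one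
  triple so that a finite subcover can be recorded as a finite set of triples.\<close>

definition near ::
  "(('i \<Rightarrow> 'a) set, 'f, 'r) metric_fm set \<times> real \<times> ((('i \<Rightarrow> 'a) set, 'f, 'r) metric_fm \<Rightarrow> real) \<Rightarrow>
   ('i \<Rightarrow> 'a) set set" where
  "near = (\<lambda>(\<Phi>, \<epsilon>, p). {A \<in> univ M. \<forall>\<phi>\<in>\<Phi>. \<bar>metric_val M (\<lambda>_. A) \<phi> - p \<phi>\<bar> < \<epsilon>})"

text \<open>The classical argument with sets \<open>near\<close> in place of formulas. Strict
  inequalities become non-strict in a limit, so a margin is built in: finitely many halved
  neighbourhoods cover the preimage of \<open>D\<close>, and the condition with
  \<open>\<epsilon> / 2\<close> in the factors implies membership in the full neighbourhood, which
  \<tau> maps into \<open>O'\<close>.\<close>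

lemma definable_separation:
  assumes def: "metric_definable_map L M T \<tau>" and D: "closedin T D" and O': "openin T O'" and sub: "D \<subseteq> O'"
  shows "\<exists>X. \<forall>a\<in>sections. (\<tau> (cls a) \<in> D \<longrightarrow> (\<forall>\<^sub>F i in \<U>. a i \<in> X i)) \<and>
    ((\<forall>\<^sub>F i in \<U>. a i \<in> X i) \<longrightarrow> \<tau> (cls a) \<in> O')"
proof -
  obtain g where g: "continuous_map (metric_type_space L M) T g"
    and g\<tau>: "\<And>A. A \<in> univ M \<Longrightarrow> g (metric_tp L M A) = \<tau> A"
    using def unfolding metric_definable_map_def by blast
  define J where "J = {(\<Phi>, \<epsilon>, p). finite \<Phi> \<and> \<Phi> \<subseteq> metric_fms L M \<and> 0 < \<epsilon> \<and> near (\<Phi>, \<epsilon>, p) \<subseteq> \<tau> -` O'}"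
  define half where "half = (\<lambda>(\<Phi>, \<epsilon>, p). near (\<Phi>, \<epsilon> / 2, p))"
  have nbhd: "\<exists>\<Phi> \<epsilon>. finite \<Phi> \<and> \<Phi> \<subseteq> metric_fms L M \<and> 0 < \<epsilon> \<and> near (\<Phi>, \<epsilon>, type_limit F) \<subseteq> \<tau> -` Q"
    if F: "ultrafilter F" "\<forall>\<^sub>F A in F. A \<in> univ M" and Q: "openin T Q" "g (type_limit F) \<in> Q" for F Q
  proof -
    have "type_limit F \<in> {p \<in> topspace (metric_type_space L M). g p \<in> Q}"
      using type_limit_in_types[OF F] Q(2) by (simp add: topspace_metric_type_space)
    note p = this
    obtain \<Phi> \<epsilon> where \<Phi>: "finite \<Phi>" "\<Phi> \<subseteq> metric_fms L M" "0 < \<epsilon>"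
      and gQ: "\<And>q. q \<in> metric_types L M \<Longrightarrow> (\<And>\<phi>. \<phi> \<in> \<Phi> \<Longrightarrow> \<bar>q \<phi> - type_limit F \<phi>\<bar> < \<epsilon>) \<Longrightarrow>
        q \<in> {p \<in> topspace (metric_type_space L M). g p \<in> Q}"
      by (rule openin_metric_type_space[OF openin_continuous_map_preimage[OF g Q(1)] p]) blast
    have "\<tau> A \<in> Q" if A: "A \<in> near (\<Phi>, \<epsilon>, type_limit F)" for A
    proof -
      have AM: "A \<in> univ M" using A by (simp add: near_def)
      have "metric_tp L M A \<in> {p \<in> topspace (metric_type_space L M). g p \<in> Q}"
      proof (rule gQ[OF metric_tp_in_types[OF AM]])
        fix \<phi> assume "\<phi> \<in> \<Phi>"
        then show "\<bar>metric_tp L M A \<phi> - type_limit F \<phi>\<bar> < \<epsilon>"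
          using A \<Phi>(2) by (auto simp: near_def metric_tp_def)
      qed
      then show ?thesis using g\<tau>[OF AM] by simp
    qed
    then show ?thesis using \<Phi>(1-3) by blast
  qed
  obtain \<P> where \<P>: "finite \<P>" "\<P> \<subseteq> half ` J" "{A \<in> univ M. \<tau> A \<in> D} \<subseteq> \<Union>\<P>"
  proof (rule ultrafilter_cover)
    fix F assume F: "ultrafilter F" and ev: "\<forall>\<^sub>F A in F. A \<in> {A \<in> univ M. \<tau> A \<in> D}"
    have univ: "\<forall>\<^sub>F A in F. A \<in> univ M" using ev by eventually_elim simp
    have evnear: "\<forall>\<^sub>F A in F. A \<in> near (\<Phi>, \<epsilon>, type_limit F)"
      if "finite \<Phi>" "\<Phi> \<subseteq> metric_fms L M" "0 < \<epsilon>" for \<Phi> \<epsilon>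
      using eventually_near_type_limit[OF F univ that] univ by eventually_elim (simp add: near_def)
    have "g (type_limit F) \<in> D"
    proof (rule ccontr)
      assume "g (type_limit F) \<notin> D"
      moreover have "g (type_limit F) \<in> topspace T"
        using g type_limit_in_types[OF F univ] by (auto simp: continuous_map_def topspace_metric_type_space)
      ultimately have gp: "g (type_limit F) \<in> topspace T - D" by blast
      have "openin T (topspace T - D)" using D by blast
      from nbhd[OF F univ this gp] obtain \<Phi> \<epsilon> where \<Phi>: "finite \<Phi>" "\<Phi> \<subseteq> metric_fms L M" "0 < \<epsilon>"
        "near (\<Phi>, \<epsilon>, type_limit F) \<subseteq> \<tau> -` (topspace T - D)"
        by (elim exE conjE)
      from evnear[OF \<Phi>(1-3)] ev have "eventually (\<lambda>_. False) F"
        by eventually_elim (use \<Phi>(4) in blast)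
      then show False using F by (simp add: ultrafilter_def trivial_limit_def)
    qed
    then have "g (type_limit F) \<in> O'" using sub by blast
    from nbhd[OF F univ O' this] obtain \<Phi> \<epsilon> where
      \<Phi>: "finite \<Phi>" "\<Phi> \<subseteq> metric_fms L M" "0 < \<epsilon>" "near (\<Phi>, \<epsilon>, type_limit F) \<subseteq> \<tau> -` O'"
      by (elim exE conjE)
    then have "(\<Phi>, \<epsilon>, type_limit F) \<in> J" by (simp add: J_def)
    moreover have "\<forall>\<^sub>F A in F. A \<in> half (\<Phi>, \<epsilon>, type_limit F)"
      using evnear[OF \<Phi>(1,2), of "\<epsilon> / 2"] \<Phi>(3) by (simp add: half_def)
    ultimately show "\<exists>P\<in>half ` J. \<forall>\<^sub>F x in F. x \<in> P" by blast
  qed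
  from finite_subset_image[OF \<P>(1,2)] obtain J0 where J0: "finite J0" "J0 \<subseteq> J" "\<P> = half ` J0" by blast
  let ?near = "\<lambda>j i x. case j of (\<Phi>, \<epsilon>, p) \<Rightarrow>
      \<forall>\<phi>\<in>\<Phi>. \<bar>metric_val (G i) (\<lambda>_. x) (fm_at i \<phi>) - p \<phi>\<bar> < \<epsilon> / 2"
  have los: "(cls a \<in> half j \<longrightarrow> (\<forall>\<^sub>F i in \<U>. ?near j i (a i))) \<and>
      ((\<forall>\<^sub>F i in \<U>. ?near j i (a i)) \<longrightarrow> cls a \<in> near j)" if a: "a \<in> sections" and jJ: "j \<in> J" for a j
  proof -
    obtain \<Phi> \<epsilon> p where j: "j = (\<Phi>, \<epsilon>, p)" by (cases j)
    have fin: "finite \<Phi>" "\<Phi> \<subseteq> metric_fms L M" "0 < \<epsilon>" using jJ by (auto simp: J_def j)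
    have aM: "cls a \<in> univ M" using a univ_M by blast
    have lim: "((\<lambda>i. \<bar>metric_val (G i) (\<lambda>_. a i) (fm_at i \<phi>) - p \<phi>\<bar>) \<longlongrightarrow> \<bar>metric_val M (\<lambda>_. cls a) \<phi> - p \<phi>\<bar>) \<U>"
      if "\<phi> \<in> \<Phi>" for \<phi>
    proof -
      have "wf_metric L (univ M) \<phi>" using that fin(2) by (auto simp: metric_fms_def)
      from Los[of "\<lambda>_. a", OF a this] show ?thesis by (intro tendsto_intros)
    qed
    have "\<forall>\<^sub>F i in \<U>. ?near j i (a i)" if "cls a \<in> half j"
    proof -
      have "\<forall>\<^sub>F i in \<U>. \<forall>\<phi>\<in>\<Phi>. \<bar>metric_val (G i) (\<lambda>_. a i) (fm_at i \<phi>) - p \<phi>\<bar> < \<epsilon> / 2"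
        using that by (intro eventually_ball_finite[OF fin(1)] ballI order_tendstoD(2)[OF lim])
          (auto simp: half_def near_def j)
      then show ?thesis by (simp add: j)
    qed
    moreover have "cls a \<in> near j" if "\<forall>\<^sub>F i in \<U>. ?near j i (a i)"
    proof -
      have "\<bar>metric_val M (\<lambda>_. cls a) \<phi> - p \<phi>\<bar> < \<epsilon>" if \<phi>: "\<phi> \<in> \<Phi>" for \<phi>
      proof -
        have "\<forall>\<^sub>F i in \<U>. \<bar>metric_val (G i) (\<lambda>_. a i) (fm_at i \<phi>) - p \<phi>\<bar> \<le> \<epsilon> / 2"
          using \<open>\<forall>\<^sub>F i in \<U>. ?near j i (a i)\<close> by eventually_elim (use \<phi> in \<open>auto simp: j intro: less_imp_le\<close>)
        then have "\<bar>metric_val M (\<lambda>_. cls a) \<phi> - p \<phi>\<bar> \<le> \<epsilon> / 2"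
          by (rule tendsto_upperbound[OF lim[OF \<phi>] _ nontrivial])
        then show ?thesis using fin(3) by linarith
      qed
      then show ?thesis using aM by (simp add: near_def j)
    qed
    ultimately show ?thesis by blast
  qed
  show ?thesis
  proof (intro exI ballI conjI impI)
    let ?X = "\<lambda>i. {x. \<exists>j\<in>J0. ?near j i x}"
    fix a assume a: "a \<in> sections"
    have aM: "cls a \<in> univ M" using a univ_M by blast
    show "\<forall>\<^sub>F i in \<U>. a i \<in> ?X i" if aD: "\<tau> (cls a) \<in> D"
    proof -
      obtain j where j: "j \<in> J0" "cls a \<in> half j" using \<P>(3) aD aM J0(3) by blast
      then have "\<forall>\<^sub>F i in \<U>. ?near j i (a i)" using los[OF a, of j] J0(2) by blast
      then show ?thesis by eventually_elim (use j(1) in blast)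
    qed
    show "\<tau> (cls a) \<in> O'" if "\<forall>\<^sub>F i in \<U>. a i \<in> ?X i"
    proof -
      have "\<forall>\<^sub>F i in \<U>. \<exists>j\<in>J0. ?near j i (a i)" using that by eventually_elim simp
      from ultrafilter_eventually_bex_finite[OF ultra J0(1) this] obtain j where
        j: "j \<in> J0" "\<forall>\<^sub>F i in \<U>. ?near j i (a i)" by blast
      then have "cls a \<in> near j" using los[OF a, of j] J0(2) by blast
      moreover have "near j \<subseteq> \<tau> -` O'" using j(1) J0(2) by (auto simp: J_def)
      ultimately show ?thesis by blast
    qed
  qed
qed

end

section \<open>The theorem in both logics\<close>

theorem theorem4p12:
  fixes \<U> :: "'i filter"
    and K :: "('k, 'z) monoid_scheme" and T :: "'k topology"
    and n :: nat and \<A> :: "'k chart set"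
  assumes "ultrafilter \<U>" and "countably_incomplete \<U>"
    and "Lie_group n K T \<A>" and "compact_space T"
  shows
    "(\<forall>(L :: ('f, 'r) lang) (G :: 'i \<Rightarrow> ('a, 'f, 'r) fo_structure) \<tau>.
        extends_group_language L \<and>
        (\<forall>i. is_fo_structure L (G i) \<and> expands_amenable_group L (G i)) \<and>
        \<tau> \<in> hom (group_reduct L (fo_ultraproduct \<U> G)) K \<and>
        fo_definable_map L (fo_ultraproduct \<U> G) T \<tau> \<longrightarrow>
        (\<exists>\<sigma> :: 'i \<Rightarrow> 'a \<Rightarrow> 'k.
           (\<forall>i. \<sigma> i \<in> hom (group_reduct L (G i)) K) \<and>
           (\<forall>A \<in> univ (fo_ultraproduct \<U> G). \<forall>a \<in> A.
              limitin T (\<lambda>i. \<sigma> i (a i)) (\<tau> A) \<U>)))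
     \<and>
     (\<forall>(L :: ('f, 'r) metric_lang) (G :: 'i \<Rightarrow> ('a, 'f, 'r) metric_structure) \<tau>.
        is_metric_lang L \<and> extends_group_language L \<and>
        (\<forall>i. is_metric_structure L (G i) \<and> expands_amenable_group L (G i)) \<and>
        \<tau> \<in> hom (group_reduct L (metric_ultraproduct \<U> G)) K \<and>
        metric_definable_map L (metric_ultraproduct \<U> G) T \<tau> \<longrightarrow>
        (\<exists>\<sigma> :: 'i \<Rightarrow> 'a \<Rightarrow> 'k.
           (\<forall>i. \<sigma> i \<in> hom (group_reduct L (G i)) K) \<and>
           (\<forall>A \<in> univ (metric_ultraproduct \<U> G). \<forall>a \<in> A.
              limitin T (\<lambda>i. \<sigma> i (a i)) (\<tau> A) \<U>)))"
proof -
  obtain V l R C where chart: "almost_additive_chart K T (coord_space n) V l R C"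
    using Lie_group_almost_additive_chart[OF assms(3,4)] by blast
  show ?thesis
  proof (intro conjI allI impI, goal_cases)
    case (1 L G \<tau>)
    then interpret fo_structure_family \<U> L G using assms(1) by unfold_locales auto
    show ?case
      by (rule homomorphism_limit[OF chart assms(1,2)]) (use 1 definable_separation in auto)
  next
    case (2 L G \<tau>)
    then interpret metric_structure_family \<U> L G using assms(1) by unfold_locales auto
    show ?case
      by (rule homomorphism_limit[OF chart assms(1,2)]) (use 2 definable_separation in auto)
  qed
qed

end
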